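(* Let $\mathcal G=(V,E)$ be a bipartite planar graph with $n$ vertices, let $\nu\colon E\to\mathbb R_{>0}$ be a positive real weight function on the edges, and let $\Phi=\{\phi_{vv'}\}$ be an $\mathrm{SL}_2(\mathbb C)$-connection on a $\mathbb C^2$-bundle on $\mathcal G$. Let $K=(K(v,v'))_{v,v'\in V}$, $K(v,v')=K_\nu(v,v')\,\phi_{vv'}$, be the associated Kasteleyn matrix, and let $\nu(\omega)$ be the connection-weight of a double-dimer configuration $\omega\in\Omega(\mathcal G)$. Then $$Z_{dd}=\sum_{\omega\in\Omega(\mathcal G)}\nu(\omega)=\mathrm{Qdet}\,K .$$
   Context: **Double-dimer configurations.** $\Omega(\mathcal G)$ is the set of coverings $\omega$ of $\mathcal G$ by collections of edges which form simple cycles of even length or doubled edges, so that every vertex is the endpoint of exactly two edges (which may be the same edge, doubled). **Connection.** An $\mathrm{SL}_2(\mathbb C)$-connection assigns to each oriented edge $vv'$ a parallel transport $\phi_{vv'}\in\mathrm{SL}_2(\mathbb C)$, written as a matrix in the standard basis of $\mathbb C^2$, with $\phi_{v'v}=\phi_{vv'}^{-1}$. The monodromy of an oriented closed path is the product of the parallel transports along it. **Weight.** $$\nu(\omega)=\prod_{e}\nu(e)\prod_{\text{cycles}}\mathrm{Tr}(w),$$ where the first product is over the edges of $\omega$ (doubled edges are counted twice), the second product is over the nontrivial cycles of $\omega$ (that is, not the doubled edges), and $w$ is the monodromy of the cycle in one direction or the other (note $\mathrm{Tr}(w)=\mathrm{Tr}(w^{-1})$). **Kasteleyn matrix.** $K_\nu$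 is the usual weighted signed scalar Kasteleyn matrix indexed by all vertices: $K_\nu(v,v')=K_\nu(v',v)=\pm\nu(vv')$ if $v,v'$ are adjacent and $0$ otherwise, with one sign for each edge, chosen so that the number of minus signs around each face of length $\ell$ is congruent to $\frac{\ell}{2}+1 \bmod 2$. The entries of $K$ are thus $2\times2$ complex matrices, and $K$ is self-dual: $K(v,v')=K(v',v)^*$, where $\begin{pmatrix}a&b\\c&d\end{pmatrix}^*=\begin{pmatrix}d&-b\\-c&a\end{pmatrix}$. **Quaternion determinant.** For a self-dual $n\times n$ matrix $K$ with $2\times 2$ complex matrix entries, $$\mathrm{Qdet}\,K=\sum_{\sigma\in S_n}\mathrm{sgn}(\sigma)\prod_{\text{cycles }C\text{ of }\sigma}\tfrac12\mathrm{Tr}(K_C),$$ where for a cycle $C=(v_1\to v_2\to\dots\to v_k\to v_1)$ one sets $K_C=K_{v_1v_2}K_{v_2v_3}\cdots K_{v_kv_1}$.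
   Formalization: The printed identity fails for a single edge (n=2, weight 1, trivial connection: Z_dd=1, Qdet K=-1); what is proved is Z_dd=(-1)^{⌊n/2⌋} Qdet K, with the sign condition required only at bounded faces of each connected component drawn by itself. *)

theory Defs
  imports "HOL-Analysis.Analysis" "HOL-Combinatorics.Orbits" "HOL-Library.Multiset"
begin

section \<open>Bipartite graphs drawn in the plane\<close>

definition simple_graph :: "'v set \<Rightarrow> 'v set set \<Rightarrow> bool" where
  "simple_graph V E \<longleftrightarrow> finite V \<and> (\<forall>e\<in>E. \<exists>u\<in>V. \<exists>v\<in>V. u \<noteq> v \<and> e = {u, v})"

definition bipartite_graph :: "'v set \<Rightarrow> 'v set set \<Rightarrow> bool" where
  "bipartite_graph V E \<longleftrightarrow> simple_graph V E \<and>
     (\<exists>B W. B \<union> W = V \<and> B \<inter> W = {} \<and> (\<forall>e\<in>E. \<exists>b\<in>B. \<exists>w\<in>W. e = {b, w}))"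

text \<open>A vertex \<open>v\<close> is drawn as the point \<open>pos v\<close> and an edge \<open>e\<close> as the Jordan arc \<open>\<gamma> e\<close>; arcs meet
  vertices and each other only in common endpoints.\<close>

definition plane_embedding ::
    "'v set \<Rightarrow> 'v set set \<Rightarrow> ('v \<Rightarrow> complex) \<Rightarrow> ('v set \<Rightarrow> real \<Rightarrow> complex) \<Rightarrow> bool" where
  "plane_embedding V E pos \<gamma> \<longleftrightarrow>
     inj_on pos V \<and>
     (\<forall>e\<in>E. arc (\<gamma> e) \<and> {pathstart (\<gamma> e), pathfinish (\<gamma> e)} = pos ` e
            \<and> path_image (\<gamma> e) \<inter> pos ` V = pos ` e) \<and>
     (\<forall>e\<in>E. \<forall>e'\<in>E. e \<noteq> e' \<longrightarrow>
            path_image (\<gamma> e) \<inter> path_image (\<gamma> e') = pos ` (e \<inter> e'))"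

definition graph_components :: "'v set \<Rightarrow> 'v set set \<Rightarrow> 'v set set" where
  "graph_components V E = V // ({(u, v). u \<in> V \<and> v \<in> V \<and> {u, v} \<in> E}\<^sup>* \<inter> V \<times> V)"

definition induced_edges :: "'v set set \<Rightarrow> 'v set \<Rightarrow> 'v set set" where
  "induced_edges E U = {e \<in> E. e \<subseteq> U}"

definition drawing ::
    "('v \<Rightarrow> complex) \<Rightarrow> ('v set \<Rightarrow> real \<Rightarrow> complex) \<Rightarrow> 'v set \<Rightarrow> 'v set set \<Rightarrow> complex set" where
  "drawing pos \<gamma> V E = pos ` V \<union> (\<Union>e\<in>E. path_image (\<gamma> e))"

definition faces ::
    "('v \<Rightarrow> complex) \<Rightarrow> ('v set \<Rightarrow> real \<Rightarrow> complex) \<Rightarrow> 'v set \<Rightarrow> 'v set set \<Rightarrow> complex set set" where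
  "faces pos \<gamma> V E = components (- drawing pos \<gamma> V E)"

text \<open>The number of times the boundary walk of the face \<open>f\<close> runs along the edge \<open>e\<close>: an edge with
  the same face on both of its sides is traversed twice.\<close>

definition face_mult ::
    "('v \<Rightarrow> complex) \<Rightarrow> ('v set \<Rightarrow> real \<Rightarrow> complex) \<Rightarrow> 'v set \<Rightarrow> 'v set set \<Rightarrow>
     complex set \<Rightarrow> 'v set \<Rightarrow> nat" where
  "face_mult pos \<gamma> V E f e =
     (if path_image (\<gamma> e) \<subseteq> frontier f
      then if \<exists>f'\<in>faces pos \<gamma> V E. f' \<noteq> f \<and> path_image (\<gamma> e) \<subseteq> frontier f' then 1 else 2
      else 0)"

definition face_length ::
    "('v \<Rightarrow> complex) \<Rightarrow> ('v set \<Rightarrow> real \<Rightarrow> complex) \<Rightarrow> 'v set \<Rightarrow> 'v set set \<Rightarrow> complex set \<Rightarrow> nat" where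
  "face_length pos \<gamma> V E f = (\<Sum>e\<in>E. face_mult pos \<gamma> V E f e)"

definition face_minus_signs ::
    "('v \<Rightarrow> complex) \<Rightarrow> ('v set \<Rightarrow> real \<Rightarrow> complex) \<Rightarrow> 'v set \<Rightarrow> 'v set set \<Rightarrow> ('v set \<Rightarrow> real) \<Rightarrow>
     complex set \<Rightarrow> nat" where
  "face_minus_signs pos \<gamma> V E \<epsilon> f = (\<Sum>e\<in>{e \<in> E. \<epsilon> e = -1}. face_mult pos \<gamma> V E f e)"

text \<open>The boundary of a face is a single closed walk only for connected graphs, so the sign condition
  is imposed on each connected component, drawn by itself. Only bounded faces are constrained: for a
  connected graph with an even number of vertices the condition at the outer face follows, whereas
  for an odd number of vertices it could not be satisfied.\<close>

definition kasteleyn_signs ::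
    "'v set \<Rightarrow> 'v set set \<Rightarrow> ('v \<Rightarrow> complex) \<Rightarrow> ('v set \<Rightarrow> real \<Rightarrow> complex) \<Rightarrow>
     ('v set \<Rightarrow> real) \<Rightarrow> bool" where
  "kasteleyn_signs V E pos \<gamma> \<epsilon> \<longleftrightarrow>
     (\<forall>e\<in>E. \<epsilon> e = 1 \<or> \<epsilon> e = -1) \<and>
     (\<forall>U\<in>graph_components V E. \<forall>f\<in>faces pos \<gamma> U (induced_edges E U). bounded f \<longrightarrow>
        face_minus_signs pos \<gamma> U (induced_edges E U) \<epsilon> f mod 2
        = (face_length pos \<gamma> U (induced_edges E U) f div 2 + 1) mod 2)"


section \<open>Connections and the Kasteleyn matrix\<close>

definition SL2_connection :: "'v set set \<Rightarrow> ('v \<Rightarrow> 'v \<Rightarrow> complex^2^2) \<Rightarrow> bool" where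
  "SL2_connection E \<phi> \<longleftrightarrow>
     (\<forall>u v. {u, v} \<in> E \<longrightarrow> det (\<phi> u v) = 1 \<and> \<phi> v u = matrix_inv (\<phi> u v))"

definition scalar_kasteleyn ::
    "'v set set \<Rightarrow> ('v set \<Rightarrow> real) \<Rightarrow> ('v set \<Rightarrow> real) \<Rightarrow> 'v \<Rightarrow> 'v \<Rightarrow> real" where
  "scalar_kasteleyn E \<epsilon> \<nu> u v = (if {u, v} \<in> E then \<epsilon> {u, v} * \<nu> {u, v} else 0)"

definition kasteleyn_matrix ::
    "'v set set \<Rightarrow> ('v set \<Rightarrow> real) \<Rightarrow> ('v set \<Rightarrow> real) \<Rightarrow> ('v \<Rightarrow> 'v \<Rightarrow> complex^2^2) \<Rightarrow>
     'v \<Rightarrow> 'v \<Rightarrow> complex^2^2" where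
  "kasteleyn_matrix E \<epsilon> \<nu> \<phi> u v = scalar_kasteleyn E \<epsilon> \<nu> u v *\<^sub>R \<phi> u v"

text \<open>Ordered matrix product; the operation \<open>*\<close> on \<open>complex^2^2\<close> is entrywise, so \<open>prod_list\<close>
  cannot be used.\<close>

definition matrix_prod :: "(complex^2^2) list \<Rightarrow> complex^2^2" where
  "matrix_prod As = foldr (**) As (mat 1)"


section \<open>The quaternion determinant\<close>

definition perm_cycle_prod ::
    "('v \<Rightarrow> 'v \<Rightarrow> complex^2^2) \<Rightarrow> ('v \<Rightarrow> 'v) \<Rightarrow> 'v \<Rightarrow> complex^2^2" where
  "perm_cycle_prod K \<sigma> v =
     matrix_prod (map (\<lambda>i. K ((\<sigma> ^^ i) v) ((\<sigma> ^^ Suc i) v)) [0..<card (orbit \<sigma> v)])"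

text \<open>The cycles of \<open>\<sigma>\<close>, fixed points included, are its orbits. The trace does not depend on the
  starting vertex chosen in an orbit.\<close>

definition Qdet :: "'v set \<Rightarrow> ('v \<Rightarrow> 'v \<Rightarrow> complex^2^2) \<Rightarrow> complex" where
  "Qdet V K =
     (\<Sum>\<sigma> | \<sigma> permutes V. of_int (sign \<sigma>) *
        (\<Prod>C\<in>orbit \<sigma> ` V. (1/2) * trace (perm_cycle_prod K \<sigma> (SOME v. v \<in> C))))"


section \<open>Double-dimer configurations\<close>

text \<open>A simple cycle is given by the list of its vertices in cyclic order.\<close>

definition simple_cycle :: "'v set set \<Rightarrow> 'v list \<Rightarrow> bool" where
  "simple_cycle E p \<longleftrightarrow> length p \<ge> 3 \<and> distinct p \<and>
     (\<forall>i<length p. {p ! i, p ! (Suc i mod length p)} \<in> E)"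

definition cycle_edges :: "'v list \<Rightarrow> 'v set set" where
  "cycle_edges p = {{p ! i, p ! (Suc i mod length p)} | i. i < length p}"

definition monodromy :: "('v \<Rightarrow> 'v \<Rightarrow> complex^2^2) \<Rightarrow> 'v list \<Rightarrow> complex^2^2" where
  "monodromy \<phi> p = matrix_prod (map (\<lambda>i. \<phi> (p ! i) (p ! (Suc i mod length p))) [0..<length p])"

text \<open>A configuration is the multiset of its edges. The nontrivial cycles of \<open>\<omega>\<close> are recorded by
  their edge sets and consist of edges of multiplicity one.\<close>

definition dd_cycles :: "'v set set \<Rightarrow> 'v set multiset \<Rightarrow> 'v set set set" where
  "dd_cycles E \<omega> = {cycle_edges p | p. simple_cycle E p \<and> (\<forall>e\<in>cycle_edges p. count \<omega> e = 1)}"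

definition double_dimer_configs :: "'v set \<Rightarrow> 'v set set \<Rightarrow> 'v set multiset set" where
  "double_dimer_configs V E =
     {\<omega>. set_mset \<omega> \<subseteq> E \<and>
         (\<forall>v\<in>V. size {#e \<in># \<omega>. v \<in> e#} = 2) \<and>
         (\<forall>e\<in>set_mset \<omega>. count \<omega> e = 2 \<or> (\<exists>C\<in>dd_cycles E \<omega>. e \<in> C \<and> even (card C)))}"

text \<open>The trace of the monodromy is the same for every starting vertex and for both directions.\<close>

definition cycle_trace ::
    "'v set set \<Rightarrow> ('v \<Rightarrow> 'v \<Rightarrow> complex^2^2) \<Rightarrow> 'v set set \<Rightarrow> complex" where
  "cycle_trace E \<phi> C = trace (monodromy \<phi> (SOME p. simple_cycle E p \<and> cycle_edges p = C))"

definition dd_weight ::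
    "'v set set \<Rightarrow> ('v set \<Rightarrow> real) \<Rightarrow> ('v \<Rightarrow> 'v \<Rightarrow> complex^2^2) \<Rightarrow> 'v set multiset \<Rightarrow> complex" where
  "dd_weight E \<nu> \<phi> \<omega> =
     of_real (\<Prod>e\<in>#\<omega>. \<nu> e) * (\<Prod>C\<in>dd_cycles E \<omega>. cycle_trace E \<phi> C)"

definition Z_dd ::
    "'v set \<Rightarrow> 'v set set \<Rightarrow> ('v set \<Rightarrow> real) \<Rightarrow> ('v \<Rightarrow> 'v \<Rightarrow> complex^2^2) \<Rightarrow> complex" where
  "Z_dd V E \<nu> \<phi> = (\<Sum>\<omega>\<in>double_dimer_configs V E. dd_weight E \<nu> \<phi> \<omega>)"

text \<open>With symmetric signs, a doubled edge \<open>e\<close> corresponds to a transposition and contributes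
  \<open>- (\<nu> e)\<^sup>2\<close> to \<open>Qdet\<close>, and a cycle of length \<open>l\<close> contributes its weight times \<open>(-1) ^ (l div 2)\<close>.
  The partition function and \<open>Qdet\<close> therefore differ by the global sign \<open>(-1) ^ (n div 2)\<close>, where
  \<open>n\<close> is the number of vertices: for a single edge of weight \<open>a\<close> the former is \<open>a\<^sup>2\<close>
  and the latter \<open>- a\<^sup>2\<close>.\<close>

end

(* A permutation contributing to Qdet moves every vertex along an edge, hence determines a double-dimer
   configuration; each configuration arises from the 2^c choices of orientation of its c nontrivial
   cycles, and these choices have equal contributions. It remains to compute signs, that is, to show
   that a cycle of length l of the configuration carries l/2 + 1 minus signs modulo 2. Summing the
   Kasteleyn condition over the faces inside the cycle and using Euler's formula gives l/2 + 1 + m,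
   where m is the number of vertices inside; m is even because the permutation preserves these
   vertices and exchanges the two colour classes.

   The topology rests on Janiszewski's theorem: if X is compact and J is a closed curve with X \<inter> J
   connected, two points outside X \<union> J are separated by X \<union> J iff they are separated by X or by J.
   So an edge joining two vertices of a connected graph splits exactly one face, into its parts
   inside and outside of a cycle through that edge. *)

theory Submission
  imports Defs "HOL-Combinatorics.Cycles"
begin

section \<open>Separation of the plane by arcs and closed curves\<close>

text \<open>The Kasteleyn condition halves face lengths, so these must be even. This is the
  obstacle: the boundary walk of a face need not be a simple cycle, and bipartiteness says nothing
  about it directly. Hence faces are described, off the drawing, as sums modulo two of insides of
  cycles and the whole plane; total face length is even on each of these, and parity is additive.
  Euler's formula is needed only inside the given cycle. The component is rebuilt from that cycle by
  pendant edges and chords, so that the cycle and its inside stay fixed; one induction yields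
  finiteness, the description of the faces and Euler's formula. Janiszewski's theorem demands a
  connected intersection: a pendant edge meets the graph in a point, and a chord is completed by a
  path of the graph to a closed curve meeting the graph in that path. On the algebraic side, every
  orbit is even, so the global sign splits into one sign per orbit. Inversion in SL2 is the
  adjugate, which reverses products and keeps traces; so reversing a cycle changes nothing, and the
  number of orientations cancels the factors 1/2 of the nontrivial cycles. For a doubled edge, 1/2
  is cancelled by the trace 2 of the identity.\<close>

lemma interior_path_image_arc:
  fixes g :: "real \<Rightarrow> complex"
  assumes "arc g"
  shows "interior (path_image g) = {}"
proof (rule ccontr)
  assume ne: "interior (path_image g) \<noteq> {}"
  obtain h where h: "homeomorphism {0..1} (path_image g) g h"
    using homeomorphism_arc[OF assms] by blast
  \<comment> \<open>The inverse of the arc would embed a nonempty open subset of the plane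
    continuously into the line, against invariance of dimension.\<close>
  have "DIM(complex) \<le> DIM(real)"
  proof (rule invariance_of_dimension)
    show "continuous_on (interior (path_image g)) h"
      using h interior_subset continuous_on_subset homeomorphism_def by metis
    show "inj_on h (interior (path_image g))"
      using h interior_subset by (metis homeomorphism_def inj_on_inverseI inj_on_subset)
  qed (use ne in auto)
  then show False by simp
qed

text \<open>For an edge this is the part that avoids all vertices and all other edges; being
  connected, it lies in a single face of the graph without that edge.\<close>

definition open_arc :: "(real \<Rightarrow> complex) \<Rightarrow> complex set" where
  "open_arc g = path_image g - {pathstart g, pathfinish g}"

lemma open_arc_eq: "arc g \<Longrightarrow> open_arc g = g ` {0<..<1}"
  unfolding open_arc_def path_image_def pathstart_def pathfinish_def arc_def inj_on_def
  by (auto simp: image_iff) force+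

lemma connected_open_arc: "arc g \<Longrightarrow> connected (open_arc g)"
  unfolding open_arc_eq by (rule connected_continuous_image)
    (auto intro: continuous_on_subset simp: arc_def path_def)

lemma open_arc_nonempty: "arc g \<Longrightarrow> open_arc g \<noteq> {}"
  by (simp add: open_arc_eq)

text \<open>The open unit interval is dense in the closed one, and continuity carries this over.
  Thus a face with the interior of an edge in its closure has the whole edge there.\<close>

lemma path_image_subset_closure_open_arc:
  assumes "arc g" shows "path_image g \<subseteq> closure (open_arc g)"
proof -
  have "g ` closure {0<..<1} \<subseteq> closure (g ` {0<..<1})"
    by (rule image_closure_subset)
      (use assms in \<open>auto simp: arc_def path_def closure_subset\<close>)
  then show ?thesis using assms by (simp add: open_arc_eq path_image_def)
qed

text \<open>Janiszewski's theorem gives one direction, monotonicity the other. In this form it says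
  that the component of a point off \<open>X \<union> J\<close> is the intersection of its
  components off \<open>X\<close> and off \<open>J\<close>.\<close>

lemma connected_component_Compl_Un:
  fixes X :: "complex set"
  assumes "compact X" "closed J" "connected (X \<inter> J)"
  shows "connected_component (- (X \<union> J)) x y \<longleftrightarrow>
    connected_component (- X) x y \<and> connected_component (- J) x y"
  using Janiszewski[OF assms] connected_component_of_subset[of "- (X \<union> J)" x y]
  by (metis Compl_anti_mono Un_upper1 Un_upper2)

lemma components_Compl_Un:
  fixes X :: "complex set"
  assumes "compact X" "closed J" "connected (X \<inter> J)"
  shows "components (- (X \<union> J)) =
    {g \<inter> h | g h. g \<in> components (- X) \<and> h \<in> components (- J) \<and> g \<inter> h \<noteq> {}}"
proof -
  have *: "connected_component_set (- (X \<union> J)) x =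
      connected_component_set (- X) x \<inter> connected_component_set (- J) x" for x
    using connected_component_Compl_Un[OF assms] by auto
  show ?thesis
  proof (intro equalityI subsetI)
    fix f assume "f \<in> components (- (X \<union> J))"
    then obtain x where x: "x \<in> - (X \<union> J)" "f = connected_component_set (- (X \<union> J)) x"
      by (auto simp: components_iff)
    let ?g = "connected_component_set (- X) x" and ?h = "connected_component_set (- J) x"
    have "x \<in> ?g \<inter> ?h" using x connected_component_refl_eq by auto
    moreover have "f = ?g \<inter> ?h" using x * by blast
    moreover have "?g \<in> components (- X)" "?h \<in> components (- J)" using x by (auto intro!: componentsI)
    ultimately show "f \<in> {g \<inter> h | g h. g \<in> components (- X) \<and> h \<in> components (- J) \<and> g \<inter> h \<noteq> {}}"
      by blast
  next
    fix f assume "f \<in> {g \<inter> h | g h. g \<in> components (- X) \<and> h \<in> components (- J) \<and> g \<inter> h \<noteq> {}}"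
    then obtain g h x where gh: "g \<in> components (- X)" "h \<in> components (- J)" "f = g \<inter> h"
      "x \<in> g" "x \<in> h" by auto
    have "g = connected_component_set (- X) x" "h = connected_component_set (- J) x"
      using gh by (metis components_iff connected_component_eq)+
    moreover have "x \<in> - (X \<union> J)" using gh in_components_subset by blast
    ultimately show "f \<in> components (- (X \<union> J))"
      using * gh(3) unfolding components_def by blast
  qed
qed

lemma not_subset_path_image_arc:
  fixes g :: "complex set"
  assumes "arc T" "open g" "g \<noteq> {}"
  shows "g - path_image T \<noteq> {}"
proof
  assume "g - path_image T = {}"
  then have "g \<subseteq> interior (path_image T)" using assms(2) by (intro interior_maximal) auto
  then show False using interior_path_image_arc[OF assms(1)] assms(3) by blast
qed

lemma components_Compl_nonempty_open:
  fixes X :: "complex set"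
  assumes "compact X" "g \<in> components (- X)"
  shows "open g" "g \<noteq> {}" "connected g"
  using open_components[OF _ assms(2)] compact_imp_closed[OF assms(1)] in_components_nonempty[OF assms(2)]
    in_components_connected[OF assms(2)] by auto

lemma components_Compl_arc:
  "arc T \<Longrightarrow> components (- path_image T) = {- path_image T}" for T :: "real \<Rightarrow> complex"
  using connected_arc_complement[of T] not_subset_path_image_arc[of T UNIV]
  by (simp add: components_eq_sing_iff Compl_eq_Diff_UNIV)

text \<open>The complement of an arc is connected, so intersecting with it as in
  \<open>components_Compl_Un\<close> cuts no component in two; none becomes empty because an arc has
  empty interior.\<close>

lemma components_Compl_Un_arc:
  fixes X :: "complex set"
  assumes X: "compact X" and T: "arc T" and con: "connected (X \<inter> path_image T)"
  shows "components (- (X \<union> path_image T)) = (\<lambda>g. g - path_image T) ` components (- X)"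
proof -
  have ne: "g \<inter> - path_image T \<noteq> {}" if "g \<in> components (- X)" for g
    using not_subset_path_image_arc[OF T, of g] components_Compl_nonempty_open[OF X that] by blast
  show ?thesis
    unfolding components_Compl_Un[OF X closed_arc_image[OF T] con] components_Compl_arc[OF T]
  proof (intro equalityI subsetI)
    fix f assume "f \<in> (\<lambda>g. g - path_image T) ` components (- X)"
    then obtain g where "g \<in> components (- X)" "f = g \<inter> - path_image T" by blast
    then show "f \<in> {g \<inter> h |g h. g \<in> components (- X) \<and> h \<in> {- path_image T} \<and> g \<inter> h \<noteq> {}}"
      using ne[of g] by (intro CollectI exI[of _ g] exI[of _ "- path_image T"]) auto
  next
    fix f assume "f \<in> {g \<inter> h |g h. g \<in> components (- X) \<and> h \<in> {- path_image T} \<and> g \<inter> h \<noteq> {}}"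
    then obtain g where "g \<in> components (- X)" "f = g - path_image T" by blast
    then show "f \<in> (\<lambda>g. g - path_image T) ` components (- X)" by (rule rev_image_eqI)
  qed
qed

text \<open>The arc may meet \<open>X1 \<union> X2\<close> in a disconnected set, to which
  Janiszewski's theorem does not apply. Attaching it to \<open>X1\<close> first and adding
  \<open>X2\<close> afterwards makes both intersections connected.\<close>

lemma components_Compl_Un_bridge:
  fixes X1 X2 :: "complex set"
  assumes "compact X1" "compact X2" "X1 \<inter> X2 = {}" and T: "arc T"
    and con: "connected (X1 \<inter> path_image T)" "connected (X2 \<inter> path_image T)"
  shows "components (- (X1 \<union> X2 \<union> path_image T)) = (\<lambda>g. g - path_image T) ` components (- (X1 \<union> X2))"
proof -
  let ?T = "path_image T"
  have 1: "components (- (X1 \<union> ?T)) = (\<lambda>g. g - ?T) ` components (- X1)"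
    by (rule components_Compl_Un_arc) (use assms in auto)
  have 2: "components (- (X1 \<union> X2)) =
    {g \<inter> h | g h. g \<in> components (- X1) \<and> h \<in> components (- X2) \<and> g \<inter> h \<noteq> {}}"
    by (rule components_Compl_Un) (use assms compact_imp_closed in auto)
  have "components (- ((X1 \<union> ?T) \<union> X2)) =
    {g \<inter> h | g h. g \<in> components (- (X1 \<union> ?T)) \<and> h \<in> components (- X2) \<and> g \<inter> h \<noteq> {}}"
  proof (rule components_Compl_Un)
    show "compact (X1 \<union> ?T)" using assms compact_arc_image by blast
    show "closed X2" using assms compact_imp_closed by blast
    have "(X1 \<union> ?T) \<inter> X2 = X2 \<inter> ?T" using assms by blast
    then show "connected ((X1 \<union> ?T) \<inter> X2)" using con by simp
  qed
  also have "\<dots> = (\<lambda>g. g - ?T) ` components (- (X1 \<union> X2))"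
  proof (intro equalityI subsetI)
    fix f assume "f \<in> {g \<inter> h | g h. g \<in> components (- (X1 \<union> ?T)) \<and> h \<in> components (- X2) \<and> g \<inter> h \<noteq> {}}"
    then obtain g h where "g \<in> components (- X1)" "h \<in> components (- X2)" "f = (g - ?T) \<inter> h" "f \<noteq> {}"
      unfolding 1 by auto
    moreover from this have "f = (g \<inter> h) - ?T" "g \<inter> h \<in> components (- (X1 \<union> X2))"
      unfolding 2 by auto
    ultimately show "f \<in> (\<lambda>g. g - ?T) ` components (- (X1 \<union> X2))" by auto
  next
    fix f assume "f \<in> (\<lambda>g. g - ?T) ` components (- (X1 \<union> X2))"
    then obtain k where k: "k \<in> components (- (X1 \<union> X2))" "f = k - ?T" by blast
    then have "f \<noteq> {}"
      using not_subset_path_image_arc[OF T] components_Compl_nonempty_open[of "X1 \<union> X2" k] assms by blast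
    obtain g h where "g \<in> components (- X1)" "h \<in> components (- X2)" "k = g \<inter> h"
      using k unfolding 2 by auto
    moreover have "f = (g - ?T) \<inter> h" using calculation k by blast
    ultimately show "f \<in> {g \<inter> h | g h. g \<in> components (- (X1 \<union> ?T)) \<and> h \<in> components (- X2) \<and> g \<inter> h \<noteq> {}}"
      unfolding 1 using \<open>f \<noteq> {}\<close> by blast
  qed
  finally show ?thesis by (simp add: Un_ac)
qed

section \<open>Closed Jordan curves and chords\<close>

definition closed_curve :: "complex set \<Rightarrow> bool" where
  "closed_curve J \<longleftrightarrow> (\<exists>c. simple_path c \<and> pathfinish c = pathstart c \<and> path_image c = J)"

lemma closed_curveD:
  assumes "closed_curve J"
  shows "inside J \<noteq> {}" "open (inside J)" "connected (inside J)" "bounded (inside J)"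
    "outside J \<noteq> {}" "open (outside J)" "connected (outside J)" "\<not> bounded (outside J)"
    "inside J \<inter> outside J = {}" "inside J \<union> outside J = - J" "compact J" "closed J"
    "frontier (inside J) = J" "frontier (outside J) = J"
proof -
  obtain c where c: "simple_path c" "pathfinish c = pathstart c" "path_image c = J"
    using assms by (auto simp: closed_curve_def)
  note J = Jordan_inside_outside[OF c(1,2), unfolded c(3)]
  show "compact J" "closed J"
    using c compact_simple_path_image closed_simple_path_image by blast+
  show "inside J \<noteq> {}" "open (inside J)" "connected (inside J)" "bounded (inside J)"
    "outside J \<noteq> {}" "open (outside J)" "connected (outside J)" "\<not> bounded (outside J)"
    "inside J \<inter> outside J = {}" "inside J \<union> outside J = - J"
    "frontier (inside J) = J" "frontier (outside J) = J" using J by auto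
qed

lemma closed_curve_connected_side:
  assumes "closed_curve J" "connected g" "g \<inter> J = {}"
  shows "g \<subseteq> inside J \<or> g \<subseteq> outside J"
proof -
  note J = closed_curveD(2,6,9,10)[OF assms(1)]
  have "g \<subseteq> inside J \<union> outside J" using J(4) assms(3) by blast
  then show ?thesis
    using connectedD[OF assms(2) J(1,2)] J(3) by blast
qed

lemma components_Compl_closed_curve:
  assumes J: "closed_curve J"
  shows "components (- J) = {inside J, outside J}"
proof -
  note Js = closed_curveD[OF J]
  have sub: "C = inside J \<or> C = outside J" if C: "C \<in> components (- J)" for C
  proof -
    have "C \<subseteq> inside J \<or> C \<subseteq> outside J"
      using closed_curve_connected_side[OF J] in_components_connected[OF C] in_components_subset[OF C]
      by blast
    moreover have "inside J \<subseteq> - J" "outside J \<subseteq> - J"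
      using Js(10) by blast+
    moreover have "d = C" if "C \<subseteq> d" "d \<subseteq> - J" "connected d" for d
      using components_maximal[OF C that(3,2)] in_components_nonempty[OF C] that(1) by blast
    ultimately show ?thesis using Js(3,7) by metis
  qed
  have "s \<in> components (- J)" if s: "s = inside J \<or> s = outside J" for s
  proof -
    have "- J \<noteq> {}" using Js(1,10) by blast
    then obtain C where "C \<in> components (- J)" "s \<subseteq> C"
      using s exists_component_superset[of s "- J"] Js(3,7,10) by blast
    moreover from this have "C = s"
      using sub[of C] s Js(1,5,9) by (metis inf.absorb1 inf_commute)
    ultimately show ?thesis by simp
  qed
  then show ?thesis using sub by (intro equalityI subsetI) auto
qed

text \<open>The arc \<open>T\<close> completes an arc in \<open>X\<close> to the closed curve \<open>J\<close>, which then separates the two sides of \<open>T\<close>.\<close>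

locale chord =
  fixes X J :: "complex set" and T :: "real \<Rightarrow> complex" and g :: "complex set"
  assumes X: "compact X" and T: "arc T" and J: "closed_curve J"
    and con: "connected (X \<inter> J)" and Un: "X \<union> path_image T = X \<union> J"
    and sub: "path_image T \<subseteq> J" and ends: "X \<inter> path_image T = {pathstart T, pathfinish T}"
    and g: "g \<in> components (- X)" "open_arc T \<subseteq> g"
begin

lemma g_open: "open g" "g \<noteq> {}" "connected g"
  using components_Compl_nonempty_open[OF X] g by auto

lemma split_nonempty: "g \<inter> inside J \<noteq> {}" "g \<inter> outside J \<noteq> {}"
proof -
  obtain x where x: "x \<in> open_arc T" using open_arc_nonempty[OF T] by blast
  then have "x \<in> J" using sub by (auto simp: open_arc_def)
  \<comment> \<open>Every point of a closed curve is a limit of both sides, and \<open>g\<close> is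
    a neighbourhood of this one.\<close>
  then have "x \<in> closure (inside J)" "x \<in> closure (outside J)"
    using closed_curveD[OF J] by (auto simp: frontier_def)
  then show "g \<inter> inside J \<noteq> {}" "g \<inter> outside J \<noteq> {}"
    using g x g_open open_Int_closure_eq_empty[of g] by blast+
qed

lemma Diff_open_arc: "path_image T \<subseteq> X \<union> open_arc T"
  using ends by (auto simp: open_arc_def)

text \<open>Off \<open>X\<close>, the curve \<open>J\<close> consists only of the interior of
  \<open>T\<close>, which lies in \<open>g\<close>; so no face other than \<open>g\<close> meets
  \<open>J\<close>.\<close>

lemma other_side:
  assumes "h \<in> components (- X)" "h \<noteq> g"
  shows "h \<inter> J = {}" "h \<subseteq> inside J \<or> h \<subseteq> outside J"
proof -
  have "h \<inter> g = {}" using assms g components_nonoverlap by blast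
  moreover have "h \<inter> X = {}" using assms in_components_subset by blast
  ultimately show "h \<inter> J = {}" using Un Diff_open_arc g by blast
  then show "h \<subseteq> inside J \<or> h \<subseteq> outside J"
    using closed_curve_connected_side[OF J] in_components_connected assms by blast
qed

text \<open>Intersecting with the two sides of \<open>J\<close> cuts \<open>g\<close> into two parts
  and leaves every other face whole, since it lies on one side.\<close>

lemma components_chord:
  "components (- (X \<union> path_image T)) = (components (- X) - {g}) \<union> {g \<inter> inside J, g \<inter> outside J}"
proof -
  have *: "components (- (X \<union> path_image T)) =
    {g \<inter> h | g h. g \<in> components (- X) \<and> h \<in> {inside J, outside J} \<and> g \<inter> h \<noteq> {}}"
    unfolding Un components_Compl_Un[OF X closed_curveD(12)[OF J] con] components_Compl_closed_curve[OF J] ..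
  show ?thesis
  proof (intro equalityI subsetI)
    fix f assume "f \<in> components (- (X \<union> path_image T))"
    then obtain h s where h: "h \<in> components (- X)" "s = inside J \<or> s = outside J" "f = h \<inter> s" "f \<noteq> {}"
      unfolding * by auto
    show "f \<in> (components (- X) - {g}) \<union> {g \<inter> inside J, g \<inter> outside J}"
    proof (cases "h = g")
      case False
      then have "h \<inter> s = h" using other_side[OF h(1)] h closed_curveD(9)[OF J] by blast
      then show ?thesis using False h by auto
    qed (use h in auto)
  next
    fix f assume f: "f \<in> (components (- X) - {g}) \<union> {g \<inter> inside J, g \<inter> outside J}"
    show "f \<in> components (- (X \<union> path_image T))"
    proof (cases "f = g \<inter> inside J \<or> f = g \<inter> outside J")
      case True
      then show ?thesis unfolding * using g split_nonempty by auto
    next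
      case False
      then have f: "f \<in> components (- X)" "f \<noteq> g" using f by auto
      then have "f = f \<inter> inside J \<or> f = f \<inter> outside J" "f \<noteq> {}"
        using other_side[OF f] in_components_nonempty[OF f(1)] by blast+
      then show ?thesis unfolding * using f by blast
    qed
  qed
qed

text \<open>The two halves are different and new, which is what makes the number of faces grow by
  exactly one.\<close>

lemma split_distinct: "g \<inter> inside J \<noteq> g \<inter> outside J"
  "g \<inter> inside J \<notin> components (- X)" "g \<inter> outside J \<notin> components (- X)"
proof -
  have d: "inside J \<inter> outside J = {}" using closed_curveD[OF J] by blast
  then show "g \<inter> inside J \<noteq> g \<inter> outside J" using split_nonempty by blast
  show "g \<inter> inside J \<notin> components (- X)"
  proof
    assume a: "g \<inter> inside J \<in> components (- X)"
    have "(g \<inter> inside J) = g" using components_nonoverlap[OF a g(1)] split_nonempty by blast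
    then show False using d split_nonempty by blast
  qed
  show "g \<inter> outside J \<notin> components (- X)"
  proof
    assume a: "g \<inter> outside J \<in> components (- X)"
    have "(g \<inter> outside J) = g" using components_nonoverlap[OF a g(1)] split_nonempty by blast
    then show False using d split_nonempty by blast
  qed
qed

text \<open>The interior of \<open>T\<close> has \<open>g\<close> as a neighbourhood, so only pieces
  of \<open>g\<close> can have it in their closure. Conversely, points of \<open>J\<close> are
  limits of both sides of \<open>J\<close>, and inside \<open>g\<close> this gives limits of both
  pieces.\<close>

lemma frontier_chord:
  assumes f: "f \<in> components (- (X \<union> path_image T))"
  shows "path_image T \<subseteq> frontier f \<longleftrightarrow> f = g \<inter> inside J \<or> f = g \<inter> outside J"
proof
  assume "path_image T \<subseteq> frontier f"
  then have "g \<inter> closure f \<noteq> {}"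
    using g open_arc_nonempty[OF T] by (auto simp: open_arc_def frontier_def)
  then have "g \<inter> f \<noteq> {}" using g_open by (simp add: open_Int_closure_eq_empty)
  then show "f = g \<inter> inside J \<or> f = g \<inter> outside J"
    using f components_nonoverlap[OF g(1)] unfolding components_chord by auto
next
  assume a: "f = g \<inter> inside J \<or> f = g \<inter> outside J"
  have "open_arc T \<subseteq> closure f"
  proof
    fix x assume x: "x \<in> open_arc T"
    then have "x \<in> J" using sub by (auto simp: open_arc_def)
    then have "x \<in> closure (inside J)" "x \<in> closure (outside J)"
      using closed_curveD[OF J] by (auto simp: frontier_def)
    then show "x \<in> closure f"
      using a x g g_open open_Int_closure_subset[of g] by blast
  qed
  then have "closure (open_arc T) \<subseteq> closure f" by (simp add: closure_minimal)
  then have "path_image T \<subseteq> closure f" using path_image_subset_closure_open_arc[OF T] by blast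
  moreover have "path_image T \<inter> f = {}" using in_components_subset[OF f] by blast
  ultimately show "path_image T \<subseteq> frontier f"
    using interior_subset by (fastforce simp: frontier_def)
qed

end

text \<open>The counterpart of \<open>frontier_chord\<close> for an arc that separates nothing. The
  face around the arc stays dense near it because an arc has empty interior, and no other face comes
  close to the interior of the arc.\<close>

lemma frontier_Diff_arc:
  fixes X :: "complex set"
  assumes X: "compact X" and T: "arc T"
    and comps: "components (- (X \<union> path_image T)) = (\<lambda>g. g - path_image T) ` components (- X)"
    and g: "g \<in> components (- X)" "open_arc T \<subseteq> g"
    and h: "h \<in> components (- X)"
  shows "path_image T \<subseteq> frontier (h - path_image T) \<longleftrightarrow> h = g"
proof
  note go = components_Compl_nonempty_open[OF X g(1)]
  assume "path_image T \<subseteq> frontier (h - path_image T)"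
  then have "g \<inter> closure (h - path_image T) \<noteq> {}"
    using g open_arc_nonempty[OF T] by (auto simp: open_arc_def frontier_def)
  then have "g \<inter> (h - path_image T) \<noteq> {}" using open_Int_closure_eq_empty[OF go(1)] by blast
  then have "g \<inter> h \<noteq> {}" by blast
  then show "h = g" using h components_nonoverlap[OF g(1)] by auto
next
  assume [simp]: "h = g"
  note go = components_Compl_nonempty_open[OF X g(1)]
  have "g \<subseteq> closure (g - path_image T)"
  proof
    fix x assume x: "x \<in> g"
    show "x \<in> closure (g - path_image T)"
      unfolding closure_iff_nhds_not_empty
    proof (intro allI impI)
      fix A S assume "S \<subseteq> A" "open S" "x \<in> S"
      then have "(S \<inter> g) - path_image T \<noteq> {}"
        using x go by (intro not_subset_path_image_arc[OF T]) auto
      then show "(g - path_image T) \<inter> A \<noteq> {}" using \<open>S \<subseteq> A\<close> by blast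
    qed
  qed
  then have "closure (open_arc T) \<subseteq> closure (g - path_image T)"
    using g by (meson closed_closure closure_minimal dual_order.trans)
  then have "path_image T \<subseteq> closure (g - path_image T)"
    using path_image_subset_closure_open_arc[OF T] by (rule order_trans[rotated])
  moreover have "path_image T \<inter> interior (g - path_image T) = {}"
    using interior_subset[of "g - path_image T"] by blast
  ultimately show "path_image T \<subseteq> frontier (h - path_image T)"
    unfolding frontier_def \<open>h = g\<close> by blast
qed

section \<open>Plane graphs and the sides of an edge\<close>

fun walk_edges :: "'v list \<Rightarrow> 'v set set" where
  "walk_edges (a # b # q) = insert {a, b} (walk_edges (b # q))"
| "walk_edges q = {}"

lemma walk_edges_conv_nth: "walk_edges q = {{q ! i, q ! Suc i} | i. Suc i < length q}"
proof (induction q rule: walk_edges.induct)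
  case (1 a b q)
  have "{{(a # b # q) ! i, (a # b # q) ! Suc i} | i. Suc i < length (a # b # q)} =
    insert {a, b} {{(b # q) ! i, (b # q) ! Suc i} | i. Suc i < length (b # q)}"
    (is "?L = insert _ ?R")
  proof (intro equalityI subsetI)
    fix x assume "x \<in> ?L"
    then obtain i where "x = {(a # b # q) ! i, (a # b # q) ! Suc i}" "Suc i < length (a # b # q)"
      by blast
    then show "x \<in> insert {a, b} ?R" by (cases i) auto
  next
    fix x assume "x \<in> insert {a, b} ?R"
    then consider "x = {a, b}" | i where "x = {(b # q) ! i, (b # q) ! Suc i}" "Suc i < length (b # q)"
      by blast
    then show "x \<in> ?L"
    proof cases
      case 1
      then show ?thesis by (intro CollectI exI[of _ 0]) auto
    next
      case 2
      then show ?thesis by (intro CollectI exI[of _ "Suc i"]) auto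
    qed
  qed
  then show ?case using 1 by simp
qed auto

lemma walk_edges_subset: "e \<in> walk_edges q \<Longrightarrow> e \<subseteq> set q"
  by (induction q rule: walk_edges.induct) auto

lemma Union_walk_edges: "length q \<ge> 2 \<Longrightarrow> \<Union> (walk_edges q) = set q"
proof (induction q rule: walk_edges.induct)
  case (1 a b q)
  then show ?case by (cases q) auto
qed auto

lemma walk_edges_snoc: "q \<noteq> [] \<Longrightarrow> walk_edges (q @ [x]) = insert {last q, x} (walk_edges q)"
  by (induction q rule: walk_edges.induct) auto

lemma cycle_edges_conv_walk: "p \<noteq> [] \<Longrightarrow> cycle_edges p = insert {last p, hd p} (walk_edges p)"
proof -
  assume p: "p \<noteq> []"
  have "cycle_edges p = (\<lambda>i. {p ! i, p ! (Suc i mod length p)}) ` {..<length p}"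
    by (auto simp: cycle_edges_def)
  also have "{..<length p} = insert (length p - 1) {i. Suc i < length p}" using p by auto
  also have "(\<lambda>i. {p ! i, p ! (Suc i mod length p)}) ` \<dots> =
    insert {last p, hd p} ((\<lambda>i. {p ! i, p ! (Suc i mod length p)}) ` {i. Suc i < length p})"
    using p by (simp add: last_conv_nth hd_conv_nth)
  also have "(\<lambda>i. {p ! i, p ! (Suc i mod length p)}) ` {i. Suc i < length p} = walk_edges p"
    unfolding walk_edges_conv_nth by (auto intro!: image_eqI)
  finally show ?thesis .
qed

lemma simple_cycle_iff:
  "simple_cycle E p \<longleftrightarrow> length p \<ge> 3 \<and> distinct p \<and> cycle_edges p \<subseteq> E"
  unfolding simple_cycle_def cycle_edges_def by auto

lemma cycle_edges_rotate1: "cycle_edges (rotate1 p) = cycle_edges p"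
proof (cases p)
  case (Cons a r)
  show ?thesis
  proof (cases "r = []")
    case False
    then have "walk_edges (a # r) = insert {a, hd r} (walk_edges r)" by (cases r) auto
    then show ?thesis using False Cons
      by (auto simp: cycle_edges_conv_walk walk_edges_snoc insert_commute)
  qed (simp add: Cons)
qed simp

lemma cycle_edges_rotate: "cycle_edges (rotate k p) = cycle_edges p"
  by (induction k) (auto simp: cycle_edges_rotate1)

lemma simple_cycle_rotate: "simple_cycle E (rotate k p) \<longleftrightarrow> simple_cycle E p"
  by (simp add: simple_cycle_iff cycle_edges_rotate)

lemma Union_cycle_edges: "length p \<ge> 2 \<Longrightarrow> \<Union> (cycle_edges p) = set p"
proof -
  assume p: "length p \<ge> 2"
  then have "p \<noteq> []" by auto
  then have "last p \<in> set p" "hd p \<in> set p" by auto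
  then show ?thesis using Union_walk_edges[OF p] cycle_edges_conv_walk[OF \<open>p \<noteq> []\<close>] by auto
qed

text \<open>Length at least 3 is essential: a walk with two vertices is closed by the very edge it
  consists of.\<close>

lemma closing_edge_notin_walk_edges:
  assumes "length q \<ge> 3" "distinct q"
  shows "{last q, hd q} \<notin> walk_edges q"
proof
  assume "{last q, hd q} \<in> walk_edges q"
  then obtain i where i: "Suc i < length q" "{q ! (length q - 1), q ! 0} = {q ! i, q ! Suc i}"
    using assms last_conv_nth[of q] hd_conv_nth[of q] by (cases q) (auto simp: walk_edges_conv_nth)
  then have "(q ! (length q - 1) = q ! i \<and> q ! 0 = q ! Suc i) \<or> (q ! (length q - 1) = q ! Suc i \<and> q ! 0 = q ! i)"
    by (auto simp: doubleton_eq_iff)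
  moreover have "length q - 1 < length q" "0 < length q" "i < length q" using assms i by auto
  ultimately show False using i assms nth_eq_iff_index_eq[OF assms(2)] by fastforce
qed

text \<open>Rotating the vertex list makes any chosen edge the closing one. The remaining edges then
  form a walk, which is drawn as an arc.\<close>

lemma simple_cycle_close:
  assumes "simple_cycle E p" "e \<in> cycle_edges p"
  obtains q where "simple_cycle E q" "cycle_edges q = cycle_edges p" "set q = set p"
    "e = {last q, hd q}" "cycle_edges q - {e} = walk_edges q"
proof -
  have len: "length p \<ge> 3" "distinct p" using assms by (auto simp: simple_cycle_iff)
  obtain i where i: "i < length p" "e = {p ! i, p ! (Suc i mod length p)}"
    using assms by (auto simp: cycle_edges_def)
  define q where "q = rotate (Suc i) p"
  have q: "length q = length p" "distinct q" "q \<noteq> []" using len by (auto simp: q_def)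
  have "hd q = p ! (Suc i mod length p)"
    unfolding q_def using len by (subst hd_rotate_conv_nth) auto
  moreover have "last q = p ! i"
  proof -
    have "last q = p ! ((Suc i + (length p - 1)) mod length p)"
      unfolding last_conv_nth[OF q(3)] q(1) unfolding q_def using len by (subst nth_rotate) auto
    also have "Suc i + (length p - 1) = i + length p" using len by simp
    finally show ?thesis using i by simp
  qed
  ultimately have e: "e = {last q, hd q}" using i by auto
  show ?thesis
  proof (rule that)
    show "simple_cycle E q" "cycle_edges q = cycle_edges p" "set q = set p"
      using assms(1) by (auto simp: q_def simple_cycle_rotate cycle_edges_rotate simp del: rotate_Suc)
    show "cycle_edges q - {e} = walk_edges q"
      using closing_edge_notin_walk_edges[of q] len q by (auto simp: e cycle_edges_conv_walk)
  qed (fact e)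
qed

text \<open>Equal edges at different positions would have to be traversed in opposite directions,
  which happens only for length 2.\<close>

lemma card_cycle_edges:
  assumes "length p \<ge> 3" "distinct p"
  shows "card (cycle_edges p) = length p"
proof -
  have "inj_on (\<lambda>i. {p ! i, p ! (Suc i mod length p)}) {..<length p}"
  proof (rule inj_onI)
    fix i j assume ij: "i \<in> {..<length p}" "j \<in> {..<length p}"
      "{p ! i, p ! (Suc i mod length p)} = {p ! j, p ! (Suc j mod length p)}"
    show "i = j"
    proof (rule ccontr)
      assume "i \<noteq> j"
      then have "p ! i \<noteq> p ! j" using ij assms by (simp add: nth_eq_iff_index_eq)
      then have "p ! i = p ! (Suc j mod length p)" "p ! (Suc i mod length p) = p ! j"
        using ij(3) by (auto simp: doubleton_eq_iff)
      moreover have lt: "i < length p" "j < length p" "Suc i mod length p < length p" "Suc j mod length p < length p"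
        using ij(1,2) by (auto intro: mod_less_divisor)
      ultimately have "i = Suc j mod length p" "Suc i mod length p = j"
        using nth_eq_iff_index_eq[OF assms(2) lt(1) lt(4)] nth_eq_iff_index_eq[OF assms(2) lt(3) lt(2)] by blast+
      then show False using ij(1,2) assms by (auto simp: mod_Suc split: if_splits)
    qed
  qed
  then have "card ((\<lambda>i. {p ! i, p ! (Suc i mod length p)}) ` {..<length p}) = length p"
    by (simp add: card_image)
  moreover have "cycle_edges p = (\<lambda>i. {p ! i, p ! (Suc i mod length p)}) ` {..<length p}"
    by (auto simp: cycle_edges_def)
  ultimately show ?thesis by simp
qed

definition edge_rel :: "'v set set \<Rightarrow> ('v \<times> 'v) set" where
  "edge_rel E = {(u, v). {u, v} \<in> E}"

lemma sym_edge_rel: "sym (edge_rel E)"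
  by (auto simp: edge_rel_def sym_def insert_commute)

lemma walk_edges_append_subset: "walk_edges (q @ r) \<supseteq> walk_edges q"
  by (induction q rule: walk_edges.induct) auto

text \<open>Repetitions are avoided by truncation: if the next vertex already occurs in the walk,
  the walk is cut off there.\<close>

lemma edge_rel_rtrancl_distinct_walk:
  assumes "(a, b) \<in> (edge_rel E)\<^sup>*"
  shows "\<exists>q. q \<noteq> [] \<and> distinct q \<and> hd q = a \<and> last q = b \<and> walk_edges q \<subseteq> E"
  using assms
proof (induction rule: rtrancl_induct)
  case base
  show ?case by (intro exI[of _ "[a]"]) auto
next
  case (step y z)
  then obtain q where q: "q \<noteq> []" "distinct q" "hd q = a" "last q = y" "walk_edges q \<subseteq> E" by blast
  show ?case
  proof (cases "z \<in> set q")
    case True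
    then obtain q1 q2 where q12: "q = q1 @ z # q2" by (meson split_list)
    then have "walk_edges (q1 @ [z]) \<subseteq> E"
      using walk_edges_append_subset[of "q1 @ [z]" q2] q by auto
    then show ?thesis using q q12 by (intro exI[of _ "q1 @ [z]"]) (auto simp: hd_append)
  next
    case False
    then show ?thesis using q step(2)
      by (intro exI[of _ "q @ [z]"]) (auto simp: walk_edges_snoc edge_rel_def)
  qed
qed

text \<open>Since \<open>a \<noteq> b\<close> and \<open>{a, b} \<notin> E\<close>, a walk from
  \<open>a\<close> to \<open>b\<close> has at least 3 vertices, enough for the new edge to close it
  to a simple cycle.\<close>

lemma simple_cycle_insert:
  assumes "(a, b) \<in> (edge_rel E)\<^sup>*" "a \<noteq> b" "{a, b} \<notin> E"
  obtains q where "simple_cycle (insert {a, b} E) q" "{a, b} \<in> cycle_edges q"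
proof -
  obtain q where q: "q \<noteq> []" "distinct q" "hd q = a" "last q = b" "walk_edges q \<subseteq> E"
    using edge_rel_rtrancl_distinct_walk[OF assms(1)] by blast
  then obtain r where r: "q = a # r" by (cases q) auto
  then obtain c s where s: "r = c # s" using q assms by (cases r) auto
  have "s \<noteq> []" using q assms r s by auto
  then have "length q \<ge> 3" using r s by (cases s) auto
  then show ?thesis
    using q by (intro that[of q]) (auto simp: simple_cycle_iff cycle_edges_conv_walk insert_commute)
qed

section \<open>Drawings of subgraphs of a plane graph\<close>

locale plane_graph =
  fixes V :: "'v set" and E :: "'v set set" and pos :: "'v \<Rightarrow> complex"
    and \<gamma> :: "'v set \<Rightarrow> real \<Rightarrow> complex"
  assumes simple: "simple_graph V E" and emb: "plane_embedding V E pos \<gamma>"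
begin

abbreviation edge_image :: "'v set \<Rightarrow> complex set" where
  "edge_image e \<equiv> path_image (\<gamma> e)"

abbreviation edge_interior :: "'v set \<Rightarrow> complex set" where
  "edge_interior e \<equiv> open_arc (\<gamma> e)"

abbreviation cycle_image :: "'v list \<Rightarrow> complex set" where
  "cycle_image p \<equiv> \<Union> (edge_image ` cycle_edges p)"

text \<open>Subgraphs carry their own vertex set, so that a graph can be grown by a vertex or an
  edge at a time within one fixed embedding, and can also be cut into components.\<close>

definition subgraph :: "'v set \<Rightarrow> 'v set set \<Rightarrow> bool" where
  "subgraph V' E' \<longleftrightarrow> V' \<subseteq> V \<and> E' \<subseteq> E \<and> (\<forall>e\<in>E'. e \<subseteq> V')"

lemma finite_V: "finite V"
  using simple by (simp add: simple_graph_def)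

lemma edge_doubleton:
  assumes "e \<in> E" obtains u v where "u \<in> V" "v \<in> V" "u \<noteq> v" "e = {u, v}"
  using assms simple by (auto simp: simple_graph_def)

lemma edge_subset: "e \<in> E \<Longrightarrow> e \<subseteq> V"
  by (auto elim: edge_doubleton)

lemma finite_E: "finite E"
  using edge_subset finite_V by (meson PowI finite_Pow_iff finite_subset subsetI)

lemma inj_pos: "inj_on pos V"
  using emb by (simp add: plane_embedding_def)

lemma arc_edge: "e \<in> E \<Longrightarrow> arc (\<gamma> e)"
  using emb by (simp add: plane_embedding_def)

lemma edge_endpoints: "e \<in> E \<Longrightarrow> {pathstart (\<gamma> e), pathfinish (\<gamma> e)} = pos ` e"
  using emb by (simp add: plane_embedding_def)

lemma edge_image_vertices: "e \<in> E \<Longrightarrow> edge_image e \<inter> pos ` V = pos ` e"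
  using emb by (simp add: plane_embedding_def)

lemma edge_image_Int: "e \<in> E \<Longrightarrow> e' \<in> E \<Longrightarrow> e \<noteq> e' \<Longrightarrow> edge_image e \<inter> edge_image e' = pos ` (e \<inter> e')"
  using emb by (simp add: plane_embedding_def)

lemma pos_edge_subset: "e \<in> E \<Longrightarrow> pos ` e \<subseteq> edge_image e"
  using edge_image_vertices by blast

lemma edge_interior_eq: "e \<in> E \<Longrightarrow> edge_interior e = edge_image e - pos ` e"
  using edge_endpoints[of e] by (simp add: open_arc_def)

lemma edge_interior_Int: "e \<in> E \<Longrightarrow> e' \<in> E \<Longrightarrow> e \<noteq> e' \<Longrightarrow> edge_interior e \<inter> edge_image e' = {}"
  using edge_image_Int[of e e'] edge_interior_eq by blast

lemma subgraph_Diff: "subgraph V' E' \<Longrightarrow> subgraph V' (E' - A)"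
  by (auto simp: subgraph_def)

lemma finite_subgraph: "subgraph V' E' \<Longrightarrow> finite V'" "subgraph V' E' \<Longrightarrow> finite E'"
  using finite_V finite_E by (auto simp: subgraph_def intro: finite_subset)

lemma compact_drawing: "subgraph V' E' \<Longrightarrow> compact (drawing pos \<gamma> V' E')"
  using finite_subgraph[of V' E'] arc_edge unfolding drawing_def subgraph_def
  by (intro compact_Un compact_UN finite_imp_compact[of "pos ` V'"]) (auto intro: compact_arc_image)

lemma drawing_insert_edge:
  "drawing pos \<gamma> V' (insert e E') = drawing pos \<gamma> V' E' \<union> edge_image e"
  by (auto simp: drawing_def)

lemma edge_image_Int_drawing:
  assumes "subgraph V' E'" "e \<in> E" "e \<notin> E'"
  shows "edge_image e \<inter> drawing pos \<gamma> V' E' = pos ` (e \<inter> V')"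
proof -
  have "edge_image e \<inter> pos ` V' = pos ` (e \<inter> V')"
  proof -
    have VV: "V' \<subseteq> V" using assms(1) by (simp add: subgraph_def)
    have "edge_image e \<inter> pos ` V' = (edge_image e \<inter> pos ` V) \<inter> pos ` V'" using VV by blast
    also have "\<dots> = pos ` (e \<inter> V')"
      unfolding edge_image_vertices[OF assms(2)]
      using inj_on_image_Int[OF inj_pos edge_subset[OF assms(2)] VV] by simp
    finally show ?thesis .
  qed
  moreover have "edge_image e \<inter> edge_image e' \<subseteq> pos ` (e \<inter> V')" if "e' \<in> E'" for e'
  proof -
    have "e' \<in> E" "e' \<subseteq> V'" using assms(1) that by (auto simp: subgraph_def)
    moreover have "e \<noteq> e'" using that assms(3) by blast
    ultimately show ?thesis using edge_image_Int[OF assms(2), of e'] by blast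
  qed
  ultimately show ?thesis unfolding drawing_def by blast
qed

lemma edge_interior_drawing:
  assumes "subgraph V' E'" "e \<in> E" "e \<notin> E'"
  shows "edge_interior e \<inter> drawing pos \<gamma> V' E' = {}"
  using edge_image_Int_drawing[OF assms] edge_interior_eq[OF assms(2)] by blast

text \<open>The direction in which \<open>\<gamma>\<close> runs through an edge is left open;
  reversing it where necessary lets the edges of a walk be joined end to end.\<close>

lemma oriented_edge:
  assumes "{a, b} \<in> E"
  obtains g where "arc g" "path_image g = edge_image {a, b}" "pathstart g = pos a" "pathfinish g = pos b"
proof -
  note arc = arc_edge[OF assms] and ends = edge_endpoints[OF assms]
  have "(pathstart (\<gamma> {a, b}) = pos a \<and> pathfinish (\<gamma> {a, b}) = pos b) \<or>
    (pathstart (\<gamma> {a, b}) = pos b \<and> pathfinish (\<gamma> {a, b}) = pos a)"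
    using ends by (auto simp: doubleton_eq_iff)
  then show ?thesis
  proof
    assume "pathstart (\<gamma> {a, b}) = pos a \<and> pathfinish (\<gamma> {a, b}) = pos b"
    then show ?thesis using that[of "\<gamma> {a, b}"] arc by auto
  next
    assume "pathstart (\<gamma> {a, b}) = pos b \<and> pathfinish (\<gamma> {a, b}) = pos a"
    then show ?thesis using that[of "reversepath (\<gamma> {a, b})"] arc by (auto simp: arc_reversepath)
  qed
qed

lemma walk_arc:
  assumes "distinct q" "length q \<ge> 2" "walk_edges q \<subseteq> E"
  shows "\<exists>g. arc g \<and> path_image g = \<Union> (edge_image ` walk_edges q) \<and>
    pathstart g = pos (hd q) \<and> pathfinish g = pos (last q)"
  using assms
proof (induction q rule: walk_edges.induct)
  case (1 a b q)
  have ab: "{a, b} \<in> E" using 1 by simp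
  obtain g1 where g1: "arc g1" "path_image g1 = edge_image {a, b}" "pathstart g1 = pos a" "pathfinish g1 = pos b"
    using oriented_edge[OF ab] by blast
  show ?case
  proof (cases q)
    case Nil
    then show ?thesis using g1 by auto
  next
    case (Cons c r)
    then obtain g2 where g2: "arc g2" "path_image g2 = \<Union> (edge_image ` walk_edges (b # q))"
      "pathstart g2 = pos b" "pathfinish g2 = pos (last (b # q))"
      using 1 by auto
    \<comment> \<open>Distinctness keeps \<open>a\<close> off all later edges, so the first edge can
      meet them only in \<open>b\<close>.\<close>
    have "path_image g1 \<inter> path_image g2 \<subseteq> {pathstart g2}"
    proof -
      have "edge_image {a, b} \<inter> edge_image e \<subseteq> {pos b}" if e: "e \<in> walk_edges (b # q)" for e
      proof -
        have "a \<notin> e" using walk_edges_subset[OF e] 1(2) by auto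
        then have "e \<noteq> {a, b}" "{a, b} \<inter> e \<subseteq> {b}" by auto
        then show ?thesis using edge_image_Int[OF ab, of e] e 1(4) by auto
      qed
      then show ?thesis using g1 g2 by auto
    qed
    then have "arc (g1 +++ g2)" using g1 g2 arc_join by metis
    moreover have "path_image (g1 +++ g2) = \<Union> (edge_image ` walk_edges (a # b # q))"
      using g1 g2 by (subst path_image_join) auto
    ultimately show ?thesis using g1 g2 by (intro exI[of _ "g1 +++ g2"]) auto
  qed
qed auto

lemma closed_curve_cycle_image:
  assumes "simple_cycle E p"
  shows "closed_curve (cycle_image p)"
proof -
  have p: "length p \<ge> 3" "distinct p" "cycle_edges p \<subseteq> E"
    using assms by (auto simp: simple_cycle_iff)
  then have ne: "p \<noteq> []" by auto
  note ce = cycle_edges_conv_walk[OF ne]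
  obtain g1 where g1: "arc g1" "path_image g1 = \<Union> (edge_image ` walk_edges p)"
    "pathstart g1 = pos (hd p)" "pathfinish g1 = pos (last p)"
    using walk_arc[of p] p by (auto simp: ce)
  have e: "{last p, hd p} \<in> E" using p by (auto simp: ce)
  obtain g2 where g2: "arc g2" "path_image g2 = edge_image {last p, hd p}"
    "pathstart g2 = pos (last p)" "pathfinish g2 = pos (hd p)"
    using oriented_edge[OF e] by blast
  have "path_image g1 \<inter> path_image g2 \<subseteq> {pathstart g1, pathstart g2}"
  proof -
    have "edge_image e \<inter> edge_image {last p, hd p} \<subseteq> {pos (hd p), pos (last p)}"
      if "e \<in> walk_edges p" for e
    proof -
      have "e \<noteq> {last p, hd p}" using closing_edge_notin_walk_edges p that by blast
      then show ?thesis using edge_image_Int[of e "{last p, hd p}"] e that p by (auto simp: ce)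
    qed
    then show ?thesis using g1 g2 by auto
  qed
  then have "simple_path (g1 +++ g2)" using g1 g2 by (intro simple_path_join_loop) auto
  moreover have "path_image (g1 +++ g2) = cycle_image p"
    using g1 g2 by (subst path_image_join) (auto simp: ce)
  ultimately show ?thesis
    using g1 g2 unfolding closed_curve_def by (intro exI[of _ "g1 +++ g2"]) auto
qed

lemma cycle_image_subset_drawing:
  "cycle_edges p \<subseteq> E' \<Longrightarrow> cycle_image p \<subseteq> drawing pos \<gamma> V' E'"
  by (auto simp: drawing_def)

lemma simple_cycle_mono: "simple_cycle E' p \<Longrightarrow> E' \<subseteq> F \<Longrightarrow> simple_cycle F p"
  by (auto simp: simple_cycle_iff)

lemma pos_cycle_image:
  assumes "simple_cycle E p" shows "pos ` set p \<subseteq> cycle_image p"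
proof -
  have "set p = \<Union> (cycle_edges p)" using assms Union_cycle_edges[of p] by (simp add: simple_cycle_iff)
  then show ?thesis using pos_edge_subset assms by (fastforce simp: simple_cycle_iff)
qed

text \<open>The rest of the cycle is an arc contained in the drawing without \<open>e\<close>, and
  this drawing meets the closed curve exactly in that arc. This supplies the connected intersection
  required by Janiszewski's theorem.\<close>

lemma cycle_chord:
  assumes sub: "subgraph V' E'" and p: "simple_cycle E' p" and e: "e \<in> cycle_edges p"
  obtains g where "chord (drawing pos \<gamma> V' (E' - {e})) (cycle_image p) (\<gamma> e) g"
proof -
  let ?X = "drawing pos \<gamma> V' (E' - {e})"
  have EE: "E' \<subseteq> E" using sub by (simp add: subgraph_def)
  obtain q where q: "simple_cycle E' q" "cycle_edges q = cycle_edges p" "set q = set p"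
    "e = {last q, hd q}" "cycle_edges q - {e} = walk_edges q"
    using simple_cycle_close[OF p e] by blast
  have q': "length q \<ge> 3" "distinct q" "cycle_edges q \<subseteq> E'" using q by (auto simp: simple_cycle_iff)
  have eE: "e \<in> E'" "e \<in> E" "e \<subseteq> V'" using q' q(2) e EE sub by (auto simp: subgraph_def)
  have subX: "subgraph V' (E' - {e})" using sub subgraph_Diff by blast
  have ends: "edge_image e \<inter> ?X = pos ` e"
    using edge_image_Int_drawing[OF subX eE(2)] eE(3) by (simp add: Int_absorb2)
  have "walk_edges q \<subseteq> E" using q(5) q' EE by blast
  then obtain g where g: "arc g" "path_image g = \<Union> (edge_image ` walk_edges q)"
    "pathstart g = pos (hd q)" "pathfinish g = pos (last q)"
    using walk_arc[of q] q' by auto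
  have J: "cycle_image p = path_image g \<union> edge_image e"
  proof -
    have "cycle_edges p = insert e (walk_edges q)" using q(2,5) e by blast
    then show ?thesis using g(2) by auto
  qed
  have PX: "path_image g \<subseteq> ?X" unfolding g(2) drawing_def using q(5) q' by blast
  have "pos ` e \<subseteq> path_image g" using g q(4) pathstart_in_path_image[of g] pathfinish_in_path_image[of g] by auto
  then have "?X \<inter> cycle_image p = path_image g" using J PX ends by blast
  then have con: "connected (?X \<inter> cycle_image p)" using connected_arc_image[OF g(1)] by metis
  have eo: "edge_interior e \<subseteq> - ?X" using edge_interior_drawing[OF subX eE(2)] by blast
  moreover have "- ?X \<noteq> {}" using eo open_arc_nonempty arc_edge eE by blast
  ultimately obtain h where h: "h \<in> components (- ?X)" "edge_interior e \<subseteq> h"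
    using exists_component_superset[of "edge_interior e" "- ?X"] connected_open_arc arc_edge eE by blast
  show ?thesis
  proof (rule that[of h], unfold_locales)
    show "compact ?X" using compact_drawing subX by blast
    show "closed_curve (cycle_image p)"
      using closed_curve_cycle_image simple_cycle_mono[OF p EE] by blast
    show "?X \<union> edge_image e = ?X \<union> cycle_image p" using J PX by blast
    show "?X \<inter> edge_image e = {pathstart (\<gamma> e), pathfinish (\<gamma> e)}"
      using ends edge_endpoints eE by blast
  qed (use arc_edge eE con J h in auto)
qed

lemma drawing_remove_edge:
  "e \<in> E' \<Longrightarrow> drawing pos \<gamma> V' (E' - {e}) \<union> edge_image e = drawing pos \<gamma> V' E'"
  by (auto simp: drawing_def)

section \<open>The faces bordering an edge\<close>

definition sides :: "'v set \<Rightarrow> 'v set set \<Rightarrow> 'v set \<Rightarrow> complex set set" where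
  "sides V' E' e = {f \<in> faces pos \<gamma> V' E'. edge_image e \<subseteq> frontier f}"

text \<open>Without \<open>e\<close> there is one face around its interior; the closed curve through
  \<open>e\<close> cuts this face into a part inside and a part outside.\<close>

lemma sides_cycle:
  assumes sub: "subgraph V' E'" and p: "simple_cycle E' p" and e: "e \<in> cycle_edges p"
  obtains f1 f2 where "f1 \<noteq> f2" "sides V' E' e = {f1, f2}"
    "f1 \<subseteq> inside (cycle_image p)" "f2 \<subseteq> outside (cycle_image p)"
proof -
  obtain g where "chord (drawing pos \<gamma> V' (E' - {e})) (cycle_image p) (\<gamma> e) g"
    using cycle_chord[OF assms] by blast
  then interpret chord "drawing pos \<gamma> V' (E' - {e})" "cycle_image p" "\<gamma> e" g .
  have "e \<in> E'" using p e by (auto simp: simple_cycle_iff)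
  note d = drawing_remove_edge[OF this]
  have "sides V' E' e = {g \<inter> inside (cycle_image p), g \<inter> outside (cycle_image p)}"
  proof (intro equalityI subsetI)
    fix f assume "f \<in> sides V' E' e"
    then show "f \<in> {g \<inter> inside (cycle_image p), g \<inter> outside (cycle_image p)}"
      using frontier_chord[of f] unfolding sides_def faces_def d by simp
  next
    fix f assume f: "f \<in> {g \<inter> inside (cycle_image p), g \<inter> outside (cycle_image p)}"
    then have "f \<in> components (- drawing pos \<gamma> V' E')"
      using components_chord unfolding d by blast
    then show "f \<in> sides V' E' e"
      using f frontier_chord[of f] unfolding sides_def faces_def d by simp
  qed
  then show ?thesis by (rule that[OF split_distinct(1)]) auto
qed

text \<open>An edge on no cycle is a bridge: without it, \<open>b\<close> cannot be reached from
  \<open>a\<close>. The vertices reachable from \<open>a\<close> and the others then have disjoint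
  compact drawings, and the edge meets each in one point.\<close>

lemma components_bridge:
  assumes sub: "subgraph V' E'" and e: "e \<in> E'" and no: "\<And>p. simple_cycle E' p \<Longrightarrow> e \<notin> cycle_edges p"
  shows "components (- drawing pos \<gamma> V' E') =
    (\<lambda>g. g - edge_image e) ` components (- drawing pos \<gamma> V' (E' - {e}))"
proof -
  have eE: "e \<in> E" "e \<subseteq> V'" using sub e by (auto simp: subgraph_def)
  obtain a b where ab: "a \<noteq> b" "e = {a, b}" using eE edge_doubleton by metis
  define A where "A = {v \<in> V'. (a, v) \<in> (edge_rel (E' - {e}))\<^sup>*}"
  have aA: "a \<in> A" using ab eE by (auto simp: A_def)
  have bA: "b \<notin> A"
  proof
    assume "b \<in> A"
    then have "(a, b) \<in> (edge_rel (E' - {e}))\<^sup>*" by (simp add: A_def)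
    then obtain q where "simple_cycle (insert {a, b} (E' - {e})) q" "{a, b} \<in> cycle_edges q"
      by (rule simple_cycle_insert) (use ab in auto)
    moreover have "insert {a, b} (E' - {e}) = E'" using ab e by blast
    ultimately show False using no ab by auto
  qed
  have closed: "e' \<subseteq> A \<or> e' \<subseteq> V' - A" if e': "e' \<in> E' - {e}" for e'
  proof -
    obtain u v where uv: "e' = {u, v}" using e' sub edge_doubleton by (metis DiffD1 subgraph_def subsetD)
    have uvV: "u \<in> V'" "v \<in> V'" using e' sub uv by (auto simp: subgraph_def)
    have "(u, v) \<in> edge_rel (E' - {e})" "(v, u) \<in> edge_rel (E' - {e})"
      using uv e' by (auto simp: edge_rel_def insert_commute)
    then have "u \<in> A \<longleftrightarrow> v \<in> A" 
      unfolding A_def using uvV by (auto intro: rtrancl.rtrancl_into_rtrancl)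
    then show ?thesis using uv uvV by auto
  qed
  define E1 E2 where "E1 = {e' \<in> E' - {e}. e' \<subseteq> A}" and "E2 = {e' \<in> E' - {e}. e' \<subseteq> V' - A}"
  have E12: "E' - {e} = E1 \<union> E2" using closed by (auto simp: E1_def E2_def)
  have AV: "A \<subseteq> V'" by (auto simp: A_def)
  have sub1: "subgraph A E1" and sub2: "subgraph (V' - A) E2"
    using sub AV by (auto simp: subgraph_def E1_def E2_def)
  let ?X1 = "drawing pos \<gamma> A E1" and ?X2 = "drawing pos \<gamma> (V' - A) E2"
  have un: "drawing pos \<gamma> V' (E' - {e}) = ?X1 \<union> ?X2"
    unfolding E12 drawing_def using AV by blast
  have e12: "e \<notin> E1" "e \<notin> E2" by (auto simp: E1_def E2_def)
  have i1: "?X1 \<inter> edge_image e = {pos a}"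
    using edge_image_Int_drawing[OF sub1 eE(1) e12(1)] aA bA ab by (auto simp: Int_commute)
  have i2: "?X2 \<inter> edge_image e = {pos b}"
    using edge_image_Int_drawing[OF sub2 eE(1) e12(2)] aA bA ab eE(2) by (auto simp: Int_commute)
  have disj: "?X1 \<inter> ?X2 = {}"
  proof -
    have "pos ` A \<inter> pos ` (V' - A) = {}"
      using inj_on_image_Int[OF inj_pos, of A "V' - A"] sub AV unfolding subgraph_def by auto
    moreover have "edge_image e1 \<inter> ?X2 = {}" if "e1 \<in> E1" for e1
    proof -
      have "e1 \<in> E" "e1 \<notin> E2" "e1 \<inter> (V' - A) = {}"
        using that sub edge_doubleton[of e1] by (auto simp: E1_def E2_def subgraph_def)
      then show ?thesis using edge_image_Int_drawing[OF sub2, of e1] by simp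
    qed
    moreover have "edge_image e2 \<inter> ?X1 = {}" if "e2 \<in> E2" for e2
    proof -
      have "e2 \<in> E" "e2 \<notin> E1" "e2 \<inter> A = {}"
        using that sub edge_doubleton[of e2] by (auto simp: E1_def E2_def subgraph_def)
      then show ?thesis using edge_image_Int_drawing[OF sub1, of e2] by simp
    qed
    ultimately show ?thesis unfolding drawing_def by blast
  qed
  have "components (- (?X1 \<union> ?X2 \<union> edge_image e)) = (\<lambda>g. g - edge_image e) ` components (- (?X1 \<union> ?X2))"
    by (rule components_Compl_Un_bridge)
      (use compact_drawing sub1 sub2 disj arc_edge eE i1 i2 in auto)
  then show ?thesis using un drawing_remove_edge[OF e, of V'] by metis
qed

lemma sides_bridge:
  assumes sub: "subgraph V' E'" and e: "e \<in> E'" and no: "\<And>p. simple_cycle E' p \<Longrightarrow> e \<notin> cycle_edges p"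
  obtains f where "sides V' E' e = {f}"
proof -
  let ?X = "drawing pos \<gamma> V' (E' - {e})"
  have eE: "e \<in> E" using sub e by (auto simp: subgraph_def)
  have subX: "subgraph V' (E' - {e})" using sub subgraph_Diff by blast
  have eo: "edge_interior e \<subseteq> - ?X" using edge_interior_drawing[OF subX eE] by blast
  moreover have "- ?X \<noteq> {}" using eo open_arc_nonempty arc_edge eE by blast
  ultimately obtain g where g: "g \<in> components (- ?X)" "edge_interior e \<subseteq> g"
    using exists_component_superset[of "edge_interior e" "- ?X"] connected_open_arc arc_edge eE by blast
  note d = drawing_remove_edge[OF e, of V']
  note cb = components_bridge[OF assms]
  have "edge_image e \<subseteq> frontier (h - edge_image e) \<longleftrightarrow> h = g" if "h \<in> components (- ?X)" for h
    using frontier_Diff_arc[OF compact_drawing[OF subX] arc_edge[OF eE] _ g that] cb d by simp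
  then have "sides V' E' e = {g - edge_image e}"
  proof -
    have F: "faces pos \<gamma> V' E' = (\<lambda>g. g - edge_image e) ` components (- ?X)"
      using cb by (simp add: faces_def)
    show ?thesis
      unfolding sides_def F using g(1) \<open>\<And>h. h \<in> components (- ?X) \<Longrightarrow> _\<close> by auto
  qed
  then show ?thesis using that by blast
qed

lemma face_connected_side:
  assumes "simple_cycle E p" "cycle_edges p \<subseteq> E'" "f \<in> faces pos \<gamma> V' E'"
  shows "f \<subseteq> inside (cycle_image p) \<or> f \<subseteq> outside (cycle_image p)"
proof -
  have "f \<inter> cycle_image p = {}"
    using assms in_components_subset[of f] cycle_image_subset_drawing[OF assms(2)] unfolding faces_def by blast
  then show ?thesis
    using closed_curve_connected_side[OF closed_curve_cycle_image[OF assms(1)]] assms(3)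
      in_components_connected unfolding faces_def by blast
qed

lemma edge_interior_cycle_image:
  assumes "simple_cycle E p" "e \<in> E" "e \<notin> cycle_edges p"
  shows "edge_interior e \<inter> cycle_image p = {}"
proof -
  have "edge_interior e \<inter> edge_image e' = {}" if "e' \<in> cycle_edges p" for e'
  proof (rule edge_interior_Int)
    show "e' \<in> E" "e \<noteq> e'" using that assms by (auto simp: simple_cycle_iff)
  qed (fact assms)
  then show ?thesis by blast
qed

lemma edge_interior_connected_side:
  assumes "simple_cycle E p" "e \<in> E" "e \<notin> cycle_edges p"
  shows "edge_interior e \<subseteq> inside (cycle_image p) \<or> edge_interior e \<subseteq> outside (cycle_image p)"
  using closed_curve_connected_side[OF closed_curve_cycle_image[OF assms(1)]]
    connected_open_arc[OF arc_edge[OF assms(2)]] edge_interior_cycle_image[OF assms] by blast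

text \<open>The interior of the edge lies in the closure of every face bordering it, and the two
  sides of the curve are open and disjoint.\<close>

lemma sides_inside_iff:
  assumes p: "simple_cycle E p" "cycle_edges p \<subseteq> E'" and e: "e \<in> E" "e \<notin> cycle_edges p"
    and f: "f \<in> sides V' E' e"
  shows "f \<subseteq> inside (cycle_image p) \<longleftrightarrow> edge_interior e \<subseteq> inside (cycle_image p)"
proof -
  let ?J = "cycle_image p"
  note J = closed_curveD[OF closed_curve_cycle_image[OF p(1)]]
  have ne: "edge_interior e \<noteq> {}" using open_arc_nonempty arc_edge e by blast
  have fcl: "edge_interior e \<subseteq> closure f" and ff: "f \<in> faces pos \<gamma> V' E'"
    using f unfolding sides_def frontier_def open_arc_def by auto
  have fne: "f \<noteq> {}" using ff in_components_nonempty unfolding faces_def by blast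
  have *: "\<not> (f \<subseteq> s \<and> edge_interior e \<subseteq> t)" if "open t" "s \<inter> t = {}" for s t
  proof
    assume a: "f \<subseteq> s \<and> edge_interior e \<subseteq> t"
    then have "t \<inter> closure f \<noteq> {}" using ne fcl by blast
    then show False using a that open_Int_closure_eq_empty[OF that(1), of f] by blast
  qed
  have "\<not> (f \<subseteq> inside ?J \<and> edge_interior e \<subseteq> outside ?J)" by (rule *[OF J(6) J(9)])
  moreover have "\<not> (f \<subseteq> outside ?J \<and> edge_interior e \<subseteq> inside ?J)"
    by (rule *[OF J(2)]) (use J(9) in blast)
  ultimately show ?thesis
    using face_connected_side[OF p ff] edge_interior_connected_side[OF p(1) e] by blast
qed

text \<open>The value 2 of \<open>face_mult\<close> for an edge with one face on both sides pays off
  here: every edge has total multiplicity 2, whether or not it is a bridge. A cycle separates the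
  two sides of its own edges and keeps those of any other edge together.\<close>

lemma sum_face_mult:
  assumes sub: "subgraph V' E'" and e: "e \<in> E'" and fin: "finite (faces pos \<gamma> V' E')"
  shows "(\<Sum>f\<in>faces pos \<gamma> V' E'. face_mult pos \<gamma> V' E' f e) = 2"
    and "simple_cycle E' p \<Longrightarrow>
      (\<Sum>f\<in>{f \<in> faces pos \<gamma> V' E'. f \<subseteq> inside (cycle_image p)}. face_mult pos \<gamma> V' E' f e) =
      (if e \<in> cycle_edges p then 1 else if edge_interior e \<subseteq> inside (cycle_image p) then 2 else 0)"
proof -
  let ?F = "faces pos \<gamma> V' E'" and ?m = "\<lambda>f. face_mult pos \<gamma> V' E' f e"
  have eE: "e \<in> E" and EE: "E' \<subseteq> E" using sub e by (auto simp: subgraph_def)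
  have m0: "?m f = 0" if "f \<in> ?F" "f \<notin> sides V' E' e" for f
    using that by (simp add: face_mult_def sides_def)
  have m1: "?m f = (if \<exists>f'\<in>sides V' E' e. f' \<noteq> f then 1 else 2)" if "f \<in> sides V' E' e" for f
    using that by (auto simp: face_mult_def sides_def)
  have sum: "sum ?m S = sum ?m (S \<inter> sides V' E' e)" if "S \<subseteq> ?F" for S
    using that fin by (intro sum.mono_neutral_right ballI m0) (auto intro: finite_subset)
  have sF: "sides V' E' e \<subseteq> ?F" by (auto simp: sides_def)
  show "sum ?m ?F = 2"
  proof (cases "\<exists>p. simple_cycle E' p \<and> e \<in> cycle_edges p")
    case True
    then obtain f1 f2 where f: "f1 \<noteq> f2" "sides V' E' e = {f1, f2}"
      using sides_cycle[OF sub] by metis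
    then have "?F \<inter> sides V' E' e = {f1, f2}" using sF by blast
    then show ?thesis using f m1[of f1] m1[of f2] by (subst sum) auto
  next
    case False
    then obtain f where f: "sides V' E' e = {f}" using sides_bridge[OF sub e] by metis
    then have "?F \<inter> sides V' E' e = {f}" using sF by blast
    then show ?thesis using f m1[of f] by (subst sum) auto
  qed
  assume p: "simple_cycle E' p"
  let ?S = "{f \<in> ?F. f \<subseteq> inside (cycle_image p)}"
  have pE: "simple_cycle E p" "cycle_edges p \<subseteq> E'" using p EE by (auto simp: simple_cycle_iff)
  show "sum ?m ?S = (if e \<in> cycle_edges p then 1 else if edge_interior e \<subseteq> inside (cycle_image p) then 2 else 0)"
  proof (cases "e \<in> cycle_edges p")
    case True
    obtain f1 f2 where f: "f1 \<noteq> f2" "sides V' E' e = {f1, f2}"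
      "f1 \<subseteq> inside (cycle_image p)" "f2 \<subseteq> outside (cycle_image p)"
      using sides_cycle[OF sub p True] by blast
    have "f2 \<noteq> {}" using f(2) sF in_components_nonempty unfolding faces_def by blast
    then have "\<not> f2 \<subseteq> inside (cycle_image p)"
      using f(4) closed_curveD(9)[OF closed_curve_cycle_image[OF pE(1)]] by blast
    then have "?S \<inter> sides V' E' e = {f1}" using f(2,3) sF by auto
    moreover have "?m f1 = 1" using m1[of f1] f by auto
    ultimately show ?thesis using True by (subst sum) auto
  next
    case False
    note in_iff = sides_inside_iff[OF pE eE False]
    show ?thesis
    proof (cases "edge_interior e \<subseteq> inside (cycle_image p)")
      case True
      then have "?S \<inter> sides V' E' e = ?F \<inter> sides V' E' e" using in_iff by blast
      then have "sum ?m ?S = sum ?m ?F" using sum[of ?S] sum[of ?F] by simp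
      then show ?thesis using True False \<open>sum ?m ?F = 2\<close> by simp
    next
      case o: False
      then have "?S \<inter> sides V' E' e = {}" using in_iff by blast
      then show ?thesis using o False by (subst sum) auto
    qed
  qed
qed

end

section \<open>Faces inside a cycle and Kasteleyn signs\<close>

text \<open>Modulo two, one part of a disjoint union is the sum of the whole and the other
  part.\<close>

lemma eq_sym_diff_Diff:
  assumes "A - X = f \<union> h" "h = B - X" "f \<inter> h = {}"
  shows "f = sym_diff A B - X"
  using assms by blast

lemma edge_rel_crossing:
  assumes "(r, u) \<in> (edge_rel F)\<^sup>*" "r \<in> A" "u \<notin> A"
  obtains x y where "x \<in> A" "y \<notin> A" "{x, y} \<in> F"
  using assms by (induction rule: rtrancl_induct) (auto simp: edge_rel_def)

lemma edge_rel_walk: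
  assumes "v \<in> set q"
  shows "(hd q, v) \<in> (edge_rel (walk_edges q))\<^sup>*"
  using assms
proof (induction q rule: walk_edges.induct)
  case (1 a b q)
  have mono: "(edge_rel (walk_edges (b # q)))\<^sup>* \<subseteq> (edge_rel (walk_edges (a # b # q)))\<^sup>*"
    by (intro rtrancl_mono) (auto simp: edge_rel_def)
  have ab: "(a, b) \<in> edge_rel (walk_edges (a # b # q))" by (auto simp: edge_rel_def)
  show ?case
  proof (cases "v = a")
    case False
    then have "(b, v) \<in> (edge_rel (walk_edges (a # b # q)))\<^sup>*" using 1 mono by auto
    then show ?thesis using ab by (auto intro: converse_rtrancl_into_rtrancl)
  qed simp
qed auto

lemma edge_rel_mono: "E \<subseteq> F \<Longrightarrow> (edge_rel E)\<^sup>* \<subseteq> (edge_rel F)\<^sup>*"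
  by (intro rtrancl_mono) (auto simp: edge_rel_def)

lemma walk_colouring:
  assumes "\<And>u v. {u, v} \<in> walk_edges q \<Longrightarrow> c u \<noteq> (c v :: bool)" "q \<noteq> []"
  shows "c (last q) = c (hd q) \<longleftrightarrow> odd (length q)"
  using assms
proof (induction q rule: walk_edges.induct)
  case (1 a b q)
  have "c (last (b # q)) = c (hd (b # q)) \<longleftrightarrow> odd (length (b # q))"
    by (rule 1(1)) (use 1(2) in auto)
  moreover have "c a \<noteq> c b" using 1(2)[of a b] by simp
  ultimately show ?case by auto
qed auto

lemma even_length_simple_cycle:
  assumes p: "simple_cycle F p" and c: "\<And>u v. {u, v} \<in> F \<Longrightarrow> c u \<noteq> (c v :: bool)"
  shows "even (length p)"
proof -
  have ne: "p \<noteq> []" using p by (auto simp: simple_cycle_iff)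
  then have sub: "insert {last p, hd p} (walk_edges p) \<subseteq> F"
    using p cycle_edges_conv_walk by (auto simp: simple_cycle_iff)
  then have "c (last p) = c (hd p) \<longleftrightarrow> odd (length p)"
    by (intro walk_colouring c) (use ne in auto)
  then show ?thesis using c[of "last p" "hd p"] sub by auto
qed

section \<open>Growing a connected graph from a cycle: its faces and Euler's formula\<close>

context plane_graph
begin

text \<open>Up to the drawing itself, every face of a connected graph is a sum modulo two of interiors of
  cycles and possibly the whole plane.\<close>

inductive_set cycle_span :: "'v set set \<Rightarrow> complex set set" for F where
  cycle_span_UNIV: "UNIV \<in> cycle_span F"
| cycle_span_inside: "simple_cycle F q \<Longrightarrow> inside (cycle_image q) \<in> cycle_span F"
| cycle_span_sym_diff: "A \<in> cycle_span F \<Longrightarrow> B \<in> cycle_span F \<Longrightarrow> sym_diff A B \<in> cycle_span F"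

lemma cycle_span_mono:
  assumes "A \<in> cycle_span E'" "E' \<subseteq> F" shows "A \<in> cycle_span F"
  using assms by induction (auto intro: cycle_span.intros simple_cycle_mono)

lemma cycle_span_empty: "{} \<in> cycle_span F"
  using cycle_span_sym_diff[OF cycle_span_UNIV cycle_span_UNIV] by simp

text \<open>For disjoint sets, union and symmetric difference coincide.\<close>

lemma cycle_span_Union:
  assumes "finite FF" "pairwise disjnt FF" "\<And>f. f \<in> FF \<Longrightarrow> \<exists>A\<in>cycle_span F. f = A - X"
  shows "\<exists>A\<in>cycle_span F. \<Union> FF = A - X"
  using assms
proof (induction FF rule: finite_induct)
  case empty
  then show ?case using cycle_span_empty by blast
next
  case (insert f FF)
  then obtain A B where AB: "A \<in> cycle_span F" "\<Union> FF = A - X" "B \<in> cycle_span F" "f = B - X"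
    by (metis insertCI pairwise_insert)
  have "disjnt f (\<Union> FF)"
    using insert(2,4) by (force simp: pairwise_insert disjnt_def)
  then have "\<Union> (insert f FF) = sym_diff B A - X"
    using AB(2,4) unfolding disjnt_def Union_insert by auto
  then show ?case using cycle_span_sym_diff[OF AB(3,1)] by blast
qed

definition faces_spanned :: "'v set \<Rightarrow> 'v set set \<Rightarrow> bool" where
  "faces_spanned V' E' \<longleftrightarrow>
    (\<forall>f\<in>faces pos \<gamma> V' E'. \<exists>A\<in>cycle_span E'. f = A - drawing pos \<gamma> V' E')"

definition faces_inside :: "'v list \<Rightarrow> 'v set \<Rightarrow> 'v set set \<Rightarrow> complex set set" where
  "faces_inside p V' E' = {f \<in> faces pos \<gamma> V' E'. f \<subseteq> inside (cycle_image p)}"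

definition vertices_inside :: "'v list \<Rightarrow> 'v set \<Rightarrow> 'v set" where
  "vertices_inside p V' = {v \<in> V'. pos v \<in> inside (cycle_image p)}"

text \<open>Edges are located by their interiors because their ends may lie on the cycle.\<close>

definition edges_inside :: "'v list \<Rightarrow> 'v set set \<Rightarrow> 'v set set" where
  "edges_inside p E' = {e \<in> E'. edge_interior e \<subseteq> inside (cycle_image p)}"

text \<open>Euler's formula for the closed disc bounded by the cycle. The vertices and the edges of
  the cycle itself are equally many and cancel.\<close>

definition euler_inside :: "'v list \<Rightarrow> 'v set \<Rightarrow> 'v set set \<Rightarrow> bool" where
  "euler_inside p V' E' \<longleftrightarrow>
    card (faces_inside p V' E') + card (vertices_inside p V') = 1 + card (edges_inside p E')"

lemma in_cycle_not_inside:
  assumes "simple_cycle E p" "e \<in> cycle_edges p"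
  shows "\<not> edge_interior e \<subseteq> inside (cycle_image p)"
proof
  assume "edge_interior e \<subseteq> inside (cycle_image p)"
  moreover have "edge_interior e \<subseteq> cycle_image p" using assms(2) by (auto simp: open_arc_def)
  moreover have "edge_interior e \<noteq> {}"
    using assms open_arc_nonempty arc_edge by (auto simp: simple_cycle_iff)
  ultimately show False using closed_curveD(10)[OF closed_curve_cycle_image[OF assms(1)]] by blast
qed

lemma drawing_cycle:
  assumes "simple_cycle E p"
  shows "drawing pos \<gamma> (set p) (cycle_edges p) = cycle_image p"
  using pos_cycle_image[OF assms] unfolding drawing_def by blast

lemma cycle_base:
  assumes p: "simple_cycle E p"
  shows "finite (faces pos \<gamma> (set p) (cycle_edges p))" "faces_spanned (set p) (cycle_edges p)"
    "euler_inside p (set p) (cycle_edges p)"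
proof -
  let ?J = "cycle_image p"
  note J = closed_curve_cycle_image[OF p]
  note Js = closed_curveD[OF J]
  have F: "faces pos \<gamma> (set p) (cycle_edges p) = {inside ?J, outside ?J}"
    unfolding faces_def drawing_cycle[OF p] by (rule components_Compl_closed_curve[OF J])
  then show "finite (faces pos \<gamma> (set p) (cycle_edges p))" by simp
  have "inside ?J \<in> cycle_span (cycle_edges p)"
    using p by (intro cycle_span_inside) (auto simp: simple_cycle_iff)
  \<comment> \<open>Off the curve, the outside is the complement of the inside, that is, its sum
    modulo two with the whole plane.\<close>
  moreover have "inside ?J = inside ?J - ?J" "outside ?J = sym_diff UNIV (inside ?J) - ?J"
    using Js(9,10) by blast+
  ultimately show "faces_spanned (set p) (cycle_edges p)"
    unfolding faces_spanned_def F drawing_cycle[OF p]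
    using cycle_span_sym_diff[OF cycle_span_UNIV] by (metis empty_iff insert_iff)
  have "faces_inside p (set p) (cycle_edges p) = {inside ?J}"
  proof -
    have "\<not> outside ?J \<subseteq> inside ?J" using Js(5,9) by blast
    then show ?thesis unfolding faces_inside_def F by auto
  qed
  moreover have "vertices_inside p (set p) = {}"
    using pos_cycle_image[OF p] Js(10) unfolding vertices_inside_def by blast
  moreover have "edges_inside p (cycle_edges p) = {}"
    using in_cycle_not_inside[OF p] unfolding edges_inside_def by blast
  ultimately show "euler_inside p (set p) (cycle_edges p)" by (simp add: euler_inside_def)
qed

text \<open>The new arc meets the drawing in one point, so old and new faces correspond one to one.
  The new vertex lies on the same side of the cycle as the new edge, hence both sides of Euler's
  formula change equally.\<close>

lemma pendant_step:
  assumes sub: "subgraph V' E'" and e: "{a, b} \<in> E" "a \<in> V'" "b \<notin> V'"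
    and fin: "finite (faces pos \<gamma> V' E')" and sp: "faces_spanned V' E'"
    and p: "simple_cycle E' p" and eu: "euler_inside p V' E'"
  shows "finite (faces pos \<gamma> (insert b V') (insert {a, b} E'))"
    "faces_spanned (insert b V') (insert {a, b} E')"
    "euler_inside p (insert b V') (insert {a, b} E')"
proof -
  let ?e = "{a, b}" and ?X = "drawing pos \<gamma> V' E'" and ?J = "cycle_image p"
  let ?X' = "drawing pos \<gamma> (insert b V') (insert {a, b} E')"
  have eE': "?e \<notin> E'" using sub e(3) by (auto simp: subgraph_def)
  have pE: "simple_cycle E p" and CE: "cycle_edges p \<subseteq> E'"
    using p sub simple_cycle_mono by (auto simp: subgraph_def simple_cycle_iff)
  note J = closed_curve_cycle_image[OF pE]
  note Js = closed_curveD[OF J]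
  have int: "edge_image ?e \<inter> ?X = {pos a}"
    using edge_image_Int_drawing[OF sub e(1) eE'] e by auto
  have X': "?X' = ?X \<union> edge_image ?e"
    using pos_edge_subset[OF e(1)] unfolding drawing_def by auto
  have "components (- (?X \<union> edge_image ?e)) = (\<lambda>g. g - edge_image ?e) ` components (- ?X)"
    by (rule components_Compl_Un_arc)
      (use compact_drawing[OF sub] arc_edge[OF e(1)] int in \<open>auto simp: Int_commute\<close>)
  then have F: "faces pos \<gamma> (insert b V') (insert ?e E') = (\<lambda>g. g - edge_image ?e) ` faces pos \<gamma> V' E'"
    unfolding faces_def X' .
  show "finite (faces pos \<gamma> (insert b V') (insert ?e E'))" unfolding F using fin by simp
  show "faces_spanned (insert b V') (insert ?e E')"
    unfolding faces_spanned_def F X'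
  proof
    fix f assume "f \<in> (\<lambda>g. g - edge_image ?e) ` faces pos \<gamma> V' E'"
    then obtain g where g: "g \<in> faces pos \<gamma> V' E'" "f = g - edge_image ?e" by blast
    then obtain A where "g = A - ?X" "A \<in> cycle_span E'"
      using sp unfolding faces_spanned_def by blast
    with g(2) show "\<exists>A\<in>cycle_span (insert ?e E'). f = A - (?X \<union> edge_image ?e)"
      using cycle_span_mono[of A E' "insert ?e E'"] by (intro bexI[of _ A]) auto
  qed
  have ne: "g - edge_image ?e \<noteq> {}" if "g \<in> faces pos \<gamma> V' E'" for g
    using that components_Compl_nonempty_open[OF compact_drawing[OF sub]]
      not_subset_path_image_arc[OF arc_edge[OF e(1)]] unfolding faces_def by blast
  have "inj_on (\<lambda>g. g - edge_image ?e) (faces pos \<gamma> V' E')"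
  proof (rule inj_onI)
    fix g h assume gh: "g \<in> faces pos \<gamma> V' E'" "h \<in> faces pos \<gamma> V' E'" "g - edge_image ?e = h - edge_image ?e"
    then have "g \<inter> h \<noteq> {}" using ne[OF gh(1)] by blast
    then show "g = h" using components_eq[of g _ h] gh(1,2) unfolding faces_def by blast
  qed
  moreover have "faces_inside p (insert b V') (insert ?e E') = (\<lambda>g. g - edge_image ?e) ` faces_inside p V' E'"
  proof -
    have "g - edge_image ?e \<subseteq> inside ?J \<longleftrightarrow> g \<subseteq> inside ?J" if g: "g \<in> faces pos \<gamma> V' E'" for g
      using face_connected_side[OF pE CE g] ne[OF g] Js(9) by blast
    then show ?thesis unfolding faces_inside_def F by blast
  qed
  ultimately have cF: "card (faces_inside p (insert b V') (insert ?e E')) = card (faces_inside p V' E')"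
    by (simp add: card_image inj_on_subset faces_inside_def)
  \<comment> \<open>The point of \<open>b\<close> is off the curve and is a limit of the interior of
    the edge, which stays on one side; the side containing \<open>b\<close> is open, so it is the
    same one.\<close>
  have in_iff: "pos b \<in> inside ?J \<longleftrightarrow> edge_interior ?e \<subseteq> inside ?J"
  proof -
    have "pos b \<in> edge_image ?e" using pos_edge_subset[OF e(1)] by auto
    then have bcl: "pos b \<in> closure (edge_interior ?e)"
      using path_image_subset_closure_open_arc[OF arc_edge[OF e(1)]] by blast
    have "pos b \<noteq> pos a" using e sub inj_pos edge_subset[OF e(1)] by (auto simp: subgraph_def inj_on_def)
    then have "pos b \<notin> ?X" using int \<open>pos b \<in> edge_image ?e\<close> by blast
    then have bJ: "pos b \<in> inside ?J \<union> outside ?J"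
      using cycle_image_subset_drawing[OF CE, of V'] Js(10) by blast
    have eo: "edge_interior ?e \<subseteq> inside ?J \<or> edge_interior ?e \<subseteq> outside ?J"
      using edge_interior_connected_side[OF pE e(1)] CE eE' by blast
    have "s \<inter> edge_interior ?e \<noteq> {}" if "open s" "pos b \<in> s" for s
      using that bcl open_Int_closure_eq_empty[OF that(1)] by blast
    from this[OF Js(2)] this[OF Js(6)] bJ eo Js(9) open_arc_nonempty[OF arc_edge[OF e(1)]]
    show ?thesis by blast
  qed
  have fV: "finite (vertices_inside p V')" "b \<notin> vertices_inside p V'"
    using finite_subgraph[OF sub] e by (auto simp: vertices_inside_def)
  have fE: "finite (edges_inside p E')" "?e \<notin> edges_inside p E'"
    using finite_subgraph[OF sub] eE' by (auto simp: edges_inside_def)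
  show "euler_inside p (insert b V') (insert ?e E')"
  proof (cases "pos b \<in> inside ?J")
    case True
    then have "vertices_inside p (insert b V') = insert b (vertices_inside p V')"
      "edges_inside p (insert ?e E') = insert ?e (edges_inside p E')"
      using in_iff by (auto simp: vertices_inside_def edges_inside_def)
    then show ?thesis using eu cF fV fE by (simp add: euler_inside_def)
  next
    case False
    then have "vertices_inside p (insert b V') = vertices_inside p V'"
      "edges_inside p (insert ?e E') = edges_inside p E'"
      using in_iff by (auto simp: vertices_inside_def edges_inside_def)
    then show ?thesis using eu cF by (simp add: euler_inside_def)
  qed
qed

text \<open>The new edge lies on a cycle \<open>q\<close>, whose curve splits the face
  \<open>g\<close> around the edge. If \<open>g\<close> lies inside the curve of \<open>p\<close>,
  Euler's formula gains one face and one edge there; otherwise nothing inside changes.\<close>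

lemma chord_step:
  assumes sub: "subgraph V' E'" and e: "{a, b} \<in> E" "{a, b} \<notin> E'" "a \<in> V'" "b \<in> V'"
    and con: "(a, b) \<in> (edge_rel E')\<^sup>*"
    and fin: "finite (faces pos \<gamma> V' E')" and sp: "faces_spanned V' E'"
    and p: "simple_cycle E' p" and eu: "euler_inside p V' E'"
  shows "finite (faces pos \<gamma> V' (insert {a, b} E'))"
    "faces_spanned V' (insert {a, b} E')"
    "euler_inside p V' (insert {a, b} E')"
proof -
  let ?e = "{a, b}" and ?X = "drawing pos \<gamma> V' E'" and ?J = "cycle_image p"
  let ?X' = "drawing pos \<gamma> V' (insert {a, b} E')"
  have pE: "simple_cycle E p" and CE: "cycle_edges p \<subseteq> E'"
    using p sub simple_cycle_mono by (auto simp: subgraph_def simple_cycle_iff)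
  note J = closed_curve_cycle_image[OF pE]
  note Js = closed_curveD[OF J]
  have sub': "subgraph V' (insert ?e E')" using sub e by (auto simp: subgraph_def)
  have "a \<noteq> b" using edge_doubleton[OF e(1)] by (metis doubleton_eq_iff)
  then obtain q where q: "simple_cycle (insert ?e E') q" "?e \<in> cycle_edges q"
    using simple_cycle_insert[OF con _ e(2)] by blast
  have qE: "simple_cycle E q"
    by (rule simple_cycle_mono[OF q(1)]) (use sub' in \<open>simp add: subgraph_def\<close>)
  let ?K = "cycle_image q"
  note Ks = closed_curveD[OF closed_curve_cycle_image[OF qE]]
  have Eeq: "insert ?e E' - {?e} = E'" using e by blast
  obtain g where "chord ?X ?K (\<gamma> ?e) g" using cycle_chord[OF sub' q] unfolding Eeq by blast
  then interpret ch: chord ?X ?K "\<gamma> ?e" g .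
  have X': "?X' = ?X \<union> edge_image ?e" by (rule drawing_insert_edge)
  let ?f1 = "g \<inter> inside ?K" and ?f2 = "g \<inter> outside ?K"
  have F: "faces pos \<gamma> V' (insert ?e E') = (faces pos \<gamma> V' E' - {g}) \<union> {?f1, ?f2}"
    unfolding faces_def X' by (rule ch.components_chord)
  have gF: "g \<in> faces pos \<gamma> V' E'" using ch.g unfolding faces_def by blast
  show "finite (faces pos \<gamma> V' (insert ?e E'))" unfolding F using fin by simp
  have disj: "f \<inter> ?X' = {}" if "f \<in> faces pos \<gamma> V' (insert ?e E')" for f
    using that in_components_subset unfolding faces_def by blast
  have old: "\<exists>A\<in>cycle_span (insert ?e E'). f = A - ?X" if "f \<in> faces pos \<gamma> V' E'" for f
    using sp that cycle_span_mono[of _ E' "insert ?e E'"] unfolding faces_spanned_def by blast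
  have other: "\<exists>A\<in>cycle_span (insert ?e E'). f = A - ?X'" if f: "f \<in> faces pos \<gamma> V' E' - {g}" for f
  proof -
    obtain A where A: "A \<in> cycle_span (insert ?e E')" "f = A - ?X" using old f by blast
    have "f \<inter> ?X' = {}" using disj[of f] f unfolding F by blast
    then have "f = A - ?X'" using A(2) X' by blast
    then show ?thesis using A(1) by blast
  qed
  let ?FF = "{f \<in> faces pos \<gamma> V' E' - {g}. f \<subseteq> inside ?K}"
  \<comment> \<open>The old faces inside the curve of \<open>q\<close> are spanned already; adding
    their union modulo two to the inside of that curve will isolate one half of
    \<open>g\<close>.\<close>
  have "\<exists>C\<in>cycle_span (insert ?e E'). \<Union> ?FF = C - ?X'"
  proof (rule cycle_span_Union)
    show "finite ?FF" using fin by auto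
    show "pairwise disjnt ?FF"
      using components_eq unfolding faces_def pairwise_def disjnt_def by blast
  qed (use other in blast)
  then obtain C where C: "C \<in> cycle_span (insert ?e E')" "\<Union> ?FF = C - ?X'" by blast
  \<comment> \<open>Every face lies on one side of the curve of \<open>q\<close>, so inside it there
    are, besides the drawing, only the inner half of \<open>g\<close> and whole old faces.\<close>
  have inK: "inside ?K - ?X' = ?f1 \<union> \<Union> ?FF"
  proof (intro equalityI subsetI)
    fix x assume x: "x \<in> inside ?K - ?X'"
    then obtain f where f: "f \<in> faces pos \<gamma> V' (insert ?e E')" "x \<in> f"
      using Union_components[of "- ?X'"] unfolding faces_def by blast
    show "x \<in> ?f1 \<union> \<Union> ?FF"
    proof (cases "f \<in> {?f1, ?f2}")
      case True
      then show ?thesis using f x Ks(9) by blast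
    next
      case False
      then have "f \<in> faces pos \<gamma> V' E' - {g}" using f F by blast
      moreover have "f \<subseteq> inside ?K \<or> f \<subseteq> outside ?K"
        by (rule face_connected_side[OF qE _ f(1)]) (use q in \<open>auto simp: simple_cycle_iff\<close>)
      ultimately show ?thesis using f(2) x Ks(9) by blast
    qed
  next
    fix x assume x: "x \<in> ?f1 \<union> \<Union> ?FF"
    then obtain f where "f \<in> faces pos \<gamma> V' (insert ?e E')" "x \<in> f" "f \<subseteq> inside ?K" unfolding F by blast
    then show "x \<in> inside ?K - ?X'" using disj by blast
  qed
  let ?B = "sym_diff (inside ?K) C"
  have B: "?B \<in> cycle_span (insert ?e E')"
    using cycle_span_sym_diff[OF cycle_span_inside[OF q(1)] C(1)] .
  have "?f1 \<inter> \<Union> ?FF = {}"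
  proof -
    have "g \<inter> f = {}" if "f \<in> faces pos \<gamma> V' E' - {g}" for f
      using that gF components_eq unfolding faces_def by blast
    then show ?thesis by blast
  qed
  with inK C(2) have f1: "?f1 = ?B - ?X'" by (rule eq_sym_diff_Diff)
  obtain A where A: "A \<in> cycle_span (insert ?e E')" "g = A - ?X" using old gF by blast
  have f12: "?f1 \<inter> ?X' = {}" "?f2 \<inter> ?X' = {}" using disj unfolding F by blast+
  have "?K \<subseteq> ?X'"
    by (rule cycle_image_subset_drawing) (use q(1) in \<open>simp add: simple_cycle_iff\<close>)
  then have "- ?X' \<subseteq> inside ?K \<union> outside ?K" unfolding Ks(10) by (rule Compl_anti_mono)
  then have "g - ?X' = ?f1 \<union> ?f2" using f12 by blast
  moreover have "g - ?X' = A - ?X'" using A(2) X' by blast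
  ultimately have "A - ?X' = ?f2 \<union> ?f1" by (metis Un_commute)
  \<comment> \<open>The outer half is what remains of \<open>g\<close> when the inner half is taken
    away.\<close>
  then have "?f2 = sym_diff A ?B - ?X'"
    using f1 by (rule eq_sym_diff_Diff) (use Ks(9) in blast)
  then have f2: "\<exists>A\<in>cycle_span (insert ?e E'). ?f2 = A - ?X'"
    using cycle_span_sym_diff[OF A(1) B] by blast
  show "faces_spanned V' (insert ?e E')"
    unfolding faces_spanned_def
  proof
    fix f assume f: "f \<in> faces pos \<gamma> V' (insert ?e E')"
    consider "f \<in> faces pos \<gamma> V' E' - {g}" | "f = ?f1" | "f = ?f2" using f unfolding F by blast
    then show "\<exists>A\<in>cycle_span (insert ?e E'). f = A - ?X'"
      by cases (use other B f1 f2 in auto)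
  qed
  have fE: "finite (edges_inside p E')" "?e \<notin> edges_inside p E'"
    using finite_subgraph[OF sub] e by (auto simp: edges_inside_def)
  have eo: "edge_interior ?e \<subseteq> inside ?J \<or> edge_interior ?e \<subseteq> outside ?J"
    using edge_interior_connected_side[OF pE e(1)] CE e(2) by blast
  have gJ: "g \<subseteq> inside ?J \<or> g \<subseteq> outside ?J" by (rule face_connected_side[OF pE CE gF])
  have eg: "edge_interior ?e \<noteq> {}" "edge_interior ?e \<subseteq> g"
    using open_arc_nonempty[OF arc_edge[OF e(1)]] ch.g by auto
  have fF: "finite (faces_inside p V' E')" using fin by (simp add: faces_inside_def)
  show "euler_inside p V' (insert ?e E')"
  proof (cases "edge_interior ?e \<subseteq> inside ?J")
    case True
    then have gi: "g \<subseteq> inside ?J" using gJ eg Js(9) by blast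
    then have fi: "faces_inside p V' (insert ?e E') = insert ?f1 (insert ?f2 (faces_inside p V' E' - {g}))"
      unfolding faces_inside_def F by blast
    have gin: "g \<in> faces_inside p V' E'" using gi gF by (simp add: faces_inside_def)
    have nin: "?f1 \<notin> insert ?f2 (faces_inside p V' E' - {g})" "?f2 \<notin> faces_inside p V' E' - {g}"
      using ch.split_distinct unfolding faces_inside_def faces_def by auto
    have "card (faces_inside p V' (insert ?e E')) = Suc (Suc (card (faces_inside p V' E' - {g})))"
      unfolding fi using card_insert_disjoint[OF _ nin(1)] card_insert_disjoint[OF _ nin(2)] fF
      by (metis finite_Diff finite_insert)
    also have "Suc (card (faces_inside p V' E' - {g})) = card (faces_inside p V' E')"
      using card_Suc_Diff1[OF fF gin] .
    finally have "card (faces_inside p V' (insert ?e E')) = Suc (card (faces_inside p V' E'))" .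
    moreover have "edges_inside p (insert ?e E') = insert ?e (edges_inside p E')"
      using True by (auto simp: edges_inside_def)
    ultimately show ?thesis using eu fE by (simp add: euler_inside_def)
  next
    case False
    then have go: "g \<subseteq> outside ?J" using gJ eg by blast
    then have "\<not> ?f1 \<subseteq> inside ?J" "\<not> ?f2 \<subseteq> inside ?J" "\<not> g \<subseteq> inside ?J"
      using ch.split_nonempty Js(9) by blast+
    then have "faces_inside p V' (insert ?e E') = faces_inside p V' E'"
      unfolding faces_inside_def F by blast
    moreover have "edges_inside p (insert ?e E') = edges_inside p E'"
      using False by (auto simp: edges_inside_def)
    ultimately show ?thesis using eu by (simp add: euler_inside_def)
  qed
qed

text \<open>Starting from the cycle keeps \<open>p\<close> a cycle at every stage. While a vertex is
  missing, connectedness yields an edge leaving the present vertex set; afterwards every missing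
  edge is a chord. Reachability from \<open>hd p\<close> belongs to the invariant because
  \<open>chord_step\<close> needs the ends of the chord to be connected already.\<close>

lemma connected_graph_faces:
  assumes sub: "subgraph U F" and p: "simple_cycle F p"
    and con: "\<And>u. u \<in> U \<Longrightarrow> (hd p, u) \<in> (edge_rel F)\<^sup>*"
  shows "finite (faces pos \<gamma> U F)" "faces_spanned U F" "euler_inside p U F"
proof -
  have pE: "simple_cycle E p" using p sub simple_cycle_mono by (auto simp: subgraph_def)
  have ne: "p \<noteq> []" using p by (auto simp: simple_cycle_iff)
  have *: "finite (faces pos \<gamma> U F) \<and> faces_spanned U F \<and> euler_inside p U F"
    if "V' \<subseteq> U" "E' \<subseteq> F" "subgraph V' E'" "set p \<subseteq> V'" "cycle_edges p \<subseteq> E'"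
      "\<And>v. v \<in> V' \<Longrightarrow> (hd p, v) \<in> (edge_rel E')\<^sup>*"
      "finite (faces pos \<gamma> V' E')" "faces_spanned V' E'" "euler_inside p V' E'"
    for V' E'
    using that
  proof (induction "card (F - E')" arbitrary: V' E' rule: less_induct)
    case less
    note sub' = less.prems(3)
    have pE': "simple_cycle E' p" using p less.prems(5) by (auto simp: simple_cycle_iff)
    have dec: "card (F - insert e E') < card (F - E')" if "e \<in> F" "e \<notin> E'" for e
      using that finite_subgraph[OF sub] by (intro psubset_card_mono) auto
    consider "V' \<noteq> U" | "V' = U" "E' \<noteq> F" | "V' = U" "E' = F" by blast
    then show ?case
    proof cases
      case 1
      then obtain u where u: "u \<in> U" "u \<notin> V'" using less.prems(1) by blast
      have "hd p \<in> V'" using less.prems(4) ne by auto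
      then obtain a b where ab: "a \<in> V'" "b \<notin> V'" "{a, b} \<in> F"
        using edge_rel_crossing[OF con[OF u(1)] _ u(2)] by blast
      have abE: "{a, b} \<in> E" "b \<in> U" using ab sub by (auto simp: subgraph_def)
      have abE': "{a, b} \<notin> E'" using ab sub' by (auto simp: subgraph_def)
      note step = pendant_step[OF sub' abE(1) ab(1,2) less.prems(7,8) pE' less.prems(9)]
      show ?thesis
      proof (rule less.hyps[OF dec[OF ab(3) abE'], of "insert b V'"])
        show "subgraph (insert b V') (insert {a, b} E')"
          using sub' abE ab(1) sub by (auto simp: subgraph_def)
        have m: "(edge_rel E')\<^sup>* \<subseteq> (edge_rel (insert {a, b} E'))\<^sup>*" by (intro edge_rel_mono) auto
        have "(hd p, a) \<in> (edge_rel (insert {a, b} E'))\<^sup>*" using less.prems(6)[OF ab(1)] m by blast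
        moreover have "(a, b) \<in> edge_rel (insert {a, b} E')" by (simp add: edge_rel_def)
        ultimately have "(hd p, b) \<in> (edge_rel (insert {a, b} E'))\<^sup>*"
          by (rule rtrancl.rtrancl_into_rtrancl)
        then show "(hd p, v) \<in> (edge_rel (insert {a, b} E'))\<^sup>*" if "v \<in> insert b V'" for v
          using that less.prems(6) m by blast
      qed (use less.prems ab abE step in auto)
    next
      case 2
      then obtain e where e: "e \<in> F" "e \<notin> E'" using less.prems(2) by blast
      then have eE: "e \<in> E" "e \<subseteq> U" using sub by (auto simp: subgraph_def)
      then obtain a b where ab: "e = {a, b}" using edge_doubleton by metis
      have abV: "a \<in> V'" "b \<in> V'" using ab eE 2 by auto
      have "(a, hd p) \<in> (edge_rel E')\<^sup>*"
        using less.prems(6)[OF abV(1)] sym_edge_rel sym_rtrancl symD by metis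
      then have "(a, b) \<in> (edge_rel E')\<^sup>*" using less.prems(6)[OF abV(2)] by (rule rtrancl_trans)
      note step = chord_step[OF sub' _ _ abV this less.prems(7,8) pE' less.prems(9), folded ab, OF eE(1) e(2)]
      show ?thesis
      proof (rule less.hyps[OF dec[OF e], of V'])
        show "subgraph V' (insert e E')" using sub' eE 2 by (auto simp: subgraph_def)
        show "(hd p, v) \<in> (edge_rel (insert e E'))\<^sup>*" if "v \<in> V'" for v
          using less.prems(6)[OF that] edge_rel_mono[of E' "insert e E'"] by blast
      qed (use less.prems e step in auto)
    next
      case 3
      then show ?thesis using less.prems by blast
    qed
  qed
  have setp: "set p = \<Union> (cycle_edges p)" using p Union_cycle_edges[of p] by (simp add: simple_cycle_iff)
  have ce: "cycle_edges p \<subseteq> F" using p by (simp add: simple_cycle_iff)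
  have setU: "set p \<subseteq> U" using setp ce sub by (auto simp: subgraph_def)
  have subp: "subgraph (set p) (cycle_edges p)"
    using setU sub setp ce by (auto simp: subgraph_def)
  have conp: "(hd p, v) \<in> (edge_rel (cycle_edges p))\<^sup>*" if "v \<in> set p" for v
    using edge_rel_walk[OF that] edge_rel_mono[of "walk_edges p" "cycle_edges p"] cycle_edges_conv_walk[OF ne]
    by blast
  show "finite (faces pos \<gamma> U F)" "faces_spanned U F" "euler_inside p U F"
    using *[OF setU ce subp _ _ conp cycle_base[OF pE]] by auto
qed

section \<open>Face lengths and minus signs inside a cycle\<close>

lemma sum_face_length:
  "(\<Sum>f\<in>S. face_length pos \<gamma> U F f) = (\<Sum>e\<in>F. \<Sum>f\<in>S. face_mult pos \<gamma> U F f e)"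
  unfolding face_length_def by (rule sum.swap)

lemma sum_length_faces_inside:
  assumes sub: "subgraph U F" and fin: "finite (faces pos \<gamma> U F)" and p: "simple_cycle F p"
  shows "(\<Sum>f\<in>faces_inside p U F. face_length pos \<gamma> U F f) = length p + 2 * card (edges_inside p F)"
proof -
  have fF: "finite F" using finite_subgraph[OF sub] by blast
  have pE: "simple_cycle E p" and ce: "cycle_edges p \<subseteq> F"
    using p sub simple_cycle_mono by (auto simp: subgraph_def simple_cycle_iff)
  have "(\<Sum>f\<in>faces_inside p U F. face_length pos \<gamma> U F f) =
    (\<Sum>e\<in>F. if e \<in> cycle_edges p then 1 else if edge_interior e \<subseteq> inside (cycle_image p) then 2 else 0)"
    unfolding sum_face_length faces_inside_def using sum_face_mult(2)[OF sub _ fin p] by simp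
  also have "\<dots> = (\<Sum>e\<in>F. (if e \<in> cycle_edges p then 1 else 0) + (if e \<in> edges_inside p F then 2 else 0))"
    using in_cycle_not_inside[OF pE] by (intro sum.cong) (auto simp: edges_inside_def)
  also have "\<dots> = card (F \<inter> cycle_edges p) + 2 * card (F \<inter> edges_inside p F)"
    using fF by (simp add: sum.distrib sum.If_cases)
  also have "F \<inter> cycle_edges p = cycle_edges p" using ce by blast
  also have "F \<inter> edges_inside p F = edges_inside p F" by (auto simp: edges_inside_def)
  finally show ?thesis using p card_cycle_edges[of p] by (simp add: simple_cycle_iff)
qed

text \<open>The parity claim is proved for all regions of the span: the plane gives 2 for each edge,
  the inside of a cycle gives its even length plus 2 for each inner edge, and symmetric differences
  add modulo two. For the last step each face must lie either in the region or off it, which is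
  therefore part of the induction.\<close>

lemma even_face_length:
  assumes sub: "subgraph U F" and fin: "finite (faces pos \<gamma> U F)" and sp: "faces_spanned U F"
    and c: "\<And>u v. {u, v} \<in> F \<Longrightarrow> c u \<noteq> (c v :: bool)" and f: "f \<in> faces pos \<gamma> U F"
  shows "even (face_length pos \<gamma> U F f)"
proof -
  let ?F = "faces pos \<gamma> U F" and ?l = "face_length pos \<gamma> U F" and ?X = "drawing pos \<gamma> U F"
  have ne: "h \<noteq> {}" if "h \<in> ?F" for h
    using that in_components_nonempty unfolding faces_def by blast
  have *: "even (\<Sum>f\<in>{f \<in> ?F. f \<subseteq> A}. ?l f) \<and> (\<forall>f\<in>?F. f \<subseteq> A \<or> f \<inter> A = {})"
    if "A \<in> cycle_span F" for A
    using that
  proof induction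
    case cycle_span_UNIV
    have "(\<Sum>f\<in>?F. ?l f) = (\<Sum>e\<in>F. 2)"
      unfolding sum_face_length using sum_face_mult(1)[OF sub _ fin] by simp
    then show ?case by simp
  next
    case (cycle_span_inside q)
    have qE: "simple_cycle E q" and ce: "cycle_edges q \<subseteq> F"
      using cycle_span_inside sub simple_cycle_mono by (auto simp: subgraph_def simple_cycle_iff)
    have "f \<subseteq> inside (cycle_image q) \<or> f \<inter> inside (cycle_image q) = {}" if "f \<in> ?F" for f
      using face_connected_side[OF qE ce that] closed_curveD(9)[OF closed_curve_cycle_image[OF qE]] by blast
    moreover have "even (length q)" using even_length_simple_cycle[of F q c] cycle_span_inside c by blast
    ultimately show ?case
      using sum_length_faces_inside[OF sub fin cycle_span_inside] by (simp add: faces_inside_def)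
  next
    case (cycle_span_sym_diff A B)
    let ?S = "\<lambda>A. {f \<in> ?F. f \<subseteq> A}"
    have fS: "finite (?S A)" for A using fin by simp
    have dich: "f \<subseteq> A \<or> f \<inter> A = {}" "f \<subseteq> B \<or> f \<inter> B = {}" if "f \<in> ?F" for f
      using cycle_span_sym_diff.IH that by auto
    have "f \<subseteq> sym_diff A B \<longleftrightarrow> (f \<subseteq> A) \<noteq> (f \<subseteq> B)" if "f \<in> ?F" for f
      using dich[OF that] ne[OF that] by blast
    then have S: "?S (sym_diff A B) = (?S A - ?S B) \<union> (?S B - ?S A)" by blast
    have "sum ?l (?S (sym_diff A B)) = sum ?l (?S A - ?S B) + sum ?l (?S B - ?S A)"
      unfolding S using fS by (intro sum.union_disjoint) auto
    moreover have "sum ?l (?S A) = sum ?l (?S A - ?S B) + sum ?l (?S A \<inter> ?S B)"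
      using sum.Int_Diff[OF fS, of ?l A "?S B"] by simp
    moreover have "sum ?l (?S B) = sum ?l (?S B - ?S A) + sum ?l (?S A \<inter> ?S B)"
      using sum.Int_Diff[OF fS, of ?l B "?S A"] by (simp add: Int_commute)
    moreover have "even (sum ?l (?S A))" "even (sum ?l (?S B))" using cycle_span_sym_diff.IH by auto
    ultimately have "even (sum ?l (?S (sym_diff A B)))" by presburger
    moreover have "f \<subseteq> sym_diff A B \<or> f \<inter> sym_diff A B = {}" if "f \<in> ?F" for f
      using dich[OF that] by blast
    ultimately show ?case by blast
  qed
  obtain A where A: "A \<in> cycle_span F" "f = A - ?X" using sp f unfolding faces_spanned_def by blast
  \<comment> \<open>Off the drawing \<open>A\<close> is just \<open>f\<close>, so a face contained
    in \<open>A\<close> is contained in \<open>f\<close> and equals it.\<close>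
  have "{h \<in> ?F. h \<subseteq> A} = {f}"
  proof (intro equalityI subsetI)
    fix h assume h: "h \<in> {h \<in> ?F. h \<subseteq> A}"
    then have "h \<subseteq> - ?X" using in_components_subset unfolding faces_def by blast
    then have "h \<subseteq> f" using h A by blast
    then have "h \<inter> f \<noteq> {}" using h ne by blast
    then show "h \<in> {f}" using h f components_eq unfolding faces_def by blast
  qed (use f A in auto)
  then show ?thesis using *[OF A(1)] by simp
qed

text \<open>For an arbitrary cycle the number of inner vertices remains in the formula; it is known
  to be even only for cycles that come from a permutation.\<close>

lemma kasteleyn_cycle:
  assumes sub: "subgraph U F" and p: "simple_cycle F p"
    and con: "\<And>u. u \<in> U \<Longrightarrow> (hd p, u) \<in> (edge_rel F)\<^sup>*"
    and c: "\<And>u v. {u, v} \<in> F \<Longrightarrow> c u \<noteq> (c v :: bool)"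
    and signs: "\<And>f. f \<in> faces pos \<gamma> U F \<Longrightarrow> bounded f \<Longrightarrow>
      face_minus_signs pos \<gamma> U F \<epsilon> f mod 2 = (face_length pos \<gamma> U F f div 2 + 1) mod 2"
  shows "card {e \<in> cycle_edges p. \<epsilon> e = -1} mod 2 =
    (length p div 2 + 1 + card (vertices_inside p U)) mod 2"
proof -
  have fin: "finite (faces pos \<gamma> U F)" and sp: "faces_spanned U F"
    and eu: "card (faces_inside p U F) + card (vertices_inside p U) = 1 + card (edges_inside p F)"
    using connected_graph_faces[OF sub p con] by (auto simp: euler_inside_def)
  let ?S = "faces_inside p U F" and ?l = "face_length pos \<gamma> U F" and ?m = "face_minus_signs pos \<gamma> U F \<epsilon>"
  have fF: "finite F" using finite_subgraph[OF sub] by blast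
  have pE: "simple_cycle E p" and ce: "cycle_edges p \<subseteq> F"
    using p sub simple_cycle_mono by (auto simp: subgraph_def simple_cycle_iff)
  have bd: "bounded f" if "f \<in> ?S" for f
    using that closed_curveD(4)[OF closed_curve_cycle_image[OF pE]] bounded_subset
    by (auto simp: faces_inside_def)
  have SF: "f \<in> faces pos \<gamma> U F" if "f \<in> ?S" for f using that by (simp add: faces_inside_def)
  have "(\<Sum>f\<in>?S. ?m f) mod 2 = (\<Sum>f\<in>?S. ?m f mod 2) mod 2" by (simp add: mod_sum_eq)
  also have "\<dots> = (\<Sum>f\<in>?S. (?l f div 2 + 1) mod 2) mod 2"
    using signs SF bd by simp
  also have "\<dots> = ((\<Sum>f\<in>?S. ?l f div 2) + card ?S) mod 2"
    by (simp only: mod_sum_eq sum.distrib sum_constant mult_1_right of_nat_id)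
  finally have 1: "(\<Sum>f\<in>?S. ?m f) mod 2 = ((\<Sum>f\<in>?S. ?l f div 2) + card ?S) mod 2" .
  \<comment> \<open>Halving commutes with the sum because each face length is even.\<close>
  have "2 * (\<Sum>f\<in>?S. ?l f div 2) = (\<Sum>f\<in>?S. ?l f)"
    unfolding sum_distrib_left using even_face_length[OF sub fin sp c SF] by (intro sum.cong) auto
  also have "\<dots> = length p + 2 * card (edges_inside p F)"
    by (rule sum_length_faces_inside[OF sub fin p])
  finally have 2: "(\<Sum>f\<in>?S. ?l f div 2) = length p div 2 + card (edges_inside p F)" by simp
  let ?M = "{e \<in> F. \<epsilon> e = -1}"
  have "(\<Sum>f\<in>?S. ?m f) = (\<Sum>e\<in>?M. \<Sum>f\<in>?S. face_mult pos \<gamma> U F f e)"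
    unfolding face_minus_signs_def by (rule sum.swap)
  also have "\<dots> = (\<Sum>e\<in>?M. if e \<in> cycle_edges p then 1 else if edge_interior e \<subseteq> inside (cycle_image p) then 2 else 0)"
    unfolding faces_inside_def using sum_face_mult(2)[OF sub _ fin p] by simp
  also have "\<dots> = (\<Sum>e\<in>?M. (if e \<in> cycle_edges p then 1 else 0) + (if e \<in> edges_inside p F then 2 else 0))"
    using in_cycle_not_inside[OF pE] by (intro sum.cong) (auto simp: edges_inside_def)
  also have "\<dots> = card (?M \<inter> cycle_edges p) + 2 * card (?M \<inter> edges_inside p F)"
    using fF by (simp add: sum.distrib sum.If_cases)
  also have "?M \<inter> cycle_edges p = {e \<in> cycle_edges p. \<epsilon> e = -1}" using ce by auto
  finally have 3: "(\<Sum>f\<in>?S. ?m f) = card {e \<in> cycle_edges p. \<epsilon> e = -1} + 2 * card (?M \<inter> edges_inside p F)" .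
  \<comment> \<open>Here \<open>k\<close>, \<open>v\<close> and \<open>d\<close> stand for the
    numbers of faces, vertices and edges inside. Euler's formula makes \<open>k + d\<close>
    congruent to \<open>1 + v\<close>, and the minus signs on inner edges, counted as
    \<open>2 * x\<close>, drop out.\<close>
  have "c mod 2 = (l + 1 + v) mod 2"
    if "m mod 2 = (s + k) mod 2" "s = l + d" "m = c + 2 * x" "k + v = 1 + d" for c l v m s k d x :: nat
  proof -
    have "even m \<longleftrightarrow> even (s + k)" using that(1) by (metis even_iff_mod_2_eq_zero)
    moreover have "even (k + v) \<longleftrightarrow> even (1 + d)" using that(4) by simp
    ultimately have "even c \<longleftrightarrow> even (l + 1 + v)" using that(2,3) by auto
    then show ?thesis by (simp add: mod2_eq_if)
  qed
  from this[OF 1 2 3 eu] show ?thesis .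
qed

end

section \<open>Signs of permutations and traces of monodromies\<close>

lemma sign_cycle_of_list: "distinct cs \<Longrightarrow> sign (cycle_of_list cs) = (-1) ^ (length cs - 1)"
proof (induction cs rule: cycle_of_list.induct)
  case (1 i j cs)
  have "sign (cycle_of_list (i # j # cs)) = sign (Transposition.transpose i j) * sign (cycle_of_list (j # cs))"
    by (simp add: sign_compose permutation_swap_id permutation_of_cycle)
  then show ?case using 1 by (simp add: sign_swap_id del: cycle_of_list.simps)
qed auto

lemma cycle_of_list_nth:
  assumes "distinct cs" "i < length cs"
  shows "cycle_of_list cs (cs ! i) = cs ! (Suc i mod length cs)"
  using arg_cong[OF cyclic_rotation[OF assms(1), of 1], of "\<lambda>l. l ! i"] assms
  by (simp add: nth_rotate1)

lemma orbit_cycle_of_list: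
  assumes "distinct cs" "x \<in> set cs"
  shows "orbit (cycle_of_list cs) x = set cs"
proof
  show "orbit (cycle_of_list cs) x \<subseteq> set cs"
    using permutes_orbit_subset[OF cycle_permutes assms(2)] .
  obtain i where i: "i < length cs" "x = cs ! i" using assms by (auto simp: in_set_conv_nth)
  have *: "((cycle_of_list cs) ^^ k) x = cs ! ((i + k) mod length cs)" for k
  proof (induction k)
    case (Suc k)
    have "(i + k) mod length cs < length cs" using i by (intro mod_less_divisor) auto
    then show ?case using Suc cycle_of_list_nth[OF assms(1)] by (simp add: mod_Suc_eq)
  qed (use i in auto)
  show "set cs \<subseteq> orbit (cycle_of_list cs) x"
  proof
    fix y assume "y \<in> set cs"
    then obtain j where j: "j < length cs" "y = cs ! j" by (auto simp: in_set_conv_nth)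
    \<comment> \<open>Orbits are made of positive powers; one extra full turn keeps the exponent
      positive even when \<open>j \<le> i\<close>.\<close>
    have "(i + (j + length cs - i)) mod length cs = j" using i j by simp
    then have "y = ((cycle_of_list cs) ^^ (j + length cs - i)) x" using * j by simp
    moreover have "0 < j + length cs - i" using i by simp
    ultimately show "y \<in> orbit (cycle_of_list cs) x" unfolding orbit_altdef by blast
  qed
qed

text \<open>In a cycle decomposition each further cycle is disjoint from the previous ones, so it
  forms one new orbit and leaves the others unchanged. A fixed point contributes
  \<open>(-1) ^ 0\<close>.\<close>

lemma sign_eq_prod_orbits:
  assumes "finite S" "p permutes S"
  shows "sign p = (\<Prod>C\<in>orbit p ` S. (-1) ^ (card C - 1))"
proof -
  have "cycle_decomp S p" using cycle_decomposition assms by blast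
  then have "finite S \<and> p permutes S \<and> sign p = (\<Prod>C\<in>orbit p ` S. (-1) ^ (card C - 1))"
  proof induction
    case (comp I p cs)
    let ?q = "cycle_of_list cs \<circ> p"
    have IH: "finite I" "p permutes I" "sign p = (\<Prod>C\<in>orbit p ` I. (-1) ^ (card C - 1))"
      using comp.IH by auto
    have perm: "?q permutes (set cs \<union> I)"
      using permutes_compose[OF permutes_subset[OF IH(2)] permutes_subset[OF cycle_permutes[of cs]]] by blast
    have o1: "orbit ?q x = orbit p x" if "x \<in> I" for x
    proof (rule orbit_cong0[symmetric, OF that])
      show "p \<in> I \<rightarrow> I" using IH(2) by (simp add: permutes_in_image)
      show "p y = ?q y" if "y \<in> I" for y
      proof -
        have "p y \<in> I" using that IH(2) by (simp add: permutes_in_image)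
        then have "p y \<notin> set cs" using comp.hyps(3) by blast
        then show ?thesis using id_outside_supp[of "p y" cs] by simp
      qed
    qed
    have o2: "orbit ?q x = set cs" if "x \<in> set cs" for x
    proof -
      have "orbit (cycle_of_list cs) x = orbit ?q x"
      proof (rule orbit_cong0[OF that])
        show "cycle_of_list cs \<in> set cs \<rightarrow> set cs" using permutes_in_image[OF cycle_permutes[of cs]] by blast
        show "cycle_of_list cs y = ?q y" if "y \<in> set cs" for y
          using that comp.hyps(3) IH(2) by (simp add: permutes_not_in disjoint_iff)
      qed
      then show ?thesis using orbit_cycle_of_list[OF comp.hyps(2) that] by simp
    qed
    have s: "sign ?q = sign (cycle_of_list cs) * sign p"
      using IH by (intro sign_compose permutation_of_cycle) (auto simp: permutation_permutes)
    show ?case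
    \<comment> \<open>An empty cycle adds no orbit, whereas the general case inserts
      \<open>set cs\<close> as a new one.\<close>
    proof (cases "cs = []")
      case True
      then show ?thesis using perm IH by simp
    next
      case False
      have oi: "orbit ?q ` I = orbit p ` I" using o1 by (intro image_cong) auto
      have "orbit ?q ` set cs = (\<lambda>x. set cs) ` set cs" using o2 by (intro image_cong) auto
      then have oc: "orbit ?q ` set cs = {set cs}" using False by (simp add: image_constant_conv)
      have ins: "orbit ?q ` (set cs \<union> I) = insert (set cs) (orbit p ` I)"
        unfolding image_Un oi oc by simp
      have notin: "set cs \<notin> orbit p ` I"
      proof
        assume "set cs \<in> orbit p ` I"
        then have "set cs \<subseteq> I" using permutes_orbit_subset[OF IH(2)] by blast
        then show False using comp.hyps(3) False by (simp add: Int_absorb2)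
      qed
      have sq: "sign ?q = (\<Prod>C\<in>orbit ?q ` (set cs \<union> I). (-1) ^ (card C - 1))"
        unfolding s ins sign_cycle_of_list[OF comp.hyps(2)] IH(3)
        using notin IH(1) distinct_card[OF comp.hyps(2)] by simp
      have "finite (set cs \<union> I)" using IH(1) by simp
      then show ?thesis using perm sq by blast
    qed
  qed auto
  then show ?thesis by blast
qed

text \<open>The adjugate, which is quaternion conjugation and the duality under which a Kasteleyn
  matrix is self-dual. It inverts matrices of determinant 1, reverses products and preserves
  traces.\<close>

definition adj2 :: "complex^2^2 \<Rightarrow> complex^2^2" where
  "adj2 A = (\<chi> i j. if i = j then A $ (if i = 1 then 2 else 1) $ (if i = 1 then 2 else 1) else - (A $ i $ j))"

lemma adj2_mult: "adj2 (A ** B) = adj2 B ** adj2 A"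
  unfolding vec_eq_iff forall_2 adj2_def matrix_matrix_mult_def by (simp add: sum_2)

lemma adj2_one: "adj2 (mat 1) = mat 1"
  unfolding vec_eq_iff forall_2 adj2_def mat_def by simp

lemma trace_adj2: "trace (adj2 A) = trace A"
  by (simp add: trace_def adj2_def sum_2)

lemma matrix_inv_eq_adj2:
  assumes "det A = 1"
  shows "matrix_inv A = adj2 A" "A ** adj2 A = mat 1"
proof -
  have 1: "A ** adj2 A = mat 1"
    using assms unfolding vec_eq_iff forall_2 adj2_def matrix_matrix_mult_def mat_def det_2
    by (simp add: sum_2 algebra_simps)
  have 2: "adj2 A ** A = mat 1"
    using assms unfolding vec_eq_iff forall_2 adj2_def matrix_matrix_mult_def mat_def det_2
    by (simp add: sum_2 algebra_simps)
  \<comment> \<open>\<open>matrix_inv\<close> is a choice among two-sided inverses, and the adjugate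
    witnesses that there is one.\<close>
  have inv: "A ** matrix_inv A = mat 1"
    unfolding matrix_inv_def using someI[of "\<lambda>B. A ** B = mat 1 \<and> B ** A = mat 1" "adj2 A"] 1 2 by blast
  have "matrix_inv A = (adj2 A ** A) ** matrix_inv A" using 2 by simp
  also have "\<dots> = adj2 A" using inv by (simp add: matrix_mul_assoc[symmetric])
  finally show "matrix_inv A = adj2 A" .
  show "A ** adj2 A = mat 1" by fact
qed

lemma matrix_prod_Cons: "matrix_prod (A # As) = A ** matrix_prod As"
  by (simp add: matrix_prod_def)

lemma matrix_prod_append: "matrix_prod (As @ Bs) = matrix_prod As ** matrix_prod Bs"
  by (induction As) (auto simp: matrix_prod_def matrix_mul_assoc)

lemma adj2_matrix_prod: "matrix_prod (map adj2 (rev As)) = adj2 (matrix_prod As)"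
  by (induction As) (auto simp: matrix_prod_append adj2_mult adj2_one matrix_prod_Cons matrix_prod_def[of "[]"])

lemma trace_matrix_prod_rotate: "trace (matrix_prod (rotate k As)) = trace (matrix_prod As)"
proof -
  have "trace (matrix_prod (rotate1 As)) = trace (matrix_prod As)" for As
  proof (cases As)
    case (Cons a r)
    then show ?thesis
      using trace_mul_sym[of "matrix_prod r" a]
      by (simp add: matrix_prod_append matrix_prod_Cons matrix_prod_def[of "[]"])
  qed simp
  then show ?thesis by (induction k) auto
qed

definition transports :: "('v \<Rightarrow> 'v \<Rightarrow> complex^2^2) \<Rightarrow> 'v list \<Rightarrow> (complex^2^2) list" where
  "transports \<phi> p = map (\<lambda>i. \<phi> (p ! i) (p ! (Suc i mod length p))) [0..<length p]"

lemma monodromy_transports: "monodromy \<phi> p = matrix_prod (transports \<phi> p)"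
  by (simp add: monodromy_def transports_def)

lemma transports_rotate: "transports \<phi> (rotate k p) = rotate k (transports \<phi> p)"
proof (rule nth_equalityI)
  fix i assume "i < length (transports \<phi> (rotate k p))"
  then have i: "i < length p" by (simp add: transports_def)
  then have pos: "0 < length p" by auto
  have "Suc i mod length p < length p" "(k + i) mod length p < length p" using pos by auto
  moreover have "(k + Suc i mod length p) mod length p = Suc ((k + i) mod length p) mod length p"
    by (simp add: mod_add_right_eq mod_Suc_eq)
  ultimately show "transports \<phi> (rotate k p) ! i = rotate k (transports \<phi> p) ! i"
    using i by (simp add: transports_def nth_rotate)
qed (simp add: transports_def)

text \<open>The closing step comes last in the transports of either vertex list, but reversing a
  list of transports puts it first; the rotation by one corrects this.\<close>

lemma transports_rev:
  assumes "\<And>u v. {u, v} \<in> cycle_edges p \<Longrightarrow> \<phi> v u = adj2 (\<phi> u v)"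
  shows "transports \<phi> (rev p) = map adj2 (rotate1 (rev (transports \<phi> p)))"
proof (rule nth_equalityI)
  fix i assume "i < length (transports \<phi> (rev p))"
  then have i: "i < length p" by (simp add: transports_def)
  let ?n = "length p"
  let ?j = "?n - Suc (Suc i mod ?n)"
  have si: "Suc i mod ?n < ?n" using i by (intro mod_less_divisor) auto
  have j: "?j < ?n" "Suc ?j mod ?n = ?n - Suc i"
    using i by (auto simp: mod_Suc Suc_diff_Suc)
  have "{p ! ?j, p ! (Suc ?j mod ?n)} \<in> cycle_edges p" using j(1) by (auto simp: cycle_edges_def)
  from assms[OF this] have "\<phi> (p ! (?n - Suc i)) (p ! ?j) = adj2 (\<phi> (p ! ?j) (p ! (Suc ?j mod ?n)))"
    by (simp add: j)
  then show "transports \<phi> (rev p) ! i = map adj2 (rotate1 (rev (transports \<phi> p))) ! i"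
    using i si j(1) by (simp add: transports_def nth_rotate1 rev_nth)
qed (simp add: transports_def)

lemma trace_monodromy_rotate: "trace (monodromy \<phi> (rotate k p)) = trace (monodromy \<phi> p)"
  by (simp add: monodromy_transports transports_rotate trace_matrix_prod_rotate)

lemma trace_monodromy_rev:
  assumes "\<And>u v. {u, v} \<in> cycle_edges p \<Longrightarrow> \<phi> v u = adj2 (\<phi> u v)"
  shows "trace (monodromy \<phi> (rev p)) = trace (monodromy \<phi> p)"
proof -
  have "transports \<phi> (rev p) = rotate 1 (map adj2 (rev (transports \<phi> p)))"
    using transports_rev[of p \<phi>] assms by (simp add: rotate1_map)
  then show ?thesis
    by (simp only: monodromy_transports trace_matrix_prod_rotate adj2_matrix_prod trace_adj2)
qed

lemma walk_edges_rev: "walk_edges (rev q) = walk_edges q"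
proof (induction q rule: walk_edges.induct)
  case (1 a b q)
  then show ?case using walk_edges_snoc[of "rev q @ [b]" a] by (simp add: insert_commute)
qed auto

lemma cycle_edges_rev: "cycle_edges (rev p) = cycle_edges p"
proof (cases "p = []")
  case False
  then show ?thesis
    using cycle_edges_conv_walk[of p] cycle_edges_conv_walk[of "rev p"]
    by (simp add: walk_edges_rev hd_rev last_rev insert_commute)
qed simp

text \<open>A vertex of a simple cycle has only its successor and its predecessor as neighbours. The
  summand \<open>length p\<close> prevents the index of the predecessor from being truncated at
  zero.\<close>

lemma cycle_edges_neighbour:
  assumes "distinct p" "i < length p" "{p ! i, x} \<in> cycle_edges p"
  shows "x = p ! (Suc i mod length p) \<or> x = p ! ((i + length p - 1) mod length p)"
proof -
  let ?n = "length p"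
  obtain j where j: "j < ?n" "{p ! i, x} = {p ! j, p ! (Suc j mod ?n)}"
    using assms(3) by (auto simp: cycle_edges_def)
  then have "(p ! i = p ! j \<and> x = p ! (Suc j mod ?n)) \<or> (p ! i = p ! (Suc j mod ?n) \<and> x = p ! j)"
    by (auto simp: doubleton_eq_iff)
  then show ?thesis
  proof
    assume "p ! i = p ! j \<and> x = p ! (Suc j mod ?n)"
    then show ?thesis using assms j nth_eq_iff_index_eq by metis
  next
    assume a: "p ! i = p ! (Suc j mod ?n) \<and> x = p ! j"
    have "Suc j mod ?n < ?n" using j by (intro mod_less_divisor) auto
    then have "i = Suc j mod ?n" using a assms nth_eq_iff_index_eq by metis
    then have "(i + ?n - 1) mod ?n = j" using j by (cases "Suc j = ?n") auto
    then show ?thesis using a by simp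
  qed
qed

text \<open>The first step fixes the direction; from then on the next vertex is the neighbour that
  was not visited just before.\<close>

lemma cycle_edges_inject:
  assumes p: "length p \<ge> 3" "distinct p" and q: "length q \<ge> 3" "distinct q"
    and e: "cycle_edges p = cycle_edges q" and eq: "p ! 0 = q ! 0" "p ! 1 = q ! 1"
  shows "p = q"
proof (rule nth_equalityI)
  show len: "length p = length q" using card_cycle_edges p q e by metis
  have "i < length p \<Longrightarrow> p ! i = q ! i" for i
  proof (induction i rule: less_induct)
    case (less i)
    consider "i = 0" | "i = 1" | j where "i = Suc (Suc j)" by (metis One_nat_def not0_implies_Suc)
    then show ?case
    proof cases
      case 3
      have lt: "Suc j < length p" "j < length p" "Suc (Suc j) < length q" using less 3 len by auto
      have IH: "p ! Suc j = q ! Suc j" "p ! j = q ! j" using less 3 by auto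
      have "{q ! Suc j, q ! Suc (Suc j)} \<in> cycle_edges q"
        using lt by (auto simp: cycle_edges_def intro!: exI[of _ "Suc j"])
      then have "{p ! Suc j, q ! i} \<in> cycle_edges p" using e IH 3 by simp
      from cycle_edges_neighbour[OF p(2) lt(1) this]
      have "q ! i = p ! i \<or> q ! i = q ! j" using lt less.prems 3 IH by auto
      moreover have "q ! i \<noteq> q ! j" using q(2) 3 lt by (simp add: nth_eq_iff_index_eq)
      ultimately show ?thesis by simp
    qed (use eq in auto)
  qed
  then show "p ! i = q ! i" if "i < length p" for i using that .
qed

lemma SL2_connection_adj2:
  assumes "SL2_connection E \<phi>" "{u, v} \<in> E"
  shows "\<phi> v u = adj2 (\<phi> u v)" "\<phi> u v ** \<phi> v u = mat 1"
  using assms matrix_inv_eq_adj2[of "\<phi> u v"] by (auto simp: SL2_connection_def)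

text \<open>Two vertex lists of one cycle differ by a rotation and possibly a reversal. Once they
  are rotated to a common first vertex, the second vertex tells which case occurs.\<close>

lemma trace_monodromy_cong:
  assumes \<phi>: "SL2_connection E \<phi>" and p: "simple_cycle E p" and q: "simple_cycle E q"
    and e: "cycle_edges p = cycle_edges q"
  shows "trace (monodromy \<phi> p) = trace (monodromy \<phi> q)"
proof -
  have p': "length p \<ge> 3" "distinct p" "cycle_edges p \<subseteq> E" and q': "length q \<ge> 3" "distinct q"
    using p q by (auto simp: simple_cycle_iff)
  have "p ! 0 \<in> set p" using p' by (intro nth_mem) auto
  then have "p ! 0 \<in> set q" using Union_cycle_edges[of p] Union_cycle_edges[of q] p' q' e by simp
  then obtain k where k: "k < length q" "p ! 0 = q ! k" by (auto simp: in_set_conv_nth)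
  have "q \<noteq> []" using q' by auto
  define r where "r = rotate k q"
  have r: "length r \<ge> 3" "distinct r" "cycle_edges p = cycle_edges r" "r ! 0 = p ! 0"
    using q' e k nth_rotate[of 0 q k] \<open>q \<noteq> []\<close> by (auto simp: r_def cycle_edges_rotate)
  have "{p ! 0, r ! 1} \<in> cycle_edges p"
    unfolding r(3) using r(1) by (auto simp: cycle_edges_def r(4)[symmetric] intro!: exI[of _ 0])
  from cycle_edges_neighbour[OF p'(2) _ this]
  moreover have pne: "p \<noteq> []" using p' by auto
  ultimately have "r ! 1 = p ! 1 \<or> r ! 1 = p ! (length p - 1)" using p' by auto
  then have "trace (monodromy \<phi> r) = trace (monodromy \<phi> p)"
  proof
    assume "r ! 1 = p ! 1"
    then have "r = p" using r p' by (intro cycle_edges_inject) auto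
    then show ?thesis by simp
  next
    assume a: "r ! 1 = p ! (length p - 1)"
    \<comment> \<open>The reversed list, rotated so that it starts at \<open>p ! 0\<close> again and
      continues with the predecessor of \<open>p ! 0\<close>.\<close>
    let ?s = "rotate (length p - 1) (rev p)"
    have "?s ! 0 = p ! 0" "?s ! 1 = p ! (length p - 1)"
      using p' pne nth_rotate[of 0 "rev p" "length p - 1"] nth_rotate[of 1 "rev p" "length p - 1"]
      by (auto simp: rev_nth)
    then have "r = ?s"
      using r p' a by (intro cycle_edges_inject) (auto simp: cycle_edges_rotate cycle_edges_rev)
    moreover have "trace (monodromy \<phi> (rev p)) = trace (monodromy \<phi> p)"
      using SL2_connection_adj2(1)[OF \<phi>] p' by (intro trace_monodromy_rev) auto
    ultimately show ?thesis using trace_monodromy_rotate by metis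
  qed
  then show ?thesis by (simp add: r_def trace_monodromy_rotate)
qed

text \<open>This frees \<open>cycle_trace\<close> from its arbitrary representative, so that the
  list of an orbit can be used instead.\<close>

lemma cycle_trace_eq:
  assumes "SL2_connection E \<phi>" "simple_cycle E p"
  shows "cycle_trace E \<phi> (cycle_edges p) = trace (monodromy \<phi> p)"
proof -
  let ?q = "SOME q. simple_cycle E q \<and> cycle_edges q = cycle_edges p"
  have "simple_cycle E ?q \<and> cycle_edges ?q = cycle_edges p"
    by (rule someI[of _ p]) (use assms in auto)
  then show ?thesis
    unfolding cycle_trace_def using trace_monodromy_cong[OF assms(1)] assms(2) by blast
qed

section \<open>Double-dimer configurations and permutations\<close>

lemma permutation_on_finite: "finite V \<Longrightarrow> \<sigma> permutes V \<Longrightarrow> permutation \<sigma>"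
  by (auto simp: permutation_permutes)

definition orbit_list :: "('v \<Rightarrow> 'v) \<Rightarrow> 'v \<Rightarrow> 'v list" where
  "orbit_list \<sigma> v = map (\<lambda>i. (\<sigma> ^^ i) v) [0..<card (orbit \<sigma> v)]"

lemma orbit_list_props:
  assumes "permutation \<sigma>"
  shows "(\<sigma> ^^ card (orbit \<sigma> v)) v = v" "distinct (orbit_list \<sigma> v)"
    "set (orbit_list \<sigma> v) = orbit \<sigma> v" "length (orbit_list \<sigma> v) = card (orbit \<sigma> v)"
    "card (orbit \<sigma> v) > 0"
proof -
  \<comment> \<open>The time of first return to \<open>v\<close>, which is the size of the
    orbit.\<close>
  let ?d = "funpow_dist1 \<sigma> v v"
  have v: "v \<in> orbit \<sigma> v" using permutation_self_in_orbit[OF assms] .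
  have inj: "inj_on (\<lambda>n. (\<sigma> ^^ n) v) {0..<?d}" by (rule inj_on_funpow_dist1[OF v])
  have orb: "orbit \<sigma> v = (\<lambda>n. (\<sigma> ^^ n) v) ` {0..<?d}" by (rule orbit_conv_funpow_dist1[OF v])
  have card: "card (orbit \<sigma> v) = ?d" unfolding orb using card_image[OF inj] by simp
  show "(\<sigma> ^^ card (orbit \<sigma> v)) v = v" unfolding card by (rule funpow_dist1_prop[OF v])
  show "distinct (orbit_list \<sigma> v)" unfolding orbit_list_def card distinct_map set_upt
    using inj distinct_upt by blast
  show "set (orbit_list \<sigma> v) = orbit \<sigma> v" unfolding orbit_list_def card set_map set_upt orb[symmetric] ..
  show "length (orbit_list \<sigma> v) = card (orbit \<sigma> v)" by (simp add: orbit_list_def)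
  show "card (orbit \<sigma> v) > 0" using card by simp
qed

lemma orbit_list_nth:
  assumes "permutation \<sigma>" "i < card (orbit \<sigma> v)"
  shows "orbit_list \<sigma> v ! i = (\<sigma> ^^ i) v"
    "orbit_list \<sigma> v ! (Suc i mod card (orbit \<sigma> v)) = \<sigma> (orbit_list \<sigma> v ! i)"
proof -
  show 1: "orbit_list \<sigma> v ! i = (\<sigma> ^^ i) v" using assms by (simp add: orbit_list_def)
  show "orbit_list \<sigma> v ! (Suc i mod card (orbit \<sigma> v)) = \<sigma> (orbit_list \<sigma> v ! i)"
  proof (cases "Suc i = card (orbit \<sigma> v)")
    case True
    then have "\<sigma> ((\<sigma> ^^ i) v) = v" using orbit_list_props(1)[OF assms(1), of v] by (metis funpow.simps(2) o_apply)
    then show ?thesis using True 1 orbit_list_props(5)[OF assms(1), of v] by (simp add: orbit_list_def)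
  next
    case False
    then show ?thesis using assms 1 by (simp add: orbit_list_def)
  qed
qed

definition orbit_edges :: "('v \<Rightarrow> 'v) \<Rightarrow> 'v set \<Rightarrow> 'v set set" where
  "orbit_edges \<sigma> C = (\<lambda>u. {u, \<sigma> u}) ` C"

lemma cycle_edges_orbit_list:
  assumes "permutation \<sigma>"
  shows "cycle_edges (orbit_list \<sigma> v) = orbit_edges \<sigma> (orbit \<sigma> v)"
proof -
  let ?p = "orbit_list \<sigma> v" and ?n = "card (orbit \<sigma> v)"
  have "cycle_edges ?p = (\<lambda>i. {?p ! i, ?p ! (Suc i mod ?n)}) ` {..<?n}"
    using orbit_list_props(4)[OF assms, of v] by (auto simp: cycle_edges_def)
  also have "\<dots> = (\<lambda>i. {?p ! i, \<sigma> (?p ! i)}) ` {..<?n}"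
    using orbit_list_nth(2)[OF assms] by (intro image_cong) auto
  also have "\<dots> = (\<lambda>u. {u, \<sigma> u}) ` (\<lambda>i. ?p ! i) ` {..<?n}" by (simp add: image_image)
  also have "(\<lambda>i. ?p ! i) ` {..<?n} = set ?p"
    using orbit_list_props(4)[OF assms, of v] by (auto simp: set_conv_nth)
  finally show ?thesis by (simp add: orbit_edges_def orbit_list_props(3)[OF assms])
qed

text \<open>Treating the matrix \<open>K\<close> like a connection gives cycles of permutations and
  cycles of the graph one common notion of product.\<close>

lemma perm_cycle_prod_monodromy:
  assumes "permutation \<sigma>"
  shows "perm_cycle_prod K \<sigma> v = monodromy K (orbit_list \<sigma> v)"
proof -
  have "K (orbit_list \<sigma> v ! i) (orbit_list \<sigma> v ! (Suc i mod card (orbit \<sigma> v))) = K ((\<sigma> ^^ i) v) ((\<sigma> ^^ Suc i) v)"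
    if "i < card (orbit \<sigma> v)" for i
    using orbit_list_nth[OF assms that] by simp
  then show ?thesis
    unfolding perm_cycle_prod_def monodromy_def orbit_list_props(4)[OF assms]
    by (intro arg_cong[of _ _ matrix_prod] map_cong) auto
qed

lemma matrix_prod_scaleR:
  "matrix_prod (map (\<lambda>i. s i *\<^sub>R A i) is) = (\<Prod>i\<leftarrow>is. s i) *\<^sub>R matrix_prod (map A is)"
proof (induction "is")
  case (Cons i r)
  have "(a *\<^sub>R A i) ** (b *\<^sub>R M) = (a * b) *\<^sub>R (A i ** M)" for a b and M :: "complex^2^2"
    by (simp add: vec_eq_iff matrix_matrix_mult_def scaleR_sum_right mult.commute)
  then show ?case using Cons by (simp add: matrix_prod_Cons)
qed (simp add: matrix_prod_def)

lemma trace_scaleR: "trace (r *\<^sub>R (A :: complex^2^2)) = of_real r * trace A"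
  by (simp add: trace_def sum_2 scaleR_conv_of_real[symmetric] scaleR_right_distrib)

lemma trace_perm_cycle_prod:
  assumes \<sigma>: "permutation \<sigma>" and E: "\<And>u. u \<in> orbit \<sigma> v \<Longrightarrow> {u, \<sigma> u} \<in> E"
  shows "trace (perm_cycle_prod (kasteleyn_matrix E \<epsilon> \<nu> \<phi>) \<sigma> v) =
    of_real (\<Prod>u\<in>orbit \<sigma> v. \<epsilon> {u, \<sigma> u} * \<nu> {u, \<sigma> u}) * trace (monodromy \<phi> (orbit_list \<sigma> v))"
proof -
  let ?p = "orbit_list \<sigma> v" and ?n = "card (orbit \<sigma> v)"
  have s: "scalar_kasteleyn E \<epsilon> \<nu> (?p ! i) (?p ! (Suc i mod ?n)) = \<epsilon> {?p ! i, \<sigma> (?p ! i)} * \<nu> {?p ! i, \<sigma> (?p ! i)}"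
    if "i < ?n" for i
    using that orbit_list_nth(2)[OF \<sigma> that] E[of "?p ! i"] orbit_list_props(3,4)[OF \<sigma>, of v] nth_mem[of i ?p]
    by (auto simp: scalar_kasteleyn_def)
  have "(\<Prod>i\<leftarrow>[0..<?n]. scalar_kasteleyn E \<epsilon> \<nu> (?p ! i) (?p ! (Suc i mod ?n))) =
    (\<Prod>i\<leftarrow>[0..<?n]. \<epsilon> {?p ! i, \<sigma> (?p ! i)} * \<nu> {?p ! i, \<sigma> (?p ! i)})"
    using s by (intro arg_cong[of _ _ prod_list] map_cong) auto
  also have "\<dots> = (\<Prod>u\<leftarrow>?p. \<epsilon> {u, \<sigma> u} * \<nu> {u, \<sigma> u})"
    using orbit_list_props(4)[OF \<sigma>, of v]
    by (intro arg_cong[of _ _ prod_list] nth_equalityI) auto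
  also have "\<dots> = (\<Prod>u\<in>orbit \<sigma> v. \<epsilon> {u, \<sigma> u} * \<nu> {u, \<sigma> u})"
    unfolding orbit_list_props(3)[OF \<sigma>, of v, symmetric]
    by (rule prod.distinct_set_conv_list[OF orbit_list_props(2)[OF \<sigma>], symmetric])
  finally have pr: "(\<Prod>i\<leftarrow>[0..<?n]. scalar_kasteleyn E \<epsilon> \<nu> (?p ! i) (?p ! (Suc i mod ?n))) = \<dots>" .
  show ?thesis
    unfolding perm_cycle_prod_monodromy[OF \<sigma>] monodromy_def kasteleyn_matrix_def
      orbit_list_props(4)[OF \<sigma>] matrix_prod_scaleR pr trace_scaleR ..
qed

text \<open>A cycle is connected, so a vertex set that meets it and is closed under its edges
  contains all of it. This is how cycles sharing a vertex are shown to coincide.\<close>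

lemma cycle_edges_subset_closed:
  assumes p: "p \<noteq> []" and v: "v \<in> set p" "v \<in> S"
    and step: "\<And>u e. u \<in> S \<Longrightarrow> e \<in> cycle_edges p \<Longrightarrow> u \<in> e \<Longrightarrow> e \<in> D \<and> e \<subseteq> S"
  shows "cycle_edges p \<subseteq> D"
proof -
  have sub: "walk_edges p \<subseteq> cycle_edges p" using cycle_edges_conv_walk[OF p] by blast
  have conn: "(v, u) \<in> (edge_rel (cycle_edges p))\<^sup>*" if "u \<in> set p" for u
  proof -
    have "(hd p, v) \<in> (edge_rel (cycle_edges p))\<^sup>*" "(hd p, u) \<in> (edge_rel (cycle_edges p))\<^sup>*"
      using edge_rel_walk[OF v(1)] edge_rel_walk[OF that] edge_rel_mono[OF sub] by auto
    then show ?thesis using sym_rtrancl[OF sym_edge_rel] by (meson rtrancl_trans symD)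
  qed
  have "u \<in> S" if u: "u \<in> set p" for u
  proof (rule ccontr)
    assume "u \<notin> S"
    then obtain x y where "x \<in> S" "y \<notin> S" "{x, y} \<in> cycle_edges p"
      using edge_rel_crossing[OF conn[OF u] v(2)] by blast
    then show False using step[of x "{x, y}"] by blast
  qed
  then have "set p \<subseteq> S" by blast
  show ?thesis
  proof
    fix e assume e: "e \<in> cycle_edges p"
    then obtain i where i: "e = {p ! i, p ! (Suc i mod length p)}" "i < length p"
      by (auto simp: cycle_edges_def)
    then have "p ! i \<in> S" using \<open>set p \<subseteq> S\<close> by auto
    then show "e \<in> D" using step[OF _ e] i by blast
  qed
qed

section \<open>Permutations along edges and their configurations\<close>

locale bipartite =
  fixes V :: "'v set" and E :: "'v set set" and c :: "'v \<Rightarrow> bool"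
  assumes simple: "simple_graph V E" and colour: "\<And>u v. {u, v} \<in> E \<Longrightarrow> c u \<noteq> c v"
begin

lemma finite_V: "finite V"
  using simple by (simp add: simple_graph_def)

lemma edge_in_V: "{u, v} \<in> E \<Longrightarrow> u \<in> V" "{u, v} \<in> E \<Longrightarrow> v \<in> V"
  using simple by (auto simp: simple_graph_def doubleton_eq_iff)

lemma edge_elements:
  assumes "e \<in> E" obtains u v where "e = {u, v}" "u \<noteq> v" "u \<in> V" "v \<in> V"
  using assms simple by (auto simp: simple_graph_def)

lemma edge_neq: "{u, v} \<in> E \<Longrightarrow> u \<noteq> v"
  using colour by blast

definition adj_perms :: "('v \<Rightarrow> 'v) set" where
  "adj_perms = {\<sigma>. \<sigma> permutes V \<and> (\<forall>v\<in>V. {v, \<sigma> v} \<in> E)}"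

lemma adj_permsD:
  assumes "\<sigma> \<in> adj_perms"
  shows "\<sigma> permutes V" "permutation \<sigma>" "\<And>v. v \<in> V \<Longrightarrow> {v, \<sigma> v} \<in> E"
    "\<And>v. v \<in> V \<Longrightarrow> \<sigma> v \<in> V" "\<And>v. v \<in> V \<Longrightarrow> \<sigma> v \<noteq> v" "inj \<sigma>"
    "\<And>v. v \<in> V \<Longrightarrow> orbit \<sigma> v \<subseteq> V"
proof -
  show p: "\<sigma> permutes V" and e: "\<And>v. v \<in> V \<Longrightarrow> {v, \<sigma> v} \<in> E" using assms by (auto simp: adj_perms_def)
  show "permutation \<sigma>" using permutation_on_finite[OF finite_V p] .
  show "\<sigma> v \<in> V" if "v \<in> V" for v using permutes_in_image[OF p] that by simp
  show "\<sigma> v \<noteq> v" if "v \<in> V" for v using edge_neq[OF e[OF that]] by simp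
  show "inj \<sigma>" using permutes_inj[OF p] .
  show "orbit \<sigma> v \<subseteq> V" if "v \<in> V" for v by (rule permutes_orbit_subset[OF p that])
qed

lemma finite_adj_perms: "finite adj_perms"
  using finite_permutations[OF finite_V] by (rule rev_finite_subset) (auto simp: adj_perms_def)

text \<open>Every step changes the colour, and a full turn restores it.\<close>

lemma even_card_orbit:
  assumes \<sigma>: "\<sigma> \<in> adj_perms" and v: "v \<in> V"
  shows "even (card (orbit \<sigma> v))"
proof -
  have "(\<sigma> ^^ i) v \<in> V \<and> (c ((\<sigma> ^^ i) v) \<longleftrightarrow> (c v \<longleftrightarrow> even i))" for i
  proof (induction i)
    case (Suc i)
    then show ?case using colour[OF adj_permsD(3)[OF \<sigma>, of "(\<sigma> ^^ i) v"]] adj_permsD(4)[OF \<sigma>] by auto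
  qed (use v in auto)
  from this[of "card (orbit \<sigma> v)"] show ?thesis
    using orbit_list_props(1)[OF adj_permsD(2)[OF \<sigma>], of v] by auto
qed

lemma orbit_card_two:
  assumes \<sigma>: "\<sigma> \<in> adj_perms" and v: "v \<in> V" and n: "\<not> card (orbit \<sigma> v) \<ge> 3"
  shows "card (orbit \<sigma> v) = 2" "\<sigma> (\<sigma> v) = v"
proof -
  have "card (orbit \<sigma> v) > 0" using orbit_list_props(5)[OF adj_permsD(2)[OF \<sigma>]] .
  moreover have "n = 2" if "n > 0" "even n" "\<not> n \<ge> 3" for n :: nat using that by presburger
  ultimately show "card (orbit \<sigma> v) = 2" using even_card_orbit[OF \<sigma> v] n by blast
  then show "\<sigma> (\<sigma> v) = v"
    using orbit_list_props(1)[OF adj_permsD(2)[OF \<sigma>], of v] by (simp add: numeral_2_eq_2)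
qed

lemma orbit_card_ge_3:
  assumes \<sigma>: "\<sigma> \<in> adj_perms" and v: "v \<in> V" and n: "card (orbit \<sigma> v) \<ge> 3" and u: "u \<in> orbit \<sigma> v"
  shows "\<sigma> (\<sigma> u) \<noteq> u"
proof
  assume a: "\<sigma> (\<sigma> u) = u"
  have "orbit \<sigma> u = orbit \<sigma> v"
    using orbit_cyclic_eq3[OF cyclic_on_orbit'[OF adj_permsD(2)[OF \<sigma>]] u] .
  moreover have "orbit \<sigma> u \<subseteq> {u, \<sigma> u}"
  proof
    fix x assume "x \<in> orbit \<sigma> u" then show "x \<in> {u, \<sigma> u}" by induction (use a in auto)
  qed
  then have "card (orbit \<sigma> u) \<le> card {u, \<sigma> u}" by (intro card_mono) auto
  then have "card (orbit \<sigma> u) \<le> 2" using card_insert_le_m1[of 2 "{\<sigma> u}" u] by simp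
  ultimately show False using n by simp
qed

text \<open>Each vertex contributes the edge along which it moves. The two vertices of a
  transposition contribute the same edge, so doubled edges get multiplicity 2 by themselves.\<close>

definition edge_mset :: "('v \<Rightarrow> 'v) \<Rightarrow> 'v set multiset" where
  "edge_mset \<sigma> = image_mset (\<lambda>v. {v, \<sigma> v}) (mset_set V)"

lemma set_edge_mset: "set_mset (edge_mset \<sigma>) = (\<lambda>v. {v, \<sigma> v}) ` V"
  using finite_V by (simp add: edge_mset_def)

lemma count_image_mset_set: "finite A \<Longrightarrow> count (image_mset f (mset_set A)) y = card {x \<in> A. f x = y}"
proof -
  assume A: "finite A"
  have "count (image_mset f (mset_set A)) y = (\<Sum>x | x \<in> A \<and> y = f x. count (mset_set A) x)"
    using A by (simp add: count_image_mset')
  also have "\<dots> = (\<Sum>x | x \<in> A \<and> y = f x. 1)" using A by (intro sum.cong) auto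
  also have "\<dots> = card {x \<in> A. f x = y}" by (simp add: eq_commute)
  finally show ?thesis .
qed

lemma count_edge_mset:
  assumes "u \<noteq> w" "u \<in> V" "w \<in> V"
  shows "count (edge_mset \<sigma>) {u, w} = of_bool (\<sigma> u = w) + of_bool (\<sigma> w = u)"
proof -
  have "{x \<in> V. {x, \<sigma> x} = {u, w}} = (if \<sigma> u = w then {u} else {}) \<union> (if \<sigma> w = u then {w} else {})"
    using assms by (auto simp: doubleton_eq_iff)
  then show ?thesis using assms
    unfolding edge_mset_def count_image_mset_set[OF finite_V] by auto
qed

lemma edge_mset_neighbour:
  assumes "\<sigma> \<in> adj_perms" "{u, x} \<in># edge_mset \<sigma>"
  shows "x = \<sigma> u \<or> u = \<sigma> x"
  using assms(2) unfolding set_edge_mset by (auto simp: doubleton_eq_iff)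

lemma simple_cycle_orbit_list:
  assumes \<sigma>: "\<sigma> \<in> adj_perms" and v: "v \<in> V" and n: "card (orbit \<sigma> v) \<ge> 3"
  shows "simple_cycle E (orbit_list \<sigma> v)"
  using adj_permsD(3,7)[OF \<sigma>] v n
  by (auto simp: simple_cycle_iff orbit_list_props[OF adj_permsD(2)[OF \<sigma>]]
      cycle_edges_orbit_list[OF adj_permsD(2)[OF \<sigma>]] orbit_edges_def)

text \<open>The orbits that become nontrivial cycles. For a permutation in \<open>adj_perms\<close>
  the other orbits are transpositions, which become doubled edges.\<close>

definition long_orbits :: "('v \<Rightarrow> 'v) \<Rightarrow> 'v set set" where
  "long_orbits \<sigma> = {C \<in> orbit \<sigma> ` V. card C \<ge> 3}"

lemma count_long_orbit:
  assumes \<sigma>: "\<sigma> \<in> adj_perms" and v: "v \<in> V" and n: "card (orbit \<sigma> v) \<ge> 3" and u: "u \<in> orbit \<sigma> v"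
  shows "count (edge_mset \<sigma>) {u, \<sigma> u} = 1"
proof -
  have "u \<in> V" using adj_permsD(7)[OF \<sigma> v] u by blast
  then show ?thesis
    using count_edge_mset[of u "\<sigma> u" \<sigma>] adj_permsD(4,5)[OF \<sigma> \<open>u \<in> V\<close>] orbit_card_ge_3[OF assms] by auto
qed

lemma Union_orbit_edges: "permutation \<sigma> \<Longrightarrow> \<Union> (orbit_edges \<sigma> (orbit \<sigma> v)) = orbit \<sigma> v"
  using orbit.step[of _ \<sigma> v] by (auto simp: orbit_edges_def)

lemma simple_cycle_in_V:
  assumes "simple_cycle E p" shows "set p \<subseteq> V" "p \<noteq> []" "set p = \<Union> (cycle_edges p)"
proof -
  show "set p = \<Union> (cycle_edges p)" using Union_cycle_edges[of p] assms by (simp add: simple_cycle_iff)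
  then show "set p \<subseteq> V" using assms edge_elements by (force simp: simple_cycle_iff)
  show "p \<noteq> []" using assms by (auto simp: simple_cycle_iff)
qed

text \<open>The edges of the configuration at a vertex lead only to its image and its preimage.
  Hence a cycle through \<open>v\<close> cannot leave the orbit of \<open>v\<close>, nor can the
  orbit leave the cycle.\<close>

lemma dd_cycles_edge_mset:
  assumes \<sigma>: "\<sigma> \<in> adj_perms"
  shows "dd_cycles E (edge_mset \<sigma>) = orbit_edges \<sigma> ` long_orbits \<sigma>"
proof (intro equalityI subsetI)
  note perm = adj_permsD(2)[OF \<sigma>]
  fix C assume "C \<in> orbit_edges \<sigma> ` long_orbits \<sigma>"
  then obtain v where v: "v \<in> V" "card (orbit \<sigma> v) \<ge> 3" "C = orbit_edges \<sigma> (orbit \<sigma> v)"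
    by (auto simp: long_orbits_def)
  then have C: "C = cycle_edges (orbit_list \<sigma> v)" by (simp add: cycle_edges_orbit_list[OF perm])
  have "count (edge_mset \<sigma>) e = 1" if "e \<in> C" for e
    using that count_long_orbit[OF \<sigma> v(1,2)] v(3) by (auto simp: orbit_edges_def)
  then show "C \<in> dd_cycles E (edge_mset \<sigma>)"
    using C simple_cycle_orbit_list[OF \<sigma> v(1,2)] by (auto simp: dd_cycles_def)
next
  note perm = adj_permsD(2)[OF \<sigma>]
  fix C assume "C \<in> dd_cycles E (edge_mset \<sigma>)"
  then obtain p where p: "simple_cycle E p" "C = cycle_edges p" "\<And>e. e \<in> C \<Longrightarrow> count (edge_mset \<sigma>) e = 1"
    by (auto simp: dd_cycles_def)
  have p': "length p \<ge> 3" "distinct p" "p \<noteq> []" "set p \<subseteq> V" "set p = \<Union> C"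
    using p simple_cycle_in_V[OF p(1)] by (auto simp: simple_cycle_iff)
  have mem: "e \<in># edge_mset \<sigma>" if "e \<in> C" for e
    using p(3)[OF that] by (metis not_in_iff zero_neq_one)
  define v where "v = p ! 0"
  have "v \<in> set p" unfolding v_def using p'(1) by (intro nth_mem) auto
  then have v: "v \<in> set p" "v \<in> V" using p'(4) by auto
  let ?O = "orbit \<sigma> v"
  have vO: "v \<in> ?O" using permutation_self_in_orbit[OF perm] .
  have sub1: "C \<subseteq> orbit_edges \<sigma> ?O"
    unfolding p(2)
  proof (rule cycle_edges_subset_closed[OF p'(3) v(1) vO])
    fix u e assume u: "u \<in> ?O" "e \<in> cycle_edges p" "u \<in> e"
    then have "e \<in> E" using p(1) by (auto simp: simple_cycle_iff)
    then obtain y z where "e = {y, z}" using edge_elements by blast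
    then obtain x where x: "e = {u, x}" using u(3) by (auto simp: insert_commute)
    have "x = \<sigma> u \<or> u = \<sigma> x" using edge_mset_neighbour[OF \<sigma>] mem u(2) p(2) x by blast
    then have "x \<in> ?O \<and> e \<in> orbit_edges \<sigma> ?O"
    proof
      assume "x = \<sigma> u"
      then show ?thesis using u x orbit.step[OF u(1)] by (auto simp: orbit_edges_def)
    next
      assume a: "u = \<sigma> x"
      then have "x \<in> ?O" using u(1) cyclic_on_f_in[OF adj_permsD(1)[OF \<sigma>] cyclic_on_orbit'[OF perm]] by blast
      then show ?thesis using a x by (auto simp: orbit_edges_def insert_commute)
    qed
    then show "e \<in> orbit_edges \<sigma> ?O \<and> e \<subseteq> ?O" using x u by blast
  qed
  have closed: "\<sigma> u \<in> set p \<and> {u, \<sigma> u} \<in> C" if u: "u \<in> set p" for u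
  proof -
    obtain i where i: "i < length p" "u = p ! i" using u by (auto simp: in_set_conv_nth)
    let ?n = "length p"
    define j where "j = (i + ?n - 1) mod ?n"
    have lt: "j < ?n" "Suc i mod ?n < ?n" unfolding j_def using i by (intro mod_less_divisor; linarith)+
    have sj: "Suc j mod ?n = i" using i by (cases i) (auto simp: j_def mod_Suc)
    have e1: "{u, p ! (Suc i mod ?n)} \<in> C" using i p(2) by (auto simp: cycle_edges_def)
    have e2: "{u, p ! j} \<in> C"
      using i lt sj p(2) by (auto simp: cycle_edges_def insert_commute intro!: exI[of _ j])
    have "j \<noteq> Suc i mod ?n" using i p'(1) by (cases i) (auto simp: j_def mod_Suc)
    then have ne: "p ! (Suc i mod ?n) \<noteq> p ! j" using lt nth_eq_iff_index_eq[OF p'(2)] by metis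
    have n1: "p ! (Suc i mod ?n) = \<sigma> u \<or> u = \<sigma> (p ! (Suc i mod ?n))"
      by (rule edge_mset_neighbour[OF \<sigma> mem[OF e1]])
    have n2: "p ! j = \<sigma> u \<or> u = \<sigma> (p ! j)" by (rule edge_mset_neighbour[OF \<sigma> mem[OF e2]])
    \<comment> \<open>Otherwise both neighbours of \<open>u\<close> on the cycle would be the
      preimage of \<open>u\<close>, although they are distinct.\<close>
    have "p ! (Suc i mod ?n) = \<sigma> u \<or> p ! j = \<sigma> u"
      using n1 n2 ne adj_permsD(6)[OF \<sigma>] by (metis injD)
    then have "{u, \<sigma> u} \<in> C" using e1 e2 by metis
    then show ?thesis using p'(5) by blast
  qed
  have Op: "?O \<subseteq> set p"
  proof
    fix x assume "x \<in> ?O" then show "x \<in> set p" by induction (use v closed in auto)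
  qed
  then have "orbit_edges \<sigma> ?O \<subseteq> C" using closed by (auto simp: orbit_edges_def)
  then have C: "C = orbit_edges \<sigma> ?O" using sub1 by blast
  have finO: "finite ?O" using Op finite_subset by blast
  have "3 \<le> card C" using p'(1,2) p(2) card_cycle_edges by metis
  also have "card C \<le> card ?O" unfolding C orbit_edges_def by (rule card_image_le[OF finO])
  finally show "C \<in> orbit_edges \<sigma> ` long_orbits \<sigma>" using C v by (auto simp: long_orbits_def)
qed

lemma card_orbit_edges:
  assumes \<sigma>: "\<sigma> \<in> adj_perms" and v: "v \<in> V" and n: "card (orbit \<sigma> v) \<ge> 3"
  shows "card (orbit_edges \<sigma> (orbit \<sigma> v)) = card (orbit \<sigma> v)"
  using card_cycle_edges[of "orbit_list \<sigma> v"] n orbit_list_props(2,4)[OF adj_permsD(2)[OF \<sigma>], of v]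
  by (simp add: cycle_edges_orbit_list[OF adj_permsD(2)[OF \<sigma>]])

lemma edge_mset_config:
  assumes \<sigma>: "\<sigma> \<in> adj_perms"
  shows "edge_mset \<sigma> \<in> double_dimer_configs V E"
  unfolding double_dimer_configs_def
proof (intro CollectI conjI ballI)
  note perm = adj_permsD(2)[OF \<sigma>]
  show "set_mset (edge_mset \<sigma>) \<subseteq> E" unfolding set_edge_mset using adj_permsD(3)[OF \<sigma>] by auto
  fix v assume v: "v \<in> V"
  obtain w where w: "w \<in> V" "\<sigma> w = v" using permutes_image[OF adj_permsD(1)[OF \<sigma>]] v by (metis imageE)
  have "filter_mset (\<lambda>e. v \<in> e) (edge_mset \<sigma>) = image_mset (\<lambda>u. {u, \<sigma> u}) (mset_set {u \<in> V. v \<in> {u, \<sigma> u}})"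
    unfolding edge_mset_def using finite_V by (simp add: filter_mset_image_mset filter_mset_mset_set)
  \<comment> \<open>The vertices whose contributed edge contains \<open>v\<close> are
    \<open>v\<close> itself and its preimage.\<close>
  also have "{u \<in> V. v \<in> {u, \<sigma> u}} = {v, w}" using v w adj_permsD(6)[OF \<sigma>] by (auto dest: injD)
  finally have "size (filter_mset (\<lambda>e. v \<in> e) (edge_mset \<sigma>)) = card {v, w}" by simp
  moreover have "v \<noteq> w" using adj_permsD(5)[OF \<sigma> w(1)] w by auto
  ultimately show "size {#e \<in># edge_mset \<sigma>. v \<in> e#} = 2" by simp
next
  note perm = adj_permsD(2)[OF \<sigma>]
  fix e assume "e \<in># edge_mset \<sigma>"
  then obtain v where v: "v \<in> V" "e = {v, \<sigma> v}" unfolding set_edge_mset by auto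
  show "count (edge_mset \<sigma>) e = 2 \<or> (\<exists>C\<in>dd_cycles E (edge_mset \<sigma>). e \<in> C \<and> even (card C))"
  proof (cases "card (orbit \<sigma> v) \<ge> 3")
    case True
    then have "orbit_edges \<sigma> (orbit \<sigma> v) \<in> dd_cycles E (edge_mset \<sigma>)"
      using v by (auto simp: dd_cycles_edge_mset[OF \<sigma>] long_orbits_def)
    moreover have "e \<in> orbit_edges \<sigma> (orbit \<sigma> v)"
      using v permutation_self_in_orbit[OF perm] by (auto simp: orbit_edges_def)
    moreover have "even (card (orbit_edges \<sigma> (orbit \<sigma> v)))"
      using card_orbit_edges[OF \<sigma> v(1) True] even_card_orbit[OF \<sigma> v(1)] by simp
    ultimately show ?thesis by blast
  next
    case False
    then show ?thesis
      using orbit_card_two[OF \<sigma> v(1) False] count_edge_mset[of v "\<sigma> v" \<sigma>] adj_permsD(4,5)[OF \<sigma> v(1)] v by auto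
  qed
qed

end

section \<open>From a configuration back to a permutation\<close>

context bipartite
begin

text \<open>Applied to the edges at a vertex: with two of them in all, they are one doubled edge or
  two different edges.\<close>

lemma size_two_cases:
  fixes M :: "'a multiset"
  assumes "size M = 2" "x \<in># M"
  shows "count M x = 2 \<Longrightarrow> set_mset M = {x}"
    and "y \<in># M \<Longrightarrow> x \<noteq> y \<Longrightarrow> set_mset M = {x, y}"
proof -
  have c: "card (set_mset M) \<le> 2"
    using size_mset_mono[OF mset_set_set_mset_msubset[of M]] assms by simp
  show "set_mset M = {x}" if "count M x = 2"
  proof -
    have "replicate_mset 2 x \<subseteq># M" using that count_le_replicate_mset_subset_eq[of 2 M x] by simp
    then have "replicate_mset 2 x = M"
      using assms(1) by (metis mset_subset_size size_replicate_mset subset_mset.le_neq_trans order_less_irrefl)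
    then show ?thesis by (metis set_mset_replicate_mset_subset zero_neq_numeral)
  qed
  show "set_mset M = {x, y}" if "y \<in># M" "x \<noteq> y"
    using that assms c by (intro card_seteq[symmetric]) auto
qed

lemma configD:
  assumes "\<omega> \<in> double_dimer_configs V E"
  shows "\<And>e. e \<in># \<omega> \<Longrightarrow> e \<in> E" "\<And>v. v \<in> V \<Longrightarrow> size {#e \<in># \<omega>. v \<in> e#} = 2"
    "\<And>e. e \<in># \<omega> \<Longrightarrow> count \<omega> e = 2 \<or> (\<exists>C\<in>dd_cycles E \<omega>. e \<in> C)"
  using assms by (auto simp: double_dimer_configs_def)

text \<open>The two edges of the cycle at \<open>v\<close> already use up its degree two.\<close>

lemma config_cycle_edges_at:
  assumes \<omega>: "\<omega> \<in> double_dimer_configs V E" and C: "C \<in> dd_cycles E \<omega>"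
    and v: "v \<in> \<Union> C" and e: "e \<in># \<omega>" "v \<in> e"
  shows "e \<in> C"
proof -
  obtain p where p: "simple_cycle E p" "C = cycle_edges p" "\<And>e. e \<in> C \<Longrightarrow> count \<omega> e = 1"
    using C by (auto simp: dd_cycles_def)
  have mem: "e \<in># \<omega>" if "e \<in> C" for e using p(3)[OF that] by (metis not_in_iff zero_neq_one)
  have p': "length p \<ge> 3" "distinct p" "p \<noteq> []" "set p \<subseteq> V" "set p = \<Union> C"
    using p simple_cycle_in_V[OF p(1)] by (auto simp: simple_cycle_iff)
  have vp: "v \<in> set p" using v p'(5) by blast
  then obtain i where i: "i < length p" "v = p ! i" by (auto simp: in_set_conv_nth)
  let ?n = "length p"
  define j where "j = (i + ?n - 1) mod ?n"
  have lt: "j < ?n" "Suc i mod ?n < ?n" unfolding j_def using i by (intro mod_less_divisor; linarith)+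
  have sj: "Suc j mod ?n = i" using i by (cases i) (auto simp: j_def mod_Suc)
  have e1: "{v, p ! (Suc i mod ?n)} \<in> C" using i p(2) by (auto simp: cycle_edges_def)
  have e2: "{v, p ! j} \<in> C"
    using i lt sj p(2) by (auto simp: cycle_edges_def insert_commute intro!: exI[of _ j])
  have "j \<noteq> Suc i mod ?n" using i p'(1) by (cases i) (auto simp: j_def mod_Suc)
  then have "p ! (Suc i mod ?n) \<noteq> p ! j" using lt nth_eq_iff_index_eq[OF p'(2)] by metis
  then have ne: "{v, p ! (Suc i mod ?n)} \<noteq> {v, p ! j}" by (auto simp: doubleton_eq_iff)
  have "set_mset {#e \<in># \<omega>. v \<in> e#} = {{v, p ! (Suc i mod ?n)}, {v, p ! j}}"
  proof (rule size_two_cases(2)[OF _ _ _ ne])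
    have "v \<in> V" using vp p'(4) by blast
    then show "size {#e \<in># \<omega>. v \<in> e#} = 2" by (rule configD(2)[OF \<omega>])
    show "{v, p ! (Suc i mod ?n)} \<in># {#e \<in># \<omega>. v \<in> e#}" using mem[OF e1] by simp
    show "{v, p ! j} \<in># {#e \<in># \<omega>. v \<in> e#}" using mem[OF e2] by simp
  qed
  then have "e \<in> {{v, p ! (Suc i mod ?n)}, {v, p ! j}}" using e by auto
  then show ?thesis using e1 e2 by auto
qed

lemma config_cycles_disjoint:
  assumes \<omega>: "\<omega> \<in> double_dimer_configs V E" and C: "C \<in> dd_cycles E \<omega>" "C' \<in> dd_cycles E \<omega>"
    and v: "v \<in> \<Union> C" "v \<in> \<Union> C'"
  shows "C = C'"
proof -
  have "C \<subseteq> C'" if C: "C \<in> dd_cycles E \<omega>" "C' \<in> dd_cycles E \<omega>" "v \<in> \<Union> C" "v \<in> \<Union> C'" for C C'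
  proof -
    obtain p where p: "simple_cycle E p" "C = cycle_edges p" "\<And>e. e \<in> C \<Longrightarrow> count \<omega> e = 1"
      using C(1) by (auto simp: dd_cycles_def)
    note p' = simple_cycle_in_V[OF p(1)]
    show ?thesis unfolding p(2)
    proof (rule cycle_edges_subset_closed[OF p'(2) _ C(4)])
      show "v \<in> set p" using C(3) p(2) p'(3) by simp
      fix u e assume u: "u \<in> \<Union> C'" "e \<in> cycle_edges p" "u \<in> e"
      have "e \<in># \<omega>" using p(3)[of e] u(2) p(2) by (metis not_in_iff zero_neq_one)
      then have "e \<in> C'" using config_cycle_edges_at[OF \<omega> C(2) u(1) _ u(3)] by blast
      then show "e \<in> C' \<and> e \<subseteq> \<Union> C'" by blast
    qed
  qed
  then show ?thesis using C v by blast
qed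

lemma config_double_edge:
  assumes \<omega>: "\<omega> \<in> double_dimer_configs V E" and v: "v \<in> V"
    and "count \<omega> e = 2" "v \<in> e" "e' \<in># \<omega>" "v \<in> e'"
  shows "e' = e"
proof -
  have "set_mset {#e \<in># \<omega>. v \<in> e#} = {e}"
  proof (rule size_two_cases(1))
    show "size {#e \<in># \<omega>. v \<in> e#} = 2" using configD(2)[OF \<omega> v] .
    show "count {#e \<in># \<omega>. v \<in> e#} e = 2" "e \<in># {#e \<in># \<omega>. v \<in> e#}"
      using assms(3,4) by (auto simp flip: count_greater_zero_iff)
  qed
  then show ?thesis using assms(5,6) by auto
qed

text \<open>Each nontrivial cycle is run through in the direction of a chosen vertex list, a doubled
  edge exchanges its ends, and points outside \<open>V\<close> stay fixed.\<close>

lemma ex_adj_perm: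
  assumes \<omega>: "\<omega> \<in> double_dimer_configs V E"
  obtains \<sigma> where "\<sigma> \<in> adj_perms" "edge_mset \<sigma> = \<omega>"
proof -
  let ?D = "dd_cycles E \<omega>"
  define P where "P C = (SOME p. simple_cycle E p \<and> cycle_edges p = C)" for C
  have P: "simple_cycle E (P C)" "cycle_edges (P C) = C" "\<And>e. e \<in> C \<Longrightarrow> count \<omega> e = 1"
    "set (P C) = \<Union> C" "distinct (P C)" "length (P C) \<ge> 3" if C: "C \<in> ?D" for C
  proof -
    obtain p where p: "simple_cycle E p" "cycle_edges p = C" "\<And>e. e \<in> C \<Longrightarrow> count \<omega> e = 1"
      using C by (auto simp: dd_cycles_def)
    have "simple_cycle E (P C) \<and> cycle_edges (P C) = C"
      unfolding P_def by (rule someI[of _ p]) (use p in auto)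
    then show a: "simple_cycle E (P C)" "cycle_edges (P C) = C" by auto
    show "\<And>e. e \<in> C \<Longrightarrow> count \<omega> e = 1" by fact
    show "set (P C) = \<Union> C" using simple_cycle_in_V(3)[OF a(1)] a(2) by simp
    show "distinct (P C)" "length (P C) \<ge> 3" using a(1) by (auto simp: simple_cycle_iff)
  qed
  \<comment> \<open>A specification of the image of \<open>v\<close> covering all cases, from which
    the permutation is obtained by choice. Different cycles share no vertex, so the first clause
    never asks for two values.\<close>
  define Q where "Q v w \<longleftrightarrow> (\<forall>C\<in>?D. v \<in> \<Union> C \<longrightarrow> w = cycle_of_list (P C) v) \<and>
      ((\<forall>C\<in>?D. v \<notin> \<Union> C) \<longrightarrow> (if v \<in> V then count \<omega> {v, w} = 2 else w = v))" for v w
  have "\<exists>w. Q v w" for v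
  proof (cases "\<exists>C\<in>?D. v \<in> \<Union> C")
    case True
    then obtain C where C: "C \<in> ?D" "v \<in> \<Union> C" by blast
    then have "\<forall>C'\<in>?D. v \<in> \<Union> C' \<longrightarrow> cycle_of_list (P C) v = cycle_of_list (P C') v"
      using config_cycles_disjoint[OF \<omega> C(1) _ C(2)] by metis
    then show ?thesis unfolding Q_def using C by blast
  next
    case False
    show ?thesis
    proof (cases "v \<in> V")
      case True
      then have "{#e \<in># \<omega>. v \<in> e#} \<noteq> {#}" using configD(2)[OF \<omega> True] by (metis size_empty zero_neq_numeral)
      then obtain e where "e \<in># {#e \<in># \<omega>. v \<in> e#}" by (rule multiset_nonemptyE)
      then have e: "e \<in># \<omega>" "v \<in> e" by auto
      then have "count \<omega> e = 2" using configD(3)[OF \<omega> e(1)] False by blast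
      moreover obtain w where "e = {v, w}"
        using edge_elements[OF configD(1)[OF \<omega> e(1)]] e(2) by (metis insert_commute insertE singletonD)
      ultimately have "Q v w" unfolding Q_def using False True by simp
      then show ?thesis ..
    qed (use False in \<open>auto simp: Q_def\<close>)
  qed
  then obtain \<sigma> where Q: "\<And>v. Q v (\<sigma> v)" by metis
  have \<sigma>: "\<And>v C. C \<in> ?D \<Longrightarrow> v \<in> \<Union> C \<Longrightarrow> \<sigma> v = cycle_of_list (P C) v"
    "\<And>v. v \<in> V \<Longrightarrow> (\<forall>C\<in>?D. v \<notin> \<Union> C) \<Longrightarrow> count \<omega> {v, \<sigma> v} = 2"
    "\<And>v. v \<notin> V \<Longrightarrow> (\<forall>C\<in>?D. v \<notin> \<Union> C) \<Longrightarrow> \<sigma> v = v"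
    using Q unfolding Q_def by presburger+
  have CV: "\<Union> C \<subseteq> V" if "C \<in> ?D" for C
    using P(4)[OF that] simple_cycle_in_V(1)[OF P(1)[OF that]] by simp
  have cyc: "\<sigma> v \<in> \<Union> C \<and> {v, \<sigma> v} \<in> C" if C: "C \<in> ?D" and v: "v \<in> \<Union> C" for v C
  proof -
    obtain i where i: "i < length (P C)" "v = P C ! i" using v P(4)[OF C] by (metis in_set_conv_nth)
    have "\<sigma> v = P C ! (Suc i mod length (P C))"
      using \<sigma>(1)[OF C v] cycle_of_list_nth[OF P(5)[OF C] i(1)] i(2) by simp
    moreover have "{P C ! i, P C ! (Suc i mod length (P C))} \<in> cycle_edges (P C)"
      unfolding cycle_edges_def using i(1) by blast
    ultimately have "{v, \<sigma> v} \<in> C" unfolding P(2)[OF C] i(2) by simp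
    then show ?thesis by blast
  qed
  have mem: "{v, \<sigma> v} \<in># \<omega>" if v: "v \<in> V" for v
  proof (cases "\<exists>C\<in>?D. v \<in> \<Union> C")
    case True
    then obtain C where C: "C \<in> ?D" "{v, \<sigma> v} \<in> C" using cyc by blast
    have "count \<omega> {v, \<sigma> v} = 1" by (rule P(3)[OF C])
    then show ?thesis by (metis not_in_iff zero_neq_one)
  next
    case False
    then have "count \<omega> {v, \<sigma> v} = 2" using \<sigma>(2)[OF v] by blast
    then show ?thesis by (metis not_in_iff zero_neq_numeral)
  qed
  have inE: "{v, \<sigma> v} \<in> E" if "v \<in> V" for v using configD(1)[OF \<omega> mem[OF that]] .
  have inj: "inj_on \<sigma> V"
  proof (rule inj_onI)
    \<comment> \<open>The doubled edge at \<open>u\<close> is the only edge at the common image, so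
      \<open>v\<close> is an end of that same edge.\<close>
    have double: "u = v" if u: "u \<in> V" "v \<in> V" "\<sigma> u = \<sigma> v" and d: "\<forall>C\<in>?D. u \<notin> \<Union> C" for u v
    proof -
      have "{v, \<sigma> v} = {u, \<sigma> v}"
        using config_double_edge[OF \<omega> edge_in_V(2)[OF inE[OF u(1)]] \<sigma>(2)[OF u(1) d] _ mem[OF u(2)]] u(3) by auto
      then show ?thesis using edge_neq[OF inE[OF u(2)]] by (auto simp: doubleton_eq_iff)
    qed
    fix u v assume uv: "u \<in> V" "v \<in> V" "\<sigma> u = \<sigma> v"
    consider "\<forall>C\<in>?D. u \<notin> \<Union> C" | "\<forall>C\<in>?D. v \<notin> \<Union> C"
      | C C' where "C \<in> ?D" "u \<in> \<Union> C" "C' \<in> ?D" "v \<in> \<Union> C'" by blast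
    then show "u = v"
    proof cases
      case 3
      then have "\<sigma> u \<in> \<Union> C" "\<sigma> u \<in> \<Union> C'" using cyc[OF 3(1,2)] cyc[OF 3(3,4)] uv(3) by auto
      then have CC: "C = C'" using config_cycles_disjoint[OF \<omega> 3(1,3)] by blast
      have "cycle_of_list (P C) u = cycle_of_list (P C) v" using \<sigma>(1) 3 CC uv(3) by metis
      then show ?thesis using permutes_inj[OF cycle_permutes[of "P C"]] by (metis injD)
    qed (use double uv in metis)+
  qed
  have \<sigma>V: "\<sigma> ` V \<subseteq> V" using edge_in_V(2)[OF inE] by blast
  have "bij_betw \<sigma> V V" using inj endo_inj_surj[OF finite_V \<sigma>V inj] by (simp add: bij_betw_def)
  then have "\<sigma> permutes V" using \<sigma>(3) CV by (intro bij_imp_permutes) blast+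
  then have adj: "\<sigma> \<in> adj_perms" using inE by (simp add: adj_perms_def)
  have "count (edge_mset \<sigma>) e = count \<omega> e" for e
  proof (cases "e \<in># \<omega>")
    case False
    have "e \<notin># edge_mset \<sigma>" unfolding set_edge_mset using mem False by blast
    then show ?thesis using False by (simp add: not_in_iff)
  next
    case e: True
    obtain u w where uw: "e = {u, w}" "u \<noteq> w" "u \<in> V" "w \<in> V"
      using edge_elements[OF configD(1)[OF \<omega> e]] by blast
    note cnt = count_edge_mset[OF uw(2-4), of \<sigma>, folded uw(1)]
    show ?thesis
    proof (cases "count \<omega> e = 2")
      case True
      have *: "\<sigma> x = y" if xy: "e = {x, y}" "x \<in> V" for x y
      proof -
        have "x \<notin> \<Union> C" if C: "C \<in> ?D" for C
        proof
          assume "x \<in> \<Union> C"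
          then have "e \<in> C" using config_cycle_edges_at[OF \<omega> C _ e] xy by blast
          then show False using P(3)[OF C] True by simp
        qed
        then have "{x, \<sigma> x} = {x, y}"
          using config_double_edge[OF \<omega> xy(2) True _ mem[OF xy(2)]] xy(1) by blast
        then show ?thesis using edge_neq[OF inE[OF xy(2)]] by (auto simp: doubleton_eq_iff)
      qed
      show ?thesis using cnt *[of u w] *[of w u] uw True by (auto simp: insert_commute)
    next
      case False
      then obtain C where C: "C \<in> ?D" "e \<in> C" using configD(3)[OF \<omega> e] by blast
      let ?p = "P C" and ?n = "length (P C)"
      have "e \<in> cycle_edges ?p" using C(2) P(2)[OF C(1)] by simp
      then obtain i where i: "i < ?n" "e = {?p ! i, ?p ! (Suc i mod ?n)}"
        by (subst (asm) cycle_edges_def) blast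
      have lt: "Suc i mod ?n < ?n" "Suc (Suc i mod ?n) mod ?n < ?n"
        using i by (intro mod_less_divisor; linarith)+
      have \<sigma>p: "\<sigma> (?p ! k) = ?p ! (Suc k mod ?n)" if "k < ?n" for k
        using \<sigma>(1)[OF C(1)] cycle_of_list_nth[OF P(5)[OF C(1)] that] P(4)[OF C(1)] nth_mem[OF that] by metis
      \<comment> \<open>Since the cycle has length at least 3, the permutation runs along its edge
        in one direction only, which gives multiplicity 1.\<close>
      have "Suc (Suc i mod ?n) mod ?n \<noteq> i" using i P(6)[OF C(1)] by (auto simp: mod_Suc)
      then have "\<sigma> (?p ! (Suc i mod ?n)) \<noteq> ?p ! i"
        using \<sigma>p[OF lt(1)] nth_eq_iff_index_eq[OF P(5)[OF C(1)] lt(2) i(1)] by simp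
      moreover have "\<sigma> (?p ! i) = ?p ! (Suc i mod ?n)" by (rule \<sigma>p[OF i(1)])
      moreover have "(u = ?p ! i \<and> w = ?p ! (Suc i mod ?n)) \<or> (w = ?p ! i \<and> u = ?p ! (Suc i mod ?n))"
        using i(2) uw(1) by (auto simp: doubleton_eq_iff)
      ultimately have "count (edge_mset \<sigma>) e = 1" unfolding cnt by auto
      then show ?thesis using P(3)[OF C] by simp
    qed
  qed
  then have "edge_mset \<sigma> = \<omega>" by (intro multiset_eqI)
  then show ?thesis using that adj by blast
qed

lemma double_dimer_configs_eq: "double_dimer_configs V E = edge_mset ` adj_perms"
  using ex_adj_perm edge_mset_config by (metis (no_types, lifting) image_iff subsetI subset_antisym)

lemma orbit_partition:
  assumes "\<sigma> \<in> adj_perms" "C \<in> orbit \<sigma> ` V" "v \<in> C"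
  shows "orbit \<sigma> v = C" "v \<in> V" "\<sigma> v \<in> C" "inv \<sigma> v \<in> C"
proof -
  obtain x where x: "x \<in> V" "C = orbit \<sigma> x" using assms by blast
  note cyc = cyclic_on_orbit'[OF adj_permsD(2)[OF assms(1)], of x]
  show "orbit \<sigma> v = C" using orbit_cyclic_eq3[OF cyc] assms(3) x by simp
  show "v \<in> V" using adj_permsD(7)[OF assms(1) x(1)] x assms(3) by blast
  show "\<sigma> v \<in> C" using assms(3) x by (auto intro: orbit.step)
  show "inv \<sigma> v \<in> C"
    using cyclic_on_f_in[OF adj_permsD(1)[OF assms(1)] cyc, of "inv \<sigma> v"] assms(3) x
      permutes_inverses(1)[OF adj_permsD(1)[OF assms(1)], of v] by simp
qed

section \<open>The permutations with a given configuration\<close>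

definition flip :: "('v \<Rightarrow> 'v) \<Rightarrow> 'v set set \<Rightarrow> 'v \<Rightarrow> 'v" where
  "flip \<sigma> S v = (if v \<in> \<Union> S then inv \<sigma> v else \<sigma> v)"

text \<open>Reversing orbits only reassigns edges to vertices: the edge of \<open>v\<close> after
  the flip is the edge of \<open>g v\<close> before it, where \<open>g\<close> goes one step back on
  the reversed orbits. As \<open>g\<close> is a permutation, the multiset of edges is
  unchanged.\<close>

lemma flip_adj_perm:
  assumes \<sigma>: "\<sigma> \<in> adj_perms" and S: "S \<subseteq> orbit \<sigma> ` V"
  shows "flip \<sigma> S \<in> adj_perms" "edge_mset (flip \<sigma> S) = edge_mset \<sigma>"
proof -
  note inv = permutes_inverses[OF adj_permsD(1)[OF \<sigma>]]
  define g where "g v = (if v \<in> \<Union> S then inv \<sigma> v else v)" for v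
  have T: "\<sigma> v \<in> \<Union> S \<and> inv \<sigma> v \<in> \<Union> S" if "v \<in> \<Union> S" for v
    using that S orbit_partition(3,4)[OF \<sigma>] by blast
  have T': "v \<in> \<Union> S" if "\<sigma> v \<in> \<Union> S" for v using T[OF that] inv(2) by metis
  have SV: "\<Union> S \<subseteq> V" using S orbit_partition(2)[OF \<sigma>] by blast
  have gV: "g ` V \<subseteq> V" using T SV by (auto simp: g_def)
  have gi: "inj_on g V"
  proof (rule inj_onI)
    fix x y assume "g x = g y"
    then show "x = y" unfolding g_def by (smt (verit) T inv(1))
  qed
  have "bij_betw g V V" using gi endo_inj_surj[OF finite_V gV gi] by (simp add: bij_betw_def)
  moreover have "g v = v" if "v \<notin> V" for v using that SV by (auto simp: g_def)
  ultimately have g: "g permutes V" by (intro bij_imp_permutes)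
  \<comment> \<open>On a reversed orbit, one step forward and two steps back give the
    inverse.\<close>
  have "flip \<sigma> S = g \<circ> g \<circ> \<sigma>"
  proof
    fix v
    show "flip \<sigma> S v = (g \<circ> g \<circ> \<sigma>) v"
    proof (cases "v \<in> \<Union> S")
      case True
      then have "g (\<sigma> v) = v" using T[OF True] inv(2) unfolding g_def by presburger
      then show ?thesis using True by (simp add: flip_def g_def)
    next
      case False
      then have "\<sigma> v \<notin> \<Union> S" using T' by blast
      then have "g (\<sigma> v) = \<sigma> v" unfolding g_def by (rule if_not_P)
      then show ?thesis using False by (simp add: flip_def)
    qed
  qed
  then have "flip \<sigma> S permutes V"
    using permutes_compose[OF adj_permsD(1)[OF \<sigma>] permutes_compose[OF g g]] by simp
  have edge: "{v, flip \<sigma> S v} = {g v, \<sigma> (g v)}" for v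
    by (auto simp: flip_def g_def inv)
  have "{v, flip \<sigma> S v} \<in> E" if "v \<in> V" for v
    unfolding edge using adj_permsD(3)[OF \<sigma>, of "g v"] gV that by blast
  then show "flip \<sigma> S \<in> adj_perms" using \<open>flip \<sigma> S permutes V\<close> by (simp add: adj_perms_def)
  have "edge_mset (flip \<sigma> S) = image_mset (\<lambda>v. {v, \<sigma> v}) (image_mset g (mset_set V))"
    unfolding edge_mset_def edge by (simp add: image_mset.compositionality comp_def)
  also have "image_mset g (mset_set V) = mset_set V"
    using image_mset_mset_set[OF gi] permutes_image[OF g] by simp
  finally show "edge_mset (flip \<sigma> S) = edge_mset \<sigma>" by (simp add: edge_mset_def)
qed

text \<open>At each vertex \<open>\<tau>\<close> follows \<open>\<sigma>\<close> or its inverse. The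
  choice is constant along a long orbit, since turning back after a step would double an edge of
  multiplicity 1; on a transposition both choices agree.\<close>

lemma fibre_eq_flips:
  assumes \<sigma>: "\<sigma> \<in> adj_perms" and \<tau>: "\<tau> \<in> adj_perms" and eq: "edge_mset \<tau> = edge_mset \<sigma>"
  shows "\<exists>S\<subseteq>long_orbits \<sigma>. \<tau> = flip \<sigma> S"
proof -
  note inv = permutes_inverses[OF adj_permsD(1)[OF \<sigma>]]
  have dich: "\<tau> v = \<sigma> v \<or> \<tau> v = inv \<sigma> v" if v: "v \<in> V" for v
  proof -
    have "{v, \<tau> v} \<in># edge_mset \<sigma>" using v unfolding eq[symmetric] set_edge_mset by blast
    then have "\<tau> v = \<sigma> v \<or> v = \<sigma> (\<tau> v)" using edge_mset_neighbour[OF \<sigma>] by blast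
    then show ?thesis using inv(2) by metis
  qed
  have same: "\<tau> u = \<sigma> u" if C: "C \<in> long_orbits \<sigma>" and v: "v \<in> C" "\<tau> v = \<sigma> v" and u: "u \<in> C" for C u v
  proof -
    have CO: "C \<in> orbit \<sigma> ` V" "card C \<ge> 3" using C by (auto simp: long_orbits_def)
    have Cv: "orbit \<sigma> v = C" "v \<in> V" using orbit_partition[OF \<sigma> CO(1) v(1)] by auto
    have step: "\<tau> (\<sigma> x) = \<sigma> (\<sigma> x)" if x: "x \<in> C" "\<tau> x = \<sigma> x" for x
    proof (rule ccontr)
      assume a: "\<tau> (\<sigma> x) \<noteq> \<sigma> (\<sigma> x)"
      have xV: "x \<in> V" using orbit_partition(2)[OF \<sigma> CO(1) x(1)] .
      then have "\<tau> (\<sigma> x) = x" using dich[OF adj_permsD(4)[OF \<sigma> xV]] a inv(2) by metis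
      then have "count (edge_mset \<tau>) {x, \<sigma> x} = 2"
        using count_edge_mset[of x "\<sigma> x" \<tau>] adj_permsD(4,5)[OF \<sigma> xV] xV x(2) by auto
      moreover have "count (edge_mset \<sigma>) {x, \<sigma> x} = 1"
        by (rule count_long_orbit[OF \<sigma> Cv(2)]) (use Cv CO x in auto)
      ultimately show False using eq by simp
    qed
    have "u \<in> orbit \<sigma> v" using u Cv by simp
    then show ?thesis
    proof induction
      case base
      then show ?case using step v by blast
    next
      case (step y)
      then show ?case using \<open>\<And>x. x \<in> C \<Longrightarrow> \<tau> x = \<sigma> x \<Longrightarrow> \<tau> (\<sigma> x) = \<sigma> (\<sigma> x)\<close> Cv by blast
    qed
  qed
  define S where "S = {C \<in> long_orbits \<sigma>. \<exists>v\<in>C. \<tau> v \<noteq> \<sigma> v}"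
  have "\<tau> v = flip \<sigma> S v" for v
  proof (cases "v \<in> \<Union> S")
    case True
    then obtain C u where C: "C \<in> long_orbits \<sigma>" "v \<in> C" "u \<in> C" "\<tau> u \<noteq> \<sigma> u" by (auto simp: S_def)
    then have "\<tau> v \<noteq> \<sigma> v" using same by blast
    moreover have "v \<in> V" using orbit_partition(2)[OF \<sigma> _ C(2)] C(1) by (simp add: long_orbits_def)
    moreover have "flip \<sigma> S v = inv \<sigma> v" unfolding flip_def using True by (rule if_P)
    ultimately show ?thesis using dich[of v] by simp
  next
    case False
    show ?thesis
    proof (cases "v \<in> V")
      case v: True
      have "\<tau> v = \<sigma> v"
      proof (cases "card (orbit \<sigma> v) \<ge> 3")
        case True
        then have "orbit \<sigma> v \<in> long_orbits \<sigma>" using v by (simp add: long_orbits_def)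
        then show ?thesis using False permutation_self_in_orbit[OF adj_permsD(2)[OF \<sigma>], of v]
          unfolding S_def by blast
      next
        case c: False
        then have "inv \<sigma> v = \<sigma> v" using orbit_card_two(2)[OF \<sigma> v c] inv(2) by metis
        then show ?thesis using dich[OF v] by simp
      qed
      then show ?thesis using False by (simp add: flip_def)
    next
      case o: False
      then show ?thesis using False adj_permsD(1)[OF \<sigma>] adj_permsD(1)[OF \<tau>]
        by (simp add: flip_def permutes_not_in)
    qed
  qed
  then have "\<tau> = flip \<sigma> S" by blast
  then show ?thesis by (intro exI[of _ S]) (auto simp: S_def)
qed

text \<open>On a long orbit \<open>\<sigma>\<close> differs from its inverse at every vertex, so
  different sets of reversed orbits give different permutations.\<close>

lemma card_fibre:
  assumes \<sigma>: "\<sigma> \<in> adj_perms"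
  shows "card {\<tau> \<in> adj_perms. edge_mset \<tau> = edge_mset \<sigma>} = 2 ^ card (long_orbits \<sigma>)"
proof -
  note inv = permutes_inverses[OF adj_permsD(1)[OF \<sigma>]]
  have sub: "long_orbits \<sigma> \<subseteq> orbit \<sigma> ` V" by (auto simp: long_orbits_def)
  have "{\<tau> \<in> adj_perms. edge_mset \<tau> = edge_mset \<sigma>} = flip \<sigma> ` Pow (long_orbits \<sigma>)"
    using flip_adj_perm[OF \<sigma>] fibre_eq_flips[OF \<sigma>] sub by (auto, blast+)
  moreover have "inj_on (flip \<sigma>) (Pow (long_orbits \<sigma>))"
  proof (rule inj_onI)
    have *: "S \<subseteq> S'" if S: "S \<subseteq> long_orbits \<sigma>" "S' \<subseteq> long_orbits \<sigma>" "flip \<sigma> S = flip \<sigma> S'" for S S'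
    proof
      fix C assume C: "C \<in> S"
      then obtain x where x: "x \<in> V" "C = orbit \<sigma> x" "card (orbit \<sigma> x) \<ge> 3" using S by (auto simp: long_orbits_def)
      have xC: "x \<in> C" using x permutation_self_in_orbit[OF adj_permsD(2)[OF \<sigma>]] by blast
      have "\<sigma> (\<sigma> x) \<noteq> x" using orbit_card_ge_3[OF \<sigma> x(1,3)] xC x by blast
      then have "inv \<sigma> x \<noteq> \<sigma> x" using inv(1) by metis
      moreover have "flip \<sigma> S x = inv \<sigma> x" using C xC by (auto simp: flip_def)
      ultimately have "x \<in> \<Union> S'" using S(3) by (metis flip_def)
      then obtain C' where C': "C' \<in> S'" "x \<in> C'" by blast
      then have "orbit \<sigma> x = C'" using orbit_partition(1)[OF \<sigma>, of C' x] S(2) sub by blast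
      then show "C \<in> S'" using C' x by simp
    qed
    fix S S' assume "S \<in> Pow (long_orbits \<sigma>)" "S' \<in> Pow (long_orbits \<sigma>)" "flip \<sigma> S = flip \<sigma> S'"
    then show "S = S'" using *[of S S'] *[of S' S] by auto
  qed
  moreover have "finite (long_orbits \<sigma>)" using finite_V by (simp add: long_orbits_def)
  ultimately show ?thesis by (simp add: card_image card_Pow)
qed

lemma inj_orbit_edges:
  assumes "\<sigma> \<in> adj_perms" shows "inj_on (orbit_edges \<sigma>) (orbit \<sigma> ` V)"
proof (rule inj_on_inverseI)
  show "\<Union> (orbit_edges \<sigma> C) = C" if "C \<in> orbit \<sigma> ` V" for C
    using that Union_orbit_edges[OF adj_permsD(2)[OF assms]] by blast
qed

lemma Union_orbits: "\<sigma> \<in> adj_perms \<Longrightarrow> \<Union> (orbit \<sigma> ` V) = V"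
  using adj_permsD(7) permutation_self_in_orbit[OF adj_permsD(2)] by blast

lemma prod_over_orbits:
  fixes f :: "'v \<Rightarrow> 'b :: comm_monoid_mult"
  assumes \<sigma>: "\<sigma> \<in> adj_perms"
  shows "(\<Prod>v\<in>V. f v) = (\<Prod>C\<in>orbit \<sigma> ` V. \<Prod>v\<in>C. f v)"
proof -
  have "prod f (\<Union> (orbit \<sigma> ` V)) = (prod \<circ> prod) f (orbit \<sigma> ` V)"
  proof (rule prod.Union_disjoint)
    show "\<forall>A\<in>orbit \<sigma> ` V. finite A" using adj_permsD(7)[OF \<sigma>] finite_V finite_subset by blast
    show "\<forall>A\<in>orbit \<sigma> ` V. \<forall>B\<in>orbit \<sigma> ` V. A \<noteq> B \<longrightarrow> A \<inter> B = {}"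
      using orbit_partition(1)[OF \<sigma>] by blast
  qed
  then show ?thesis using Union_orbits[OF \<sigma>] by simp
qed

text \<open>This distributes the global sign over the orbits; the halves add up because every orbit
  is even.\<close>

lemma card_V_orbits:
  assumes \<sigma>: "\<sigma> \<in> adj_perms"
  shows "card V div 2 = (\<Sum>C\<in>orbit \<sigma> ` V. card C div 2)"
proof -
  have "card (\<Union> (orbit \<sigma> ` V)) = (\<Sum>C\<in>orbit \<sigma> ` V. card C)"
  proof (rule card_Union_disjoint)
    show "pairwise disjnt (orbit \<sigma> ` V)"
      using orbit_partition(1)[OF \<sigma>] unfolding pairwise_def disjnt_def by blast
    show "\<And>A. A \<in> orbit \<sigma> ` V \<Longrightarrow> finite A" using adj_permsD(7)[OF \<sigma>] finite_V finite_subset by blast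
  qed
  then have "card V = (\<Sum>C\<in>orbit \<sigma> ` V. card C)" using Union_orbits[OF \<sigma>] by simp
  also have "\<dots> = 2 * (\<Sum>C\<in>orbit \<sigma> ` V. card C div 2)"
    unfolding sum_distrib_left using even_card_orbit[OF \<sigma>] by (intro sum.cong) auto
  finally show ?thesis by simp
qed

section \<open>Expansion of the quaternion determinant\<close>

definition qdet_term :: "('v \<Rightarrow> 'v \<Rightarrow> complex^2^2) \<Rightarrow> ('v \<Rightarrow> 'v) \<Rightarrow> complex" where
  "qdet_term K \<sigma> = of_int (sign \<sigma>) *
    (\<Prod>C\<in>orbit \<sigma> ` V. (1/2) * trace (perm_cycle_prod K \<sigma> (SOME v. v \<in> C)))"

text \<open>A step along a non-edge puts a zero matrix among the factors of its cycle.\<close>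

lemma qdet_term_zero:
  assumes \<sigma>: "\<sigma> permutes V" and n: "\<sigma> \<notin> adj_perms"
  shows "qdet_term (kasteleyn_matrix E \<epsilon> \<nu> \<phi>) \<sigma> = 0"
proof -
  note perm = permutation_on_finite[OF finite_V \<sigma>]
  let ?K = "kasteleyn_matrix E \<epsilon> \<nu> \<phi>"
  obtain u where u: "u \<in> V" "{u, \<sigma> u} \<notin> E" using assms by (auto simp: adj_perms_def)
  let ?C = "orbit \<sigma> u"
  define v where "v = (SOME v. v \<in> ?C)"
  have "v \<in> ?C" unfolding v_def using permutation_self_in_orbit[OF perm] by (rule someI)
  then have orb: "orbit \<sigma> v = ?C" using orbit_cyclic_eq3[OF cyclic_on_orbit'[OF perm]] by blast
  then have "u \<in> set (orbit_list \<sigma> v)" using orbit_list_props(3)[OF perm] permutation_self_in_orbit[OF perm] by blast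
  then obtain i where i: "i < card (orbit \<sigma> v)" "orbit_list \<sigma> v ! i = u"
    by (metis in_set_conv_nth orbit_list_props(4)[OF perm])
  have z: "matrix_prod As = 0" if "0 \<in> set As" for As
    using that by (induction As) (auto simp: matrix_prod_Cons)
  have "?K (orbit_list \<sigma> v ! i) (orbit_list \<sigma> v ! (Suc i mod card (orbit \<sigma> v))) = 0"
    unfolding orbit_list_nth(2)[OF perm i(1)] i(2) using u by (simp add: kasteleyn_matrix_def scalar_kasteleyn_def)
  then have "0 \<in> set (transports ?K (orbit_list \<sigma> v))"
    using i(1) orbit_list_props(4)[OF perm, of v] unfolding transports_def by (auto intro!: image_eqI[of _ _ i])
  then have "perm_cycle_prod ?K \<sigma> v = 0"
    unfolding perm_cycle_prod_monodromy[OF perm] monodromy_transports by (rule z)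
  then have "trace (perm_cycle_prod ?K \<sigma> (SOME v. v \<in> ?C)) = 0"
    by (simp add: v_def[symmetric] trace_def)
  then have "(\<Prod>C\<in>orbit \<sigma> ` V. (1/2) * trace (perm_cycle_prod ?K \<sigma> (SOME v. v \<in> C))) = 0"
    using u(1) finite_V by (intro prod_zero) auto
  then show ?thesis by (simp add: qdet_term_def)
qed

lemma Qdet_eq: "Qdet V (kasteleyn_matrix E \<epsilon> \<nu> \<phi>) = (\<Sum>\<sigma>\<in>adj_perms. qdet_term (kasteleyn_matrix E \<epsilon> \<nu> \<phi>) \<sigma>)"
  unfolding Qdet_def qdet_term_def[symmetric]
  by (rule sum.mono_neutral_right[OF finite_permutations[OF finite_V]])
    (use qdet_term_zero in \<open>auto simp: adj_perms_def\<close>)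

text \<open>The comparison is made orbit by orbit. A long orbit of size \<open>k\<close> carries
  \<open>(-1) ^ (k div 2)\<close> from the global sign, -1 as an even cycle, and
  \<open>(-1) ^ (k div 2 + 1)\<close> from the edges, in all 1; its factor 1/2 survives. For a
  transposition the first two signs cancel, the edge sign is squared, and half the trace of the
  identity is 1.\<close>

lemma qdet_term_weight:
  assumes \<sigma>: "\<sigma> \<in> adj_perms" and \<phi>: "SL2_connection E \<phi>"
    and \<epsilon>: "\<And>e. e \<in> E \<Longrightarrow> \<epsilon> e = 1 \<or> \<epsilon> e = (-1::real)"
    and signs: "\<And>v. v \<in> V \<Longrightarrow> card (orbit \<sigma> v) \<ge> 3 \<Longrightarrow>
      (\<Prod>u\<in>orbit \<sigma> v. \<epsilon> {u, \<sigma> u}) = (-1) ^ (card (orbit \<sigma> v) div 2 + 1)"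
  shows "(-1) ^ (card V div 2) * qdet_term (kasteleyn_matrix E \<epsilon> \<nu> \<phi>) \<sigma> =
    dd_weight E \<nu> \<phi> (edge_mset \<sigma>) / 2 ^ card (long_orbits \<sigma>)"
proof -
  let ?K = "kasteleyn_matrix E \<epsilon> \<nu> \<phi>" and ?O = "orbit \<sigma> ` V"
  note perm = adj_permsD(2)[OF \<sigma>]
  have fin: "finite ?O" using finite_V by simp
  let ?t = "\<lambda>C. (1/2) * trace (perm_cycle_prod ?K \<sigma> (SOME v. v \<in> C))"
  let ?r = "\<lambda>C. if card C \<ge> 3 then (1/2) * cycle_trace E \<phi> (orbit_edges \<sigma> C) else 1"
  have each: "(-1) ^ (card C div 2) * ((-1) ^ (card C - 1) * ?t C) = of_real (\<Prod>u\<in>C. \<nu> {u, \<sigma> u}) * ?r C"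
    if C: "C \<in> ?O" for C
  proof -
    define v where "v = (SOME v. v \<in> C)"
    have "v \<in> C" unfolding v_def using C permutation_self_in_orbit[OF perm] by (intro someI_ex[of "\<lambda>v. v \<in> C"]) blast
    then have v: "orbit \<sigma> v = C" "v \<in> V" using orbit_partition[OF \<sigma> C] by auto
    have ev: "even (card C)" "card C > 0"
      using even_card_orbit[OF \<sigma> v(2)] orbit_list_props(5)[OF perm, of v] v by auto
    have E': "{u, \<sigma> u} \<in> E" if "u \<in> C" for u using adj_permsD(3)[OF \<sigma>] orbit_partition(2)[OF \<sigma> C that] by blast
    have t: "?t C = (1/2) * (of_real (\<Prod>u\<in>C. \<epsilon> {u, \<sigma> u} * \<nu> {u, \<sigma> u}) * trace (monodromy \<phi> (orbit_list \<sigma> v)))"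
      using trace_perm_cycle_prod[OF perm, of v E \<epsilon> \<nu> \<phi>] E' unfolding v_def[symmetric] v(1) by simp
    have odd: "(-1) ^ (card C - 1) = (-1 :: complex)" using ev by simp
    show ?thesis
    proof (cases "card C \<ge> 3")
      case True
      have "cycle_trace E \<phi> (orbit_edges \<sigma> C) = trace (monodromy \<phi> (orbit_list \<sigma> v))"
        using cycle_trace_eq[OF \<phi> simple_cycle_orbit_list[OF \<sigma> v(2)]] True v(1)
        by (simp add: cycle_edges_orbit_list[OF perm])
      moreover have "(\<Prod>u\<in>C. \<epsilon> {u, \<sigma> u}) = (-1) ^ (card C div 2 + 1)" using signs[OF v(2)] True v(1) by simp
      ultimately show ?thesis
        using True unfolding t odd prod.distrib
        by (simp add: power_add[symmetric] mult_2[symmetric] algebra_simps)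
    next
      case False
      have two: "card C = 2" "\<sigma> (\<sigma> v) = v" using orbit_card_two[OF \<sigma> v(2)] False v(1) by auto
      have "orbit_list \<sigma> v = [v, \<sigma> v]" using two(1) v(1) by (simp add: orbit_list_def numeral_2_eq_2)
      then have "monodromy \<phi> (orbit_list \<sigma> v) = \<phi> v (\<sigma> v) ** \<phi> (\<sigma> v) v"
        by (simp add: monodromy_def matrix_prod_def)
      also have "\<dots> = mat 1" using SL2_connection_adj2(2)[OF \<phi> adj_permsD(3)[OF \<sigma> v(2)]] .
      finally have tr: "trace (monodromy \<phi> (orbit_list \<sigma> v)) = 2" by (simp add: trace_def mat_def sum_2)
      have "C = {v, \<sigma> v}" using orbit_list_props(3)[OF perm, of v] \<open>orbit_list \<sigma> v = [v, \<sigma> v]\<close> v(1) by simp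
      then have "(\<Prod>u\<in>C. \<epsilon> {u, \<sigma> u}) = \<epsilon> {v, \<sigma> v} * \<epsilon> {v, \<sigma> v}"
        using adj_permsD(5)[OF \<sigma> v(2)] two(2) by (simp add: insert_commute)
      also have "\<dots> = 1" using \<epsilon>[OF adj_permsD(3)[OF \<sigma> v(2)]] by auto
      finally show ?thesis
        using False two(1) unfolding t odd prod.distrib tr by simp
    qed
  qed
  have "(-1) ^ (card V div 2) * qdet_term ?K \<sigma> =
    (\<Prod>C\<in>?O. (-1) ^ (card C div 2) * ((-1) ^ (card C - 1) * ?t C))"
    unfolding qdet_term_def sign_eq_prod_orbits[OF finite_V adj_permsD(1)[OF \<sigma>]] card_V_orbits[OF \<sigma>]
      power_sum prod.distrib by simp
  also have "\<dots> = (\<Prod>C\<in>?O. of_real (\<Prod>u\<in>C. \<nu> {u, \<sigma> u}) * ?r C)"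
    using each by (intro prod.cong) auto
  also have "\<dots> = of_real (\<Prod>v\<in>V. \<nu> {v, \<sigma> v}) * (\<Prod>C\<in>?O. ?r C)"
    unfolding prod.distrib prod_over_orbits[OF \<sigma>, of "\<lambda>v. \<nu> {v, \<sigma> v}"] by simp
  also have "(\<Prod>C\<in>?O. ?r C) = (\<Prod>C\<in>long_orbits \<sigma>. (1/2) * cycle_trace E \<phi> (orbit_edges \<sigma> C))"
    unfolding long_orbits_def using fin by (simp add: prod.If_cases Int_def)
  also have "\<dots> = (1/2) ^ card (long_orbits \<sigma>) * (\<Prod>C\<in>long_orbits \<sigma>. cycle_trace E \<phi> (orbit_edges \<sigma> C))"
    by (simp only: prod.distrib prod_constant)
  also have "(\<Prod>C\<in>long_orbits \<sigma>. cycle_trace E \<phi> (orbit_edges \<sigma> C)) = (\<Prod>C\<in>dd_cycles E (edge_mset \<sigma>). cycle_trace E \<phi> C)"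
    unfolding dd_cycles_edge_mset[OF \<sigma>]
    using inj_on_subset[OF inj_orbit_edges[OF \<sigma>], of "long_orbits \<sigma>"]
    by (subst prod.reindex) (auto simp: long_orbits_def)
  also have "(\<Prod>v\<in>V. \<nu> {v, \<sigma> v}) = (\<Prod>e\<in>#edge_mset \<sigma>. \<nu> e)"
    unfolding edge_mset_def by (simp add: prod_unfold_prod_mset image_mset.compositionality comp_def)
  finally show ?thesis unfolding dd_weight_def by (simp add: power_divide)
qed

text \<open>The permutations over one configuration contribute equally, and their number, a power of
  two, cancels the factors 1/2 left by the long orbits.\<close>

lemma Z_dd_eq_Qdet:
  assumes \<phi>: "SL2_connection E \<phi>"
    and \<epsilon>: "\<And>e. e \<in> E \<Longrightarrow> \<epsilon> e = 1 \<or> \<epsilon> e = (-1::real)"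
    and signs: "\<And>\<sigma> v. \<sigma> \<in> adj_perms \<Longrightarrow> v \<in> V \<Longrightarrow> card (orbit \<sigma> v) \<ge> 3 \<Longrightarrow>
      (\<Prod>u\<in>orbit \<sigma> v. \<epsilon> {u, \<sigma> u}) = (-1) ^ (card (orbit \<sigma> v) div 2 + 1)"
  shows "Z_dd V E \<nu> \<phi> = (-1) ^ (card V div 2) * Qdet V (kasteleyn_matrix E \<epsilon> \<nu> \<phi>)"
proof -
  let ?K = "kasteleyn_matrix E \<epsilon> \<nu> \<phi>"
  let ?s = "(-1) ^ (card V div 2) :: complex"
  have fibre: "(\<Sum>\<tau>\<in>{\<tau> \<in> adj_perms. edge_mset \<tau> = \<omega>}. ?s * qdet_term ?K \<tau>) = dd_weight E \<nu> \<phi> \<omega>"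
    if \<omega>: "\<omega> \<in> edge_mset ` adj_perms" for \<omega>
  proof -
    obtain \<sigma> where \<sigma>: "\<sigma> \<in> adj_perms" "\<omega> = edge_mset \<sigma>" using \<omega> by blast
    have "?s * qdet_term ?K \<tau> = dd_weight E \<nu> \<phi> \<omega> / 2 ^ card (long_orbits \<sigma>)"
      if \<tau>: "\<tau> \<in> adj_perms" "edge_mset \<tau> = \<omega>" for \<tau>
    proof -
      \<comment> \<open>The number of long orbits is read off from the configuration, so it is the
        same throughout the fibre.\<close>
      have card: "card (long_orbits \<rho>) = card (dd_cycles E (edge_mset \<rho>))" if "\<rho> \<in> adj_perms" for \<rho>
        unfolding dd_cycles_edge_mset[OF that] using inj_on_subset[OF inj_orbit_edges[OF that], of "long_orbits \<rho>"]
        by (subst card_image) (auto simp: long_orbits_def)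
      have "card (long_orbits \<tau>) = card (long_orbits \<sigma>)"
        unfolding card[OF \<tau>(1)] card[OF \<sigma>(1)] using \<tau>(2) \<sigma>(2) by simp
      then show ?thesis
        using qdet_term_weight[OF \<tau>(1) \<phi> \<epsilon> signs[OF \<tau>(1)], where \<nu> = \<nu>] unfolding \<tau>(2) by metis
    qed
    then have "(\<Sum>\<tau>\<in>{\<tau> \<in> adj_perms. edge_mset \<tau> = \<omega>}. ?s * qdet_term ?K \<tau>) =
      of_nat (card {\<tau> \<in> adj_perms. edge_mset \<tau> = \<omega>}) * (dd_weight E \<nu> \<phi> \<omega> / 2 ^ card (long_orbits \<sigma>))"
      by simp
    then show ?thesis using card_fibre[OF \<sigma>(1)] \<sigma>(2) by simp
  qed
  have "?s * Qdet V ?K = (\<Sum>\<tau>\<in>adj_perms. ?s * qdet_term ?K \<tau>)"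
    unfolding Qdet_eq sum_distrib_left ..
  also have "\<dots> = (\<Sum>\<omega>\<in>edge_mset ` adj_perms. \<Sum>\<tau>\<in>{\<tau> \<in> adj_perms. edge_mset \<tau> = \<omega>}. ?s * qdet_term ?K \<tau>)"
    by (rule sum.image_gen[OF finite_adj_perms])
  also have "\<dots> = Z_dd V E \<nu> \<phi>"
    unfolding Z_dd_def double_dimer_configs_eq using fibre by (intro sum.cong) auto
  finally show ?thesis by simp
qed

end

section \<open>The Kasteleyn identity\<close>

lemma even_iff_of_mod_add:
  fixes k a m :: nat
  assumes "k mod 2 = (a + m) mod 2" "even m"
  shows "even k \<longleftrightarrow> even a"
proof -
  have "even k \<longleftrightarrow> even (a + m)" using assms(1) by (simp only: even_iff_mod_2_eq_zero)
  then show ?thesis using assms(2) by simp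
qed

locale bipartite_plane_graph = plane_graph V E pos \<gamma> + bip: bipartite V E c
  for V :: "'v set" and E :: "'v set set" and pos \<gamma> and c :: "'v \<Rightarrow> bool"
begin

text \<open>For \<open>x\<close> off the orbit of \<open>v\<close>, the edge from \<open>x\<close>
  to \<open>\<sigma> x\<close> shares no vertex with the cycle and so cannot cross its curve. Thus
  \<open>\<sigma>\<close> maps inner vertices to inner vertices and exchanges the colours;
  injections in both directions make the two classes equally large.\<close>

lemma even_vertices_inside:
  assumes \<sigma>: "\<sigma> \<in> bip.adj_perms" and v: "v \<in> V" "card (orbit \<sigma> v) \<ge> 3" and U: "U \<subseteq> V"
    and closed: "\<And>x y. x \<in> U \<Longrightarrow> {x, y} \<in> E \<Longrightarrow> y \<in> U"
  shows "even (card (vertices_inside (orbit_list \<sigma> v) U))"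
proof -
  let ?p = "orbit_list \<sigma> v" and ?J = "cycle_image (orbit_list \<sigma> v)"
  let ?S = "vertices_inside ?p U"
  note perm = bip.adj_permsD(2)[OF \<sigma>]
  have p: "simple_cycle E ?p" by (rule bip.simple_cycle_orbit_list[OF \<sigma> v])
  note J = closed_curve_cycle_image[OF p]
  note Js = closed_curveD[OF J]
  have fS: "finite ?S" using finite_subset[OF U finite_V] by (simp add: vertices_inside_def)
  have step: "\<sigma> x \<in> ?S \<and> c (\<sigma> x) \<noteq> c x" if x: "x \<in> ?S" for x
  proof -
    have xU: "x \<in> U" "x \<in> V" "pos x \<in> inside ?J" using x U by (auto simp: vertices_inside_def)
    have e: "{x, \<sigma> x} \<in> E" by (rule bip.adj_permsD(3)[OF \<sigma> xU(2)])
    have "x \<notin> set ?p"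
    proof
      assume "x \<in> set ?p"
      then have "pos x \<in> ?J" using pos_cycle_image[OF p] by blast
      then show False using Js(10) xU(3) by blast
    qed
    then have xO: "x \<notin> orbit \<sigma> v" using orbit_list_props(3)[OF perm] by blast
    then have sO: "\<sigma> x \<notin> orbit \<sigma> v"
      using cyclic_on_f_in[OF bip.adj_permsD(1)[OF \<sigma>] cyclic_on_orbit'[OF perm]] by blast
    have "edge_image {x, \<sigma> x} \<inter> edge_image e' = {}" if e': "e' \<in> cycle_edges ?p" for e'
    proof -
      have "e' \<subseteq> orbit \<sigma> v"
        using e' bip.simple_cycle_in_V(3)[OF p] orbit_list_props(3)[OF perm, of v] by blast
      then have int: "{x, \<sigma> x} \<inter> e' = {}" using xO sO by blast
      moreover have "e' \<in> E" using e' p by (auto simp: simple_cycle_iff)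
      moreover have "{x, \<sigma> x} \<noteq> e'" using int by blast
      ultimately show ?thesis using edge_image_Int[OF e, of e'] by simp
    qed
    then have disj: "edge_image {x, \<sigma> x} \<inter> ?J = {}" by blast
    have "edge_image {x, \<sigma> x} \<subseteq> inside ?J \<or> edge_image {x, \<sigma> x} \<subseteq> outside ?J"
      by (rule closed_curve_connected_side[OF J connected_arc_image[OF arc_edge[OF e]] disj])
    moreover have "pos x \<in> edge_image {x, \<sigma> x}" "pos (\<sigma> x) \<in> edge_image {x, \<sigma> x}"
      using pos_edge_subset[OF e] by auto
    ultimately have "pos (\<sigma> x) \<in> inside ?J" using xU(3) Js(9) by blast
    then show ?thesis using closed[OF xU(1) e] bip.colour[OF e] by (auto simp: vertices_inside_def)
  qed
  let ?A = "{x \<in> ?S. c x}" and ?B = "{x \<in> ?S. \<not> c x}"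
  have inj: "inj_on \<sigma> X" for X using bip.adj_permsD(6)[OF \<sigma>] inj_on_subset by blast
  have "card ?A \<le> card ?B" "card ?B \<le> card ?A"
    by (rule card_inj_on_le[OF inj]; use step fS in auto)+
  moreover have "card ?S = card ?A + card ?B"
  proof -
    have "?S = ?A \<union> ?B" "?A \<inter> ?B = {}" by auto
    then show ?thesis using card_Un_disjoint[of ?A ?B] fS by (metis (no_types, lifting) finite_Un)
  qed
  ultimately show ?thesis by simp
qed

text \<open>The sign condition concerns each component drawn by itself, so the argument is
  restricted to the component of \<open>v\<close>, which contains the whole orbit and is closed
  under adjacency.\<close>

lemma prod_signs_orbit:
  assumes ks: "kasteleyn_signs V E pos \<gamma> \<epsilon>"
    and \<sigma>: "\<sigma> \<in> bip.adj_perms" and v: "v \<in> V" "card (orbit \<sigma> v) \<ge> 3"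
  shows "(\<Prod>u\<in>orbit \<sigma> v. \<epsilon> {u, \<sigma> u}) = (-1) ^ (card (orbit \<sigma> v) div 2 + 1)"
proof -
  let ?p = "orbit_list \<sigma> v" and ?C = "orbit_edges \<sigma> (orbit \<sigma> v)"
  note perm = bip.adj_permsD(2)[OF \<sigma>]
  have p: "simple_cycle E ?p" by (rule bip.simple_cycle_orbit_list[OF \<sigma> v])
  have CE: "cycle_edges ?p = ?C" by (rule cycle_edges_orbit_list[OF perm])
  have hd: "hd ?p = v"
    using orbit_list_nth(1)[OF perm, of 0 v] v(2) bip.simple_cycle_in_V(2)[OF p] by (simp add: hd_conv_nth)
  \<comment> \<open>This is the relation underlying \<open>graph_components\<close>, chosen so that
    \<open>U\<close> is one of its classes.\<close>
  define R where "R = {(x, y). x \<in> V \<and> y \<in> V \<and> {x, y} \<in> E}"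
  define U where "U = (R\<^sup>* \<inter> V \<times> V) `` {v}"
  define F where "F = induced_edges E U"
  have U_iff: "x \<in> U \<longleftrightarrow> x \<in> V \<and> (v, x) \<in> R\<^sup>*" for x using v(1) by (auto simp: U_def)
  have comp: "U \<in> graph_components V E"
    unfolding graph_components_def U_def R_def using v(1) by (rule quotientI)
  have UV: "U \<subseteq> V" and vU: "v \<in> U" using U_iff v(1) by auto
  have closed: "y \<in> U" if "x \<in> U" "{x, y} \<in> E" for x y
  proof -
    have "(x, y) \<in> R" using that bip.edge_in_V by (auto simp: R_def)
    then show ?thesis using that(1) bip.edge_in_V(2)[OF that(2)] U_iff by (auto intro: rtrancl_into_rtrancl)
  qed
  have sub: "subgraph U F" using UV by (auto simp: subgraph_def F_def induced_edges_def)
  have OU: "orbit \<sigma> v \<subseteq> U"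
  proof
    fix x assume "x \<in> orbit \<sigma> v"
    then show "x \<in> U"
    proof induction
      case base
      show ?case using closed[OF vU bip.adj_permsD(3)[OF \<sigma> v(1)]] .
    next
      case (step y)
      then show ?case using closed[OF step(2)] bip.adj_permsD(3)[OF \<sigma>, of y] UV by blast
    qed
  qed
  have pF: "simple_cycle F ?p"
  proof -
    have "e \<in> F" if "e \<in> cycle_edges ?p" for e
    proof -
      have "e \<subseteq> orbit \<sigma> v"
        using that bip.simple_cycle_in_V(3)[OF p] orbit_list_props(3)[OF perm, of v] by blast
      then show ?thesis using that p OU by (auto simp: F_def induced_edges_def simple_cycle_iff)
    qed
    then show ?thesis using p by (auto simp: simple_cycle_iff)
  qed
  have con: "(hd ?p, u) \<in> (edge_rel F)\<^sup>*" if "u \<in> U" for u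
  proof -
    have "(v, u) \<in> R\<^sup>*" using that U_iff by blast
    then have "u \<in> U \<and> (v, u) \<in> (edge_rel F)\<^sup>*"
    proof (induction rule: rtrancl_induct)
      case (step y z)
      have e: "{y, z} \<in> E" using step(2) by (simp add: R_def)
      then have z: "z \<in> U" using closed step(3) by blast
      then have "(y, z) \<in> edge_rel F"
        using e step(3) by (simp add: edge_rel_def F_def induced_edges_def)
      then show ?case using z step(3) by (auto intro: rtrancl_into_rtrancl)
    qed (use vU in auto)
    then show ?thesis using hd by simp
  qed
  have col: "c x \<noteq> c y" if "{x, y} \<in> F" for x y
    using bip.colour[of x y] that by (simp add: F_def induced_edges_def)
  have "card {e \<in> cycle_edges ?p. \<epsilon> e = -1} mod 2 = (length ?p div 2 + 1 + card (vertices_inside ?p U)) mod 2"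
  proof (rule kasteleyn_cycle[OF sub pF con col])
    fix f assume "f \<in> faces pos \<gamma> U F" "bounded f"
    then show "face_minus_signs pos \<gamma> U F \<epsilon> f mod 2 = (face_length pos \<gamma> U F f div 2 + 1) mod 2"
      using ks comp unfolding kasteleyn_signs_def F_def by blast
  qed
  from even_iff_of_mod_add[OF this even_vertices_inside[OF \<sigma> v UV closed]]
  have par: "even (card {e \<in> ?C. \<epsilon> e = -1}) \<longleftrightarrow> even (card (orbit \<sigma> v) div 2 + 1)"
    unfolding CE orbit_list_props(4)[OF perm] .
  have fO: "finite (orbit \<sigma> v)" by (rule finite_subset[OF subset_trans[OF OU UV] finite_V])
  have \<epsilon>: "\<epsilon> e = (if \<epsilon> e = -1 then -1 else 1)" if "e \<in> ?C" for e
  proof -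
    have "e \<in> E" using that CE p by (auto simp: simple_cycle_iff)
    then show ?thesis using ks by (auto simp: kasteleyn_signs_def)
  qed
  \<comment> \<open>A long orbit has as many edges as vertices, so the product over its vertices can
    be taken over its edges.\<close>
  have "inj_on (\<lambda>u. {u, \<sigma> u}) (orbit \<sigma> v)"
    using bip.card_orbit_edges[OF \<sigma> v] by (intro eq_card_imp_inj_on[OF fO]) (simp add: orbit_edges_def)
  then have "(\<Prod>u\<in>orbit \<sigma> v. \<epsilon> {u, \<sigma> u}) = (\<Prod>e\<in>?C. \<epsilon> e)"
    unfolding orbit_edges_def by (simp add: prod.reindex)
  also have "\<dots> = (\<Prod>e\<in>?C. if \<epsilon> e = -1 then -1 else 1)" using \<epsilon> by (intro prod.cong) auto
  also have "\<dots> = (-1) ^ card {e \<in> ?C. \<epsilon> e = -1}"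
    using fO by (simp add: prod.If_cases orbit_edges_def Int_def)
  also have "\<dots> = (-1) ^ (card (orbit \<sigma> v) div 2 + 1)"
    using par by (simp only: minus_one_power_iff)
  finally show ?thesis .
qed

end

theorem theorem2:
  fixes V :: "'v set" and E :: "'v set set"
    and pos :: "'v \<Rightarrow> complex" and \<gamma> :: "'v set \<Rightarrow> real \<Rightarrow> complex"
    and \<nu> \<epsilon> :: "'v set \<Rightarrow> real" and \<phi> :: "'v \<Rightarrow> 'v \<Rightarrow> complex^2^2"
  assumes "bipartite_graph V E"
    and "plane_embedding V E pos \<gamma>"
    and "\<forall>e\<in>E. \<nu> e > 0"
    and "SL2_connection E \<phi>"
    and "kasteleyn_signs V E pos \<gamma> \<epsilon>"
  shows "Z_dd V E \<nu> \<phi> = (-1) ^ (card V div 2) * Qdet V (kasteleyn_matrix E \<epsilon> \<nu> \<phi>)"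
proof -
  obtain B W where BW: "B \<inter> W = {}" "\<forall>e\<in>E. \<exists>b\<in>B. \<exists>w\<in>W. e = {b, w}" and simple: "simple_graph V E"
    using assms(1) unfolding bipartite_graph_def by blast
  interpret bipartite_plane_graph V E pos \<gamma> "\<lambda>v. v \<in> B"
  proof unfold_locales
    show "(u \<in> B) \<noteq> (v \<in> B)" if "{u, v} \<in> E" for u v
      using BW that by (force simp: doubleton_eq_iff)
  qed (use simple assms(2) in auto)
  show ?thesis
    using assms(4,5) prod_signs_orbit[OF assms(5)]
    by (intro bip.Z_dd_eq_Qdet) (auto simp: kasteleyn_signs_def)
qed

end
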